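(* Let $p$ be an odd prime and $x\in\mathbb{F}_p$ with $x\neq 0,1$. Then \[ {_3G}_{3}\left[\begin{array}{ccc}\frac{1}{2}, & \frac{1}{2}, & \frac{1}{2}\\ 0, & 0, & 0\end{array}\Big|\frac{1}{x}\right]_p=\varphi(1-x)\cdot{_2G}_{2}\left[\begin{array}{cc}\frac{1}{4}, & \frac{3}{4}\\ 0, & 0\end{array}\Big|\frac{x-1}{x}\right]_p^2-p\cdot\varphi(1-x). \]
   Context: $\varphi$ is the quadratic character of $\mathbb{F}_p^\times$ with $\varphi(0)=0$. Let $\omega:\mathbb{F}_p^\times\to\mathbb{Z}_p^\times$ be the Teichmüller character, $\overline{\omega}$ its inverse ($\overline{\omega}^a(0)=0$), $\Gamma_p$ Morita's $p$-adic gamma function, $\langle y\rangle=y-\lfloor y\rfloor$. For $t\in\mathbb{F}_p$ and $a_k,b_k\in\mathbb{Q}\cap\mathbb{Z}_p$, \[ {_nG}_n\left[\begin{array}{ccc}a_1,&\ldots,&a_n\\ b_1,&\ldots,&b_n\end{array}\Big|t\right]_p:=\frac{-1}{p-1}\sum_{a=0}^{p-2}(-1)^{an}\,\overline{\omega}^a(t)\prod_{k=1}^n(-p)^{-\lfloor\langle a_k\rangle-\frac{a}{p-1}\rfloor-\lfloor\langle -b_k\rangle+\frac{a}{p-1}\rfloor}\frac{\Gamma_p(\langle a_k-\frac{a}{p-1}\rangle)}{\Gamma_p(\langle a_k\rangle)}\frac{\Gamma_p(\langle-b_k+\frac{a}{p-1}\rangle)}{\Gamma_p(\langle -b_k\rangle)}.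 \] *)

theory Defs
  imports Complex_Main
    "Berlekamp_Zassenhaus.Finite_Field"
    "HOL-Computational_Algebra.Fraction_Field"
begin

section \<open>The $p$-adic integers\<close>

text \<open>
  The prime $p$ is the cardinality of a type of class \<^class>\<open>prime_card\<close>, so that
  \<^typ>\<open>'p mod_ring\<close> is the field of $p$ elements.  The ring of $p$-adic integers is the inverse
  limit of the rings of residues modulo $p^n$; residues are represented by the integers
  in $\{0, \ldots, p^n - 1\}$.
\<close>

typedef (overloaded) ('p :: prime_card) padic_int =
  "{f :: nat \<Rightarrow> int. \<forall>n. f n = f (Suc n) mod int CARD('p) ^ n}"
  morphisms padic_res Abs_padic_int
  by (rule exI[of _ "\<lambda>_. 0"]) simp

setup_lifting type_definition_padic_int

lemma mod_power_Suc_cancel: "(a mod (p :: int) ^ Suc n) mod p ^ n = a mod p ^ n"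
  by (rule mod_mod_cancel) (rule le_imp_power_dvd, simp)

context
  fixes f g :: "nat \<Rightarrow> int" and p :: int
  assumes f: "\<forall>n. f n = f (Suc n) mod p ^ n"
begin

lemma coherent_mod: "f n mod p ^ n = f n"
proof -
  have "f n = f (Suc n) mod p ^ n" using f by blast
  then show ?thesis by simp
qed

lemma coherent_uminus: "(- f n) mod p ^ n = (- f (Suc n)) mod p ^ Suc n mod p ^ n"
  unfolding mod_power_Suc_cancel
  using mod_minus_eq[of "f (Suc n)" "p ^ n"]
  by (simp only: f[rule_format, of n, symmetric])

lemma coherent_plus:
  assumes g: "\<forall>n. g n = g (Suc n) mod p ^ n"
  shows "(f n + g n) mod p ^ n = (f (Suc n) + g (Suc n)) mod p ^ Suc n mod p ^ n"
  unfolding mod_power_Suc_cancel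
  using mod_add_eq[of "f (Suc n)" "p ^ n" "g (Suc n)"]
  by (simp only: f[rule_format, of n, symmetric] g[rule_format, of n, symmetric])

lemma coherent_minus:
  assumes g: "\<forall>n. g n = g (Suc n) mod p ^ n"
  shows "(f n - g n) mod p ^ n = (f (Suc n) - g (Suc n)) mod p ^ Suc n mod p ^ n"
  unfolding mod_power_Suc_cancel
  using mod_diff_eq[of "f (Suc n)" "p ^ n" "g (Suc n)"]
  by (simp only: f[rule_format, of n, symmetric] g[rule_format, of n, symmetric])

lemma coherent_times:
  assumes g: "\<forall>n. g n = g (Suc n) mod p ^ n"
  shows "(f n * g n) mod p ^ n = (f (Suc n) * g (Suc n)) mod p ^ Suc n mod p ^ n"
  unfolding mod_power_Suc_cancel
  using mod_mult_eq[of "f (Suc n)" "p ^ n" "g (Suc n)"]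
  by (simp only: f[rule_format, of n, symmetric] g[rule_format, of n, symmetric])

end

lemma padic_res_mod: "padic_res x n mod int CARD('p) ^ n = padic_res (x :: 'p :: prime_card padic_int) n"
  by transfer (rule coherent_mod)

lemma padic_int_eq_iff: "x = y \<longleftrightarrow> (\<forall>n. padic_res x n = padic_res y n)"
  by (metis ext padic_res_inject)

instantiation padic_int :: (prime_card) comm_ring_1
begin

lift_definition zero_padic_int :: "'a padic_int" is "\<lambda>_. 0" by simp

lift_definition one_padic_int :: "'a padic_int" is "\<lambda>n. 1 mod int CARD('a) ^ n"
  by (simp only: mod_power_Suc_cancel simp_thms)

lift_definition plus_padic_int :: "'a padic_int \<Rightarrow> 'a padic_int \<Rightarrow> 'a padic_int"
  is "\<lambda>f g n. (f n + g n) mod int CARD('a) ^ n"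
  using coherent_plus by blast

lift_definition minus_padic_int :: "'a padic_int \<Rightarrow> 'a padic_int \<Rightarrow> 'a padic_int"
  is "\<lambda>f g n. (f n - g n) mod int CARD('a) ^ n"
  using coherent_minus by blast

lift_definition uminus_padic_int :: "'a padic_int \<Rightarrow> 'a padic_int"
  is "\<lambda>f n. (- f n) mod int CARD('a) ^ n"
  using coherent_uminus by blast

lift_definition times_padic_int :: "'a padic_int \<Rightarrow> 'a padic_int \<Rightarrow> 'a padic_int"
  is "\<lambda>f g n. (f n * g n) mod int CARD('a) ^ n"
  using coherent_times by blast

instance
proof
  fix a b c :: "'a padic_int"
  note rep_eqs = padic_int_eq_iff zero_padic_int.rep_eq one_padic_int.rep_eq
    plus_padic_int.rep_eq minus_padic_int.rep_eq uminus_padic_int.rep_eq times_padic_int.rep_eq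
  show "a * b * c = a * (b * c)"
    by (simp only: rep_eqs simp_thms mod_mult_left_eq mod_mult_right_eq mult.assoc)
  show "a * b = b * a" by (simp add: rep_eqs mult.commute)
  show "1 * a = a" by (simp add: rep_eqs mod_mult_left_eq padic_res_mod)
  show "a + b + c = a + (b + c)"
    by (simp only: rep_eqs simp_thms mod_add_left_eq mod_add_right_eq add.assoc)
  show "a + b = b + a" by (simp add: rep_eqs add.commute)
  show "0 + a = a" by (simp add: rep_eqs padic_res_mod)
  show "- a + a = 0" by (simp add: rep_eqs mod_add_left_eq)
  show "a - b = a + - b" by (simp add: rep_eqs mod_add_right_eq)
  show "(a + b) * c = a * c + b * c"
    by (simp only: rep_eqs simp_thms mod_mult_left_eq mod_add_eq distrib_right)
  show "(0 :: 'a padic_int) \<noteq> 1"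
  proof
    assume "(0 :: 'a padic_int) = 1"
    then have "padic_res (0 :: 'a padic_int) 1 = padic_res (1 :: 'a padic_int) 1" by simp
    moreover have "1 mod int CARD('a) = 1"
      using nontriv[where ?'a = 'a] by (intro mod_pos_pos_trivial) auto
    ultimately show False by (simp add: zero_padic_int.rep_eq one_padic_int.rep_eq)
  qed
qed

end

lemma padic_res_mod_le:
  "m \<le> n \<Longrightarrow> padic_res x n mod int CARD('p) ^ m = padic_res (x :: 'p :: prime_card padic_int) m"
proof (induction n rule: dec_induct)
  case base
  show ?case by (rule padic_res_mod)
next
  case (step n)
  have "padic_res x n = padic_res x (Suc n) mod int CARD('p) ^ n"
    using padic_res[of x] by blast
  then have "padic_res x m = padic_res x (Suc n) mod int CARD('p) ^ n mod int CARD('p) ^ m"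
    using step.IH by simp
  also have "\<dots> = padic_res x (Suc n) mod int CARD('p) ^ m"
    by (rule mod_mod_cancel) (use step.hyps in \<open>simp add: le_imp_power_dvd\<close>)
  finally show ?case by simp
qed

instance padic_int :: (prime_card) idom
proof
  fix a b :: "'a padic_int"
  let ?p = "int CARD('a)"
  assume "a \<noteq> 0" "b \<noteq> 0"
  then obtain i j where i: "padic_res a i \<noteq> 0" and j: "padic_res b j \<noteq> 0"
    by (auto simp: padic_int_eq_iff zero_padic_int.rep_eq)
  have p: "prime ?p" using prime_card_int .
  define x y where "x = padic_res a (i + j)" and "y = padic_res b (i + j)"
  have "\<not> ?p ^ i dvd x" "\<not> ?p ^ j dvd y"
    using i j padic_res_mod_le[of i "i + j" a] padic_res_mod_le[of j "i + j" b]
    by (auto simp: x_def y_def dvd_eq_mod_eq_0)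
  moreover from this have nz: "x \<noteq> 0" "y \<noteq> 0" by auto
  ultimately have "multiplicity ?p x < i" "multiplicity ?p y < j"
    using multiplicity_dvd'[of i ?p x] multiplicity_dvd'[of j ?p y] by linarith+
  then have "multiplicity ?p (x * y) < i + j"
    using p nz by (simp add: prime_elem_multiplicity_mult_distrib)
  then have "\<not> ?p ^ (i + j) dvd x * y"
    using p nz by (subst power_dvd_iff_le_multiplicity) auto
  then have "padic_res (a * b) (i + j) \<noteq> 0"
    by (simp add: times_padic_int.rep_eq x_def y_def dvd_eq_mod_eq_0)
  then show "a * b \<noteq> 0" by (auto simp: zero_padic_int.rep_eq)
qed

lemma padic_res_of_nat:
  "padic_res (of_nat m :: 'p :: prime_card padic_int) n = int m mod int CARD('p) ^ n"
  by (induction m)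
     (simp_all add: zero_padic_int.rep_eq plus_padic_int.rep_eq one_padic_int.rep_eq mod_simps)

instance padic_int :: (prime_card) ring_char_0
proof
  show "inj (of_nat :: nat \<Rightarrow> 'a padic_int)"
  proof (rule injI)
    fix m n :: nat
    assume eq: "of_nat m = (of_nat n :: 'a padic_int)"
    define k where "k = m + n"
    have "1 < CARD('a)" by (rule nontriv)
    then have "k < CARD('a) ^ k" by (intro power_gt_expt) simp
    then have "int m < int CARD('a) ^ k" "int n < int CARD('a) ^ k"
      unfolding of_nat_power[symmetric] of_nat_less_iff by (simp_all add: k_def)
    moreover have "int m mod int CARD('a) ^ k = int n mod int CARD('a) ^ k"
      using eq by (metis padic_res_of_nat)
    ultimately show "m = n" by simp
  qed
qed


subsection \<open>The $p$-adic metric\<close>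

definition padic_val :: "'p :: prime_card padic_int \<Rightarrow> nat" where
  "padic_val x = (LEAST n. padic_res x (Suc n) \<noteq> 0)"

definition padic_abs :: "'p :: prime_card padic_int \<Rightarrow> real" where
  "padic_abs x = (if x = 0 then 0 else inverse (real CARD('p)) ^ padic_val x)"

lemma padic_val_ge_iff:
  fixes x :: "'p :: prime_card padic_int"
  assumes "x \<noteq> 0"
  shows "n \<le> padic_val x \<longleftrightarrow> padic_res x n = 0"
proof -
  from assms obtain k where k: "padic_res x k \<noteq> 0"
    by (auto simp: padic_int_eq_iff zero_padic_int.rep_eq)
  have r0: "padic_res x 0 = 0" using padic_res_mod[of x 0] by simp
  with k obtain j where "padic_res x (Suc j) \<noteq> 0" by (cases k) auto
  then have *: "padic_res x (Suc (padic_val x)) \<noteq> 0"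
    unfolding padic_val_def by (rule LeastI)
  have **: "padic_res x (Suc i) = 0" if "i < padic_val x" for i
    using that not_less_Least unfolding padic_val_def by blast
  show ?thesis
  proof
    assume "n \<le> padic_val x"
    then show "padic_res x n = 0" using r0 ** by (cases n) auto
  next
    assume n: "padic_res x n = 0"
    show "n \<le> padic_val x"
    proof (rule ccontr)
      assume "\<not> n \<le> padic_val x"
      then have "padic_res x (Suc (padic_val x)) = padic_res x n mod int CARD('p) ^ Suc (padic_val x)"
        by (metis Suc_leI not_le padic_res_mod_le)
      with * n show False by simp
    qed
  qed
qed

lemma padic_abs_le_iff:
  fixes x :: "'p :: prime_card padic_int"
  shows "padic_abs x \<le> inverse (real CARD('p)) ^ n \<longleftrightarrow> padic_res x n = 0"
proof (cases "x = 0")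
  case False
  have "1 < real CARD('p)" using nontriv[where ?'a = 'p] by simp
  then have "inverse (real CARD('p)) ^ padic_val x \<le> inverse (real CARD('p)) ^ n \<longleftrightarrow> n \<le> padic_val x"
    by (intro power_decreasing_iff) (auto simp: field_simps)
  with False show ?thesis by (simp add: padic_abs_def padic_val_ge_iff)
qed (simp add: padic_abs_def zero_padic_int.rep_eq)

lemma padic_abs_add_le: "padic_abs (x + y) \<le> max (padic_abs x) (padic_abs y)"
  for x y :: "'p :: prime_card padic_int"
proof (cases "x = 0 \<or> y = 0")
  case False
  define n where "n = min (padic_val x) (padic_val y)"
  have "padic_res (x + y) n = 0"
    using False padic_val_ge_iff[of x n] padic_val_ge_iff[of y n]
    by (simp add: plus_padic_int.rep_eq n_def)
  then have "padic_abs (x + y) \<le> inverse (real CARD('p)) ^ n" by (simp add: padic_abs_le_iff)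
  also have "\<dots> \<le> max (padic_abs x) (padic_abs y)"
    using False by (auto simp: padic_abs_def n_def min_def)
  finally show ?thesis .
qed (auto simp: padic_abs_def)

lemma padic_abs_minus: "padic_abs (- x) = padic_abs (x :: 'p :: prime_card padic_int)"
proof -
  have "padic_res (- x) n = 0 \<longleftrightarrow> padic_res x n = 0" for n
    by (metis dvd_eq_mod_eq_0 dvd_minus_iff padic_res_mod uminus_padic_int.rep_eq)
  then show ?thesis by (simp add: padic_abs_def padic_val_def)
qed

instantiation padic_int :: (prime_card) metric_space
begin

definition dist_padic_int :: "'a padic_int \<Rightarrow> 'a padic_int \<Rightarrow> real" where
  "dist_padic_int x y = padic_abs (x - y)"

definition uniformity_padic_int :: "('a padic_int \<times> 'a padic_int) filter" where
  "uniformity_padic_int = (INF e\<in>{0<..}. principal {(x, y). dist x y < e})"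

definition open_padic_int :: "'a padic_int set \<Rightarrow> bool" where
  "open_padic_int U \<longleftrightarrow> (\<forall>x\<in>U. eventually (\<lambda>(x', y). x' = x \<longrightarrow> y \<in> U) uniformity)"

instance
proof
  fix x y z :: "'a padic_int"
  show "dist x y = 0 \<longleftrightarrow> x = y" by (auto simp: dist_padic_int_def padic_abs_def)
  have nonneg: "0 \<le> padic_abs (u :: 'a padic_int)" for u by (simp add: padic_abs_def)
  have "padic_abs (x - y) \<le> max (padic_abs (x - z)) (padic_abs (- (y - z)))"
    using padic_abs_add_le[of "x - z" "- (y - z)"] by simp
  then have "padic_abs (x - y) \<le> max (padic_abs (x - z)) (padic_abs (y - z))"
    by (simp only: padic_abs_minus)
  then show "dist x y \<le> dist x z + dist y z"
    using nonneg[of "x - z"] nonneg[of "y - z"] by (simp add: dist_padic_int_def)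
qed (simp_all add: uniformity_padic_int_def open_padic_int_def)

end


section \<open>The field of $p$-adic numbers\<close>

type_synonym 'p padic = "'p padic_int fract"

abbreviation padic_of_int :: "'p :: prime_card padic_int \<Rightarrow> 'p padic" where
  "padic_of_int z \<equiv> Fraction_Field.Fract z 1"

instance fract :: ("{idom, ring_char_0}") field_char_0
proof
  have "of_nat n = Fraction_Field.Fract (of_nat n :: 'a) 1" for n
    by (induction n) (simp_all add: Fraction_Field.Zero_fract_def Fraction_Field.One_fract_def)
  then show "inj (of_nat :: nat \<Rightarrow> 'a fract)"
    by (auto intro!: injI simp: Fraction_Field.eq_fract)
qed

text \<open>The inclusion of $\mathbb{Q} \cap \mathbb{Z}_p$ into $\mathbb{Z}_p$.\<close>

definition padic_int_of_rat :: "rat \<Rightarrow> 'p :: prime_card padic_int" where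
  "padic_int_of_rat r = (THE z. padic_of_int z = of_rat r)"


section \<open>Characters of the prime field\<close>

definition quad_char :: "'p :: prime_card mod_ring \<Rightarrow> int" where
  "quad_char t = Legendre (to_int_mod_ring t) (int CARD('p))"

text \<open>
  For $t \neq 0$, the Teichmueller representative of $t$ is the $(p-1)$-st root of unity
  in $\mathbb{Z}_p$ that reduces to $t$ modulo $p$.
\<close>

definition teichmueller :: "'p :: prime_card mod_ring \<Rightarrow> 'p padic_int" where
  "teichmueller t = (THE w. w ^ (CARD('p) - 1) = 1 \<and> padic_res w 1 = to_int_mod_ring t)"

text \<open>
  The $a$-th power of the inverse Teichmueller character, extended by $0$ to $t = 0$,
  also when $a = 0$.
\<close>

definition teichmueller_bar_power :: "nat \<Rightarrow> 'p :: prime_card mod_ring \<Rightarrow> 'p padic" where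
  "teichmueller_bar_power a t =
     (if t = 0 then 0 else inverse (padic_of_int (teichmueller t)) ^ a)"


section \<open>Morita's $p$-adic gamma function\<close>

text \<open>
  $\Gamma_p(x)$ is the limit of $(-1)^n \prod_{0 < j < n,\ p \nmid j} j$ as the natural
  number $n$ tends to $x$ in the $p$-adic metric.  The filter contains the value at $n = x$ if $x$
  is itself a natural number, so that $\Gamma_p(n)$ is then given by this formula; in
  particular $\Gamma_p(0) = 1$.
\<close>

definition morita_Gamma :: "'p :: prime_card padic_int \<Rightarrow> 'p padic_int" where
  "morita_Gamma x = Lim (filtercomap of_nat (nhds x))
     (\<lambda>n :: nat. (- 1) ^ n * of_nat (\<Prod>j | 0 < j \<and> j < n \<and> \<not> CARD('p) dvd j. j))"

definition Gamma_rat :: "rat \<Rightarrow> 'p :: prime_card padic" where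
  "Gamma_rat r = padic_of_int (morita_Gamma (padic_int_of_rat r))"


section \<open>The $p$-adic hypergeometric function ${}_nG_n$\<close>

text \<open>
  The parameters $a_1, \ldots, a_n$ and $b_1, \ldots, b_n$ are given as lists of equal length $n$
  of rational numbers that are $p$-adically integral.
\<close>

definition nGn :: "rat list \<Rightarrow> rat list \<Rightarrow> 'p :: prime_card mod_ring \<Rightarrow> 'p padic" where
  "nGn as bs t =
     (- 1) / of_nat (CARD('p) - 1) *
     (\<Sum>a = 0..CARD('p) - 2.
        (- 1) ^ (a * length as) * teichmueller_bar_power a t *
        (\<Prod>k < length as.
           let q = of_nat a / of_nat (CARD('p) - 1) in
           (- of_nat CARD('p)) powi (- \<lfloor>frac (as ! k) - q\<rfloor> - \<lfloor>frac (- (bs ! k)) + q\<rfloor>) *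
           (Gamma_rat (frac (as ! k - q)) / Gamma_rat (frac (as ! k))) *
           (Gamma_rat (frac (- (bs ! k) + q)) / Gamma_rat (frac (- (bs ! k))))))"

end

theory Submission
  imports Defs
    "HOL-Algebra.Algebraic_Closure_Type"
    "HOL-Computational_Algebra.Formal_Laurent_Series"
    "HOL-Number_Theory.Euler_Criterion"
begin

text \<open>
  Let $\pi^{p-1} = -p$. Dwork's series $\exp(\pi (X - X^p))$ evaluated at Teichmueller
  representatives is an additive character of the field of $p$ elements, and its Gauss sums are
  $-\pi^a \Gamma_p(a/(p-1))$. Following Boyarsky and Robert, both $\Gamma_p(a/(p-1))$ and the Gauss
  sum are convergent series in the coefficients of $\exp(X + X^p/p)$, and the recurrence
  $n c_n = c_{n-1} + c_{n-p}$ transforms one into the other.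

  Together with the duplication formula for $\Gamma_p$ this turns the summands of both
  hypergeometric functions into Jacobi sums, and orthogonality of characters gives, with
  $k = -1/x$ and $m = k + 1 = (x-1)/x$,
  ${}_3G_3 = \varphi(k) \sum_{u,v} \varphi(1+u)\varphi(1+v)\varphi(1+k/(uv))$ and
  ${}_2G_2 = -\varphi(m) B$ where $B = \sum_v \varphi(1+v)\varphi(mv^2-1)$.

  It remains to see that the first sum is $\varphi(m)(B^2 - p)$. Expand $B^2$ in the elementary symmetric
  functions $s$, $P$ of the two variables; a pair $(s, P)$ occurs $1 + \varphi(s^2 - 4P)$ times. The
  part without the factor $\varphi(s^2-4P)$ is $p$. In the other part, the sum over $P$ for fixed
  $1 + s + P$ is a sum over a curve of genus one, and replacing that curve by a 2-isogenous one
  leads to the required sum.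
\<close>

section \<open>Divisibility in the $p$-adic integers\<close>

text \<open>Gauss sums reach Gamma_p only at multiples of 1/(p - 1). The parameter 1/2 is such a
  multiple, but 1/4 is not when p is 3 modulo 4. This is what the duplication formula is for: it
  trades the pair 1/4 - a/(p - 1) and 3/4 - a/(p - 1), whose members differ by 1/2, for admissible
  arguments.

  Convergence at pi is the analytic difficulty. The coefficients of exp(X + X^p/p) are not visibly
  small enough, and exp itself diverges at pi. The bound comes from Gamma_p: up to the factor (-p)^k
  k!, the coefficients are k-th differences of Gamma_p along an arithmetic progression of step p,
  and such a difference is divisible by about p^(k/2). The same function thus supplies the values
  and controls the convergence.

  All limits are taken in the p-adic numbers. The algebraic closure carries no topology; it only
  holds pi as an algebraic element, and pi cancels as soon as Gauss sums are turned into Jacobi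
  sums.\<close>

abbreviation padic_p :: "'p :: prime_card padic_int" where
  "padic_p \<equiv> of_nat CARD('p)"

lemma dvd_diff_swap: "(a :: 'a :: comm_ring_1) dvd x - y \<Longrightarrow> a dvd y - x"
  by (metis dvd_minus_iff minus_diff_eq)

lemma CARD_gt_1: "1 < CARD('p :: prime_card)"
  using nontriv by blast

lemma CARD_ge_3:
  assumes "odd CARD('p :: prime_card)"
  shows "3 \<le> CARD('p)"
proof -
  have "CARD('p) \<noteq> 2" using assms by auto
  then show ?thesis using CARD_gt_1[where 'p='p] by linarith
qed

lemma padic_res_of_int:
  "padic_res (of_int z :: 'p :: prime_card padic_int) n = z mod int CARD('p) ^ n"
proof -
  obtain a b where z: "z = int a - int b" by (rule int_diff_cases)
  show ?thesis
    by (simp add: z minus_padic_int.rep_eq padic_res_of_nat mod_simps)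
qed

text \<open>The ideal generated by p^n is the ball of radius p^-n around 0, so divisibility can
  replace the metric. The quotient is obtained by dropping the last n digits of x.\<close>

lemma padic_power_dvd_iff:
  "padic_p ^ n dvd x \<longleftrightarrow> padic_res (x :: 'p :: prime_card padic_int) n = 0"
proof
  assume "padic_p ^ n dvd x"
  then obtain y where "x = of_nat (CARD('p) ^ n) * y" by auto
  then show "padic_res x n = 0"
    by (simp only: times_padic_int.rep_eq padic_res_of_nat) simp
next
  assume x: "padic_res x n = 0"
  let ?p = "int CARD('p)"
  define f where "f k = padic_res x (n + k) div ?p ^ n" for k
  have p0: "?p > 0" by simp
  have res: "padic_res x k = padic_res x (Suc k) mod ?p ^ k" for k
    using padic_res[of x] by blast
  have coh: "f k = f (Suc k) mod ?p ^ k" for k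
  proof -
    have "f k = (padic_res x (Suc (n + k)) mod ?p ^ (n + k)) div ?p ^ n"
      using res[of "n + k"] by (simp add: f_def)
    also have "\<dots> = f (Suc k) mod ?p ^ k"
      using p0 zmod_zmult2_eq[of "?p ^ k" "padic_res x (Suc (n + k))" "?p ^ n"]
      by (simp add: f_def power_add)
    finally show ?thesis .
  qed
  define y :: "'p padic_int" where "y = Abs_padic_int f"
  have y: "padic_res y = f" unfolding y_def by (rule Abs_padic_int_inverse) (use coh in blast)
  have "x = of_nat (CARD('p) ^ n) * y"
  proof (subst padic_int_eq_iff, rule allI)
    fix k
    have "padic_res x (n + k) mod ?p ^ n = 0"
      using padic_res_mod_le[of n "n + k" x] x by simp
    then have "?p ^ n * f k = padic_res x (n + k)"
      by (simp add: f_def dvd_eq_mod_eq_0)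
    moreover have "padic_res (of_nat (CARD('p) ^ n) * y) k = int (CARD('p) ^ n) * f k mod ?p ^ k"
      by (simp only: times_padic_int.rep_eq padic_res_of_nat y mod_mult_left_eq)
    ultimately have "padic_res (of_nat (CARD('p) ^ n) * y) k = padic_res x (n + k) mod ?p ^ k"
      by (simp only: of_nat_power)
    also have "\<dots> = padic_res x k" by (rule padic_res_mod_le) simp
    finally show "padic_res x k = padic_res (of_nat (CARD('p) ^ n) * y) k" by simp
  qed
  then show "padic_p ^ n dvd x" by simp
qed

lemma padic_power_dvd_of_int_iff:
  "padic_p ^ n dvd (of_int z :: 'p :: prime_card padic_int) \<longleftrightarrow> int CARD('p) ^ n dvd z"
  by (simp add: padic_power_dvd_iff padic_res_of_int dvd_eq_mod_eq_0)

lemma padic_p_dvd_of_int_iff: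
  "padic_p dvd (of_int z :: 'p :: prime_card padic_int) \<longleftrightarrow> int CARD('p) dvd z"
  using padic_power_dvd_of_int_iff[of 1 z] by simp

lemma padic_power_dvd_of_nat_iff:
  "padic_p ^ n dvd (of_nat m :: 'p :: prime_card padic_int) \<longleftrightarrow> CARD('p) ^ n dvd m"
  using padic_power_dvd_of_int_iff[of n "int m", where 'p='p]
  by (simp flip: of_nat_power)

lemma padic_p_dvd_of_nat_iff:
  "padic_p dvd (of_nat m :: 'p :: prime_card padic_int) \<longleftrightarrow> CARD('p) dvd m"
  using padic_power_dvd_of_nat_iff[of 1 m] by simp

lemma padic_eqI:
  fixes x y :: "'p :: prime_card padic_int"
  assumes "\<And>n. padic_p ^ n dvd x - y"
  shows "x = y"
proof -
  have "x - y = 0" using assms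
    by (subst padic_int_eq_iff) (simp add: padic_power_dvd_iff zero_padic_int.rep_eq)
  then show ?thesis by simp
qed

lemma padic_approx_nat:
  fixes x :: "'p :: prime_card padic_int"
  obtains m :: nat where "padic_p ^ n dvd x - of_nat m"
proof
  have "padic_res x n \<ge> 0" 
    by (subst padic_res_mod[symmetric]) simp
  then show "padic_p ^ n dvd x - of_nat (nat (padic_res x n))"
    by (simp add: padic_power_dvd_iff minus_padic_int.rep_eq padic_res_of_int padic_res_mod)
qed

text \<open>Term \<open>f n\<close> agrees with the limit modulo p^n, so the limit takes its n-th
  residue from \<open>f n\<close>; the hypothesis is exactly the coherence of this diagonal.\<close>

lemma padic_complete:
  fixes f :: "nat \<Rightarrow> 'p :: prime_card padic_int"
  assumes "\<And>n. padic_p ^ n dvd f (Suc n) - f n"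
  obtains x where "\<And>n. padic_p ^ n dvd x - f n"
proof
  have coh: "padic_res (f n) n = padic_res (f (Suc n)) (Suc n) mod int CARD('p) ^ n" for n
  proof -
    have "padic_res (f (Suc n) - f n) n = 0"
      using assms[of n] by (simp add: padic_power_dvd_iff)
    then have "padic_res (f (Suc n)) n mod int CARD('p) ^ n = padic_res (f n) n mod int CARD('p) ^ n"
      by (simp add: minus_padic_int.rep_eq mod_eq_dvd_iff dvd_eq_mod_eq_0)
    then have "padic_res (f (Suc n)) n = padic_res (f n) n" by (simp add: padic_res_mod)
    moreover have "padic_res (f (Suc n)) (Suc n) mod int CARD('p) ^ n = padic_res (f (Suc n)) n"
      by (rule padic_res_mod_le) simp
    ultimately show ?thesis by simp
  qed
  define x :: "'p padic_int" where "x = Abs_padic_int (\<lambda>n. padic_res (f n) n)"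
  have x: "padic_res x = (\<lambda>n. padic_res (f n) n)"
    unfolding x_def by (rule Abs_padic_int_inverse) (use coh in blast)
  show "padic_p ^ n dvd x - f n" for n
    by (simp add: padic_power_dvd_iff minus_padic_int.rep_eq x)
qed

lemma padic_p_dvd_mult_iff:
  "padic_p dvd x * y \<longleftrightarrow> padic_p dvd x \<or> padic_p dvd (y :: 'p :: prime_card padic_int)"
proof
  assume xy: "padic_p dvd x * y"
  obtain m where m: "padic_p dvd x - of_nat m" using padic_approx_nat[of 1 x] by auto
  obtain n where n: "padic_p dvd y - of_nat n" using padic_approx_nat[of 1 y] by auto
  have "padic_p dvd x * y - ((x - of_nat m) * y + of_nat m * (y - of_nat n))"
    using xy m n by (intro dvd_diff dvd_add) auto
  then have "padic_p dvd (of_nat (m * n) :: 'p padic_int)" by (simp add: algebra_simps)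
  then have "CARD('p) dvd m \<or> CARD('p) dvd n"
    by (subst (asm) padic_p_dvd_of_nat_iff) (simp add: prime_dvd_mult_iff prime_card)
  then have "padic_p dvd (of_nat m :: 'p padic_int) \<or> padic_p dvd (of_nat n :: 'p padic_int)"
    by (simp add: padic_p_dvd_of_nat_iff)
  then show "padic_p dvd x \<or> padic_p dvd y"
    using dvd_add[OF m, of "of_nat m"] dvd_add[OF n, of "of_nat n"] by auto
qed auto

lemma padic_p_not_unit: "\<not> padic_p dvd (1 :: 'p :: prime_card padic_int)"
  using padic_p_dvd_of_nat_iff[of 1] CARD_gt_1[where 'p='p] by auto

lemma padic_p_neq_0: "(padic_p :: 'p :: prime_card padic_int) \<noteq> 0"
  by simp

lemma padic_power_dvd_mult_cancel:
  fixes x u :: "'p :: prime_card padic_int"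
  assumes "\<not> padic_p dvd u" "padic_p ^ n dvd x * u"
  shows "padic_p ^ n dvd x"
  using assms(2)
proof (induction n arbitrary: x)
  case (Suc n)
  have "padic_p dvd padic_p ^ Suc n" by simp
  then have "padic_p dvd x * u" using Suc.prems by (rule dvd_trans)
  then obtain y where y: "x = padic_p * y" using assms(1) unfolding padic_p_dvd_mult_iff by (auto elim: dvdE)
  have "padic_p * padic_p ^ n dvd padic_p * (y * u)"
    using Suc.prems unfolding y power_Suc mult.assoc .
  then have "padic_p ^ n dvd y * u"
    unfolding dvd_times_left_cancel_iff[OF padic_p_neq_0] .
  from Suc.IH[OF this] show ?case unfolding y power_Suc by (rule mult_dvd_mono[OF dvd_refl])
qed simp

text \<open>An inverse modulo p turns x into 1 - w with w divisible by p, and the geometric series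
  inverts 1 - w.\<close>

lemma padic_inverse:
  fixes x :: "'p :: prime_card padic_int"
  assumes "\<not> padic_p dvd x"
  obtains y where "x * y = 1"
proof -
  obtain m where m: "padic_p dvd x - of_nat m" using padic_approx_nat[of 1 x] by auto
  have "\<not> CARD('p) dvd m"
    using assms dvd_add[OF m, of "of_nat m"] padic_p_dvd_of_nat_iff[of m] by auto
  then have "coprime m CARD('p)"
    using prime_card[where 'a='p] prime_imp_coprime coprime_commute by metis
  then obtain n where "[m * n = 1] (mod CARD('p))"
    by (metis cong_solve_coprime_nat One_nat_def)
  then have "[int (m * n) = int 1] (mod int CARD('p))" unfolding cong_int_iff .
  then have "int CARD('p) dvd int (m * n) - 1" by (simp add: cong_iff_dvd_diff)
  then have "padic_p dvd (of_int (int (m * n) - 1) :: 'p padic_int)"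
    by (simp only: padic_p_dvd_of_int_iff)
  then have "padic_p dvd (x - of_nat m) * of_nat n + (of_nat (m * n) - 1)"
    using m by (intro dvd_add) auto
  then have "padic_p dvd x * of_nat n - 1" by (simp add: algebra_simps)
  then obtain z where "x * of_nat n - 1 = padic_p * z" by auto
  then have z: "x * of_nat n = 1 - padic_p * (- z)" by (simp add: algebra_simps)
  define w where "w = padic_p * (- z)"
  have "padic_p ^ k dvd (\<Sum>i<Suc k. w ^ i) - (\<Sum>i<k. w ^ i)" for k
    by (simp add: w_def power_mult_distrib del: mult_minus_right)
  then obtain s where s: "\<And>k. padic_p ^ k dvd s - (\<Sum>i<k. w ^ i)"
    by (rule padic_complete) blast
  have "(1 - w) * s = 1"
  proof (rule padic_eqI)
    fix k
    have "(1 - w) * (\<Sum>i<k. w ^ i) = 1 - w ^ k" by (simp add: one_diff_power_eq)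
    then have "(1 - w) * s - 1 = (1 - w) * (s - (\<Sum>i<k. w ^ i)) - w ^ k"
      by (simp add: algebra_simps)
    moreover have "padic_p ^ k dvd w ^ k" by (simp add: w_def power_mult_distrib del: mult_minus_right)
    ultimately show "padic_p ^ k dvd (1 - w) * s - 1" using s[of k] by auto
  qed
  then have "x * (of_nat n * s) = 1" using z by (simp add: w_def mult.assoc[symmetric])
  then show ?thesis by (rule that)
qed

section \<open>Morita's gamma function\<close>

definition morita_seq :: "nat \<Rightarrow> 'p :: prime_card padic_int" where
  "morita_seq n = (- 1) ^ n * of_nat (\<Prod>j | 0 < j \<and> j < n \<and> \<not> CARD('p) dvd j. j)"

text \<open>The quotient Gamma_p(x + 1) / Gamma_p(x) in Morita's functional equation.\<close>

definition morita_factor :: "'p :: prime_card padic_int \<Rightarrow> 'p padic_int" where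
  "morita_factor x = - (if padic_p dvd x then 1 else x)"

lemma morita_seq_0 [simp]: "morita_seq 0 = 1"
  by (simp add: morita_seq_def)

lemma morita_seq_Suc:
  "morita_seq (Suc n) = (morita_seq n * morita_factor (of_nat n) :: 'p :: prime_card padic_int)"
proof (cases "CARD('p) dvd n")
  case True
  then have "{j. 0 < j \<and> j < Suc n \<and> \<not> CARD('p) dvd j}
      = {j. 0 < j \<and> j < n \<and> \<not> CARD('p) dvd j}"
    using less_Suc_eq by auto
  with True show ?thesis by (simp add: morita_seq_def morita_factor_def padic_p_dvd_of_nat_iff)
next
  case False
  then have "n > 0" by (auto intro: gr0I)
  with False have "{j. 0 < j \<and> j < Suc n \<and> \<not> CARD('p) dvd j} =
      insert n {j. 0 < j \<and> j < n \<and> \<not> CARD('p) dvd j}"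
    by auto
  with False show ?thesis by (simp add: morita_seq_def morita_factor_def padic_p_dvd_of_nat_iff)
qed

lemma morita_factor_unit: "\<not> padic_p dvd morita_factor (x :: 'p :: prime_card padic_int)"
  by (simp add: morita_factor_def padic_p_not_unit)

lemma morita_factor_shift:
  fixes x y :: "'p :: prime_card padic_int"
  assumes "padic_p dvd y"
  shows "morita_factor (x + y) = morita_factor x - (if padic_p dvd x then 0 else y)"
  using assms dvd_add_left_iff[OF assms, of x] by (simp add: morita_factor_def)

text \<open>The quotient Gamma_p(x + n) / Gamma_p(x).\<close>

definition morita_block :: "nat \<Rightarrow> 'p :: prime_card padic_int \<Rightarrow> 'p padic_int" where
  "morita_block n x = (\<Prod>i<n. morita_factor (x + of_nat i))"

lemma morita_block_add:
  "morita_block (m + n) x = morita_block m x * morita_block n (x + of_nat m)"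
  by (induction n) (simp_all add: morita_block_def mult.assoc add.assoc)

lemma morita_seq_add:
  "morita_seq (n + m) = (morita_seq n * morita_block m (of_nat n) :: 'p :: prime_card padic_int)"
  by (induction m) (simp_all add: morita_block_def morita_seq_Suc mult.assoc)

text \<open>A block of length p runs through all residue classes, so modulo p it does not depend on
  x. At x = 0 it is -(p - 1)!, which is 1 by Wilson's theorem; oddness of p fixes the sign.\<close>

lemma morita_block_prime:
  fixes x :: "'p :: prime_card padic_int"
  assumes "odd CARD('p)"
  shows "padic_p dvd morita_block CARD('p) x - 1"
proof -
  let ?B = "morita_block CARD('p) :: 'p padic_int \<Rightarrow> _"
  have fac: "padic_p dvd morita_factor (y + z) - morita_factor y" if "padic_p dvd z" for y z :: "'p padic_int"
    using that by (simp add: morita_factor_shift)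
  have shift: "padic_p dvd ?B (y + z) - ?B y" if "padic_p dvd z" for y z :: "'p padic_int"
  proof -
    have "padic_p dvd (\<Prod>i<n. morita_factor (y + z + of_nat i)) - (\<Prod>i<n. morita_factor (y
        + of_nat i))" for n
    proof (induction n)
      case (Suc n)
      let ?a = "\<lambda>i. morita_factor (y + z + of_nat i)" and ?b
          = "\<lambda>i. morita_factor (y + of_nat i)"
      have "padic_p dvd ((\<Prod>i<n. ?a i) - (\<Prod>i<n. ?b i)) * ?a n + (\<Prod>i<n. ?b i) * (?a n - ?b n)"
        using Suc fac[OF that, of "y + of_nat n"] by (intro dvd_add) (auto simp: algebra_simps)
      then show ?case by (simp add: algebra_simps)
    qed simp
    then show ?thesis by (simp add: morita_block_def)
  qed
  \<comment> \<open>Moving the window by one exchanges the factor at y for the congruent factor at y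
    + p, and factors are units modulo p.\<close>
  have step: "padic_p dvd ?B (y + 1) - ?B y" for y
  proof -
    obtain q where q: "CARD('p) = Suc q" by (cases "CARD('p)") auto
    have "morita_factor y * ?B (y + 1) = morita_block (1 + CARD('p)) y"
      by (simp only: morita_block_add) (simp add: morita_block_def)
    also have "1 + CARD('p) = CARD('p) + 1" by simp
    also have "morita_block (CARD('p) + 1) y = ?B y * morita_factor (y + padic_p)"
      by (simp only: morita_block_add) (simp add: morita_block_def)
    finally have "(?B (y + 1) - ?B y) * morita_factor y = ?B y * (morita_factor (y + padic_p)
        - morita_factor y)"
      by (simp add: algebra_simps)
    then have "padic_p dvd (?B (y + 1) - ?B y) * morita_factor y"
      using fac[of padic_p y] by simp
    then show ?thesis using morita_factor_unit padic_p_dvd_mult_iff by blast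
  qed
  have nat: "padic_p dvd ?B (of_nat n) - ?B 0" for n
  proof (induction n)
    case (Suc n)
    show ?case using dvd_add[OF step[of "of_nat n"] Suc] by (simp add: algebra_simps)
  qed simp
  have "?B 0 = of_int (- fact (CARD('p) - 1))"
  proof -
    obtain q where q: "CARD('p) = Suc q" by (cases "CARD('p)") auto
    have "(\<Prod>i<q. morita_factor (of_nat (Suc i)) :: 'p padic_int) = (\<Prod>i<q. - of_nat (Suc i))"
    proof (rule prod.cong)
      fix i assume "i \<in> {..<q}"
      then have "\<not> CARD('p) dvd Suc i" using q by (auto dest: dvd_imp_le)
      then show "morita_factor (of_nat (Suc i)) = - (of_nat (Suc i) :: 'p padic_int)"
        unfolding morita_factor_def by (subst padic_p_dvd_of_nat_iff) simp
    qed simp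
    also have "\<dots> = (- 1) ^ q * of_nat (\<Prod>i<q. Suc i)"
      by (simp only: prod_uminus card_lessThan of_nat_prod)
    also have "(\<Prod>i<q. Suc i) = fact q" by (simp add: fact_prod_Suc atLeast0LessThan)
    also have "(- 1 :: 'p padic_int) ^ q = 1" using assms q by simp
    finally have *: "(\<Prod>i<q. morita_factor (of_nat (Suc i)) :: 'p padic_int) = of_nat (fact q)" by simp
    have "?B 0 = morita_factor 0 * (\<Prod>i<q. morita_factor (of_nat (Suc i)))"
      unfolding morita_block_def q by (subst prod.lessThan_Suc_shift) simp
    also have "\<dots> = - of_nat (fact q)" by (subst *) (simp add: morita_factor_def)
    finally show ?thesis using q by simp
  qed
  moreover have "[fact (CARD('p) - 1) = - 1] (mod int CARD('p))"
    by (rule wilson_theorem) (rule prime_card)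
  then have "int CARD('p) dvd - (fact (CARD('p) - 1) - (- 1))" by (simp only: cong_iff_dvd_diff dvd_minus_iff)
  then have "padic_p dvd (of_int (- (fact (CARD('p) - 1) - (- 1))) :: 'p padic_int)"
    by (simp only: padic_p_dvd_of_int_iff)
  ultimately have zero: "padic_p dvd ?B 0 - 1" by simp
  obtain n where n: "padic_p dvd x - of_nat n" using padic_approx_nat[of 1 x] by auto
  have "padic_p dvd (?B x - ?B (of_nat n)) + ((?B (of_nat n) - ?B 0) + (?B 0 - 1))"
    using shift[OF n, of "of_nat n"] nat zero by (intro dvd_add) auto
  then show ?thesis by simp
qed

text \<open>To first order in $t$ the block at $x + t p^n$ is affine in $t$, and the linear terms cancel
  in the product over $t < p$ because $\sum_{t<p} t$ is divisible by $p$.\<close>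

lemma morita_block_prime_power:
  fixes x :: "'p :: prime_card padic_int"
  assumes "odd CARD('p)"
  shows "padic_p ^ n dvd morita_block (CARD('p) ^ n) x - 1"
proof (induction n arbitrary: x)
  case (Suc n)
  show ?case
  \<comment> \<open>The quadratic terms carry p^(2n), which p^(n+1) divides only for n >= 1; the
    step from n = 0 is Wilson's theorem instead.\<close>
  proof (cases "n = 0")
    case True
    then show ?thesis using morita_block_prime[OF assms, of x] by simp
  next
    case False
    let ?q = "CARD('p) ^ n" and ?P = "padic_p :: 'p padic_int"
    have pn: "?P dvd ?P ^ n" using False by (simp add: dvd_power)
    have pSn: "?P ^ Suc n dvd ?P ^ n * ?P ^ n" using pn by simp
    have "\<exists>D. \<forall>t. ?P ^ Suc n dvd morita_block m (x + of_nat t * ?P ^ n) - (morita_block m x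
        + of_nat t * ?P ^ n * D)" for m
    proof (induction m)
      case 0
      show ?case by (auto simp: morita_block_def intro: exI[of _ 0])
    next
      case (Suc m)
      then obtain D where D: "\<And>t. ?P ^ Suc n dvd morita_block m (x + of_nat t * ?P ^ n)
          - (morita_block m x + of_nat t * ?P ^ n * D)"
        by blast
      define e where "e = (if ?P dvd x + of_nat m then 0 else 1 :: 'p padic_int)"
      let ?B = "morita_block m x" and ?f = "morita_factor (x + of_nat m)"
      show ?case
      proof (intro exI allI)
        fix t
        let ?T = "of_nat t * ?P ^ n"
        have "morita_factor (x + ?T + of_nat m) = morita_factor (x + of_nat m + ?T)" by (simp add: ac_simps)
        also have "\<dots> = ?f - e * ?T"
          using pn by (subst morita_factor_shift) (auto simp: e_def)
        finally have f: "morita_factor (x + ?T + of_nat m) = ?f - e * ?T" .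
        have "morita_block (Suc m) (x + ?T) = morita_block m (x + ?T) * (?f - e * ?T)"
          unfolding morita_block_def prod.lessThan_Suc f ..
        moreover have "morita_block (Suc m) x = ?B * ?f"
          unfolding morita_block_def prod.lessThan_Suc ..
        ultimately have "morita_block (Suc m) (x + ?T) - (morita_block (Suc m) x + ?T * (D * ?f - e * ?B)) =
           (morita_block m (x + ?T) - (?B + ?T * D)) * (?f - e * ?T) - of_nat t * of_nat t * D * e
               * (?P ^ n * ?P ^ n)"
          by (simp only:) (simp add: algebra_simps)
        moreover have "?P ^ Suc n dvd (morita_block m (x + ?T) - (?B + ?T * D)) * (?f - e * ?T) - of_nat t
            * of_nat t * D * e * (?P ^ n * ?P ^ n)"
          by (rule dvd_diff[OF dvd_mult2[OF D] dvd_mult[OF pSn]])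
        ultimately show "?P ^ Suc n dvd morita_block (Suc m) (x + ?T) - (morita_block (Suc m) x + ?T * (D
            * ?f - e * ?B))"
          by simp
      qed
    qed
    then obtain D where D: "\<And>t. ?P ^ Suc n dvd morita_block ?q (x + of_nat t * ?P ^ n)
        - (morita_block ?q x + of_nat t * ?P ^ n * D)"
      by blast
    obtain z where z: "morita_block ?q x = 1 + ?P ^ n * z"
      using Suc.IH[of x] by (auto elim!: dvdE simp: algebra_simps)
    have *: "?P ^ Suc n dvd morita_block (?q * k) x - (1 + ?P ^ n * (of_nat k * z + of_nat (\<Sum>t<k. t)
        * D))" for k
    proof (induction k)
      case 0
      show ?case by (simp add: morita_block_def)
    next
      case (Suc k)
      let ?A = "of_nat k * z + of_nat (\<Sum>t<k. t) * D" and ?E = "z + of_nat k * D"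
      let ?X = "morita_block (?q * k) x" and ?Y = "morita_block ?q (x + of_nat k * ?P ^ n)"
      have Y: "?P ^ Suc n dvd ?Y - (1 + ?P ^ n * ?E)"
        using D[of k] by (simp add: z algebra_simps)
      have "morita_block (?q * Suc k) x = ?X * ?Y"
        by (simp only: mult_Suc_right add.commute[of "?q"] morita_block_add) (simp add: mult.commute)
      then have "morita_block (?q * Suc k) x - (1 + ?P ^ n * (of_nat (Suc k) * z
          + of_nat (\<Sum>t<Suc k. t) * D))
         = (?X - (1 + ?P ^ n * ?A)) * ?Y + (1 + ?P ^ n * ?A) * (?Y - (1 + ?P ^ n * ?E)) + ?A * ?E * (?P ^ n
             * ?P ^ n)"
        by (simp add: algebra_simps)
      moreover have "?P ^ Suc n dvd (?X - (1 + ?P ^ n * ?A)) * ?Y + (1 + ?P ^ n * ?A) * (?Y - (1 + ?P ^ n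
          * ?E)) + ?A * ?E * (?P ^ n * ?P ^ n)"
        by (rule dvd_add[OF dvd_add[OF dvd_mult2[OF Suc] dvd_mult[OF Y]] dvd_mult[OF pSn]])
      ultimately show ?case by simp
    qed
    have "CARD('p) dvd (\<Sum>t<CARD('p). t)"
    proof -
      have "(\<Sum>t<CARD('p). t) = CARD('p) * ((CARD('p) - 1) div 2)"
        using assms by (simp add: Sum_Ico_nat atLeast0LessThan[symmetric] div_mult_swap)
      then show ?thesis by simp
    qed
    then obtain s where s: "(\<Sum>t<CARD('p). t) = CARD('p) * s" by auto
    have "?P ^ Suc n dvd morita_block (?q * CARD('p)) x - (1 + ?P ^ n * (?P * z + ?P * of_nat s * D))"
      using *[of "CARD('p)"] s by simp
    moreover have "?P ^ Suc n dvd ?P ^ n * (?P * z + ?P * of_nat s * D)"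
      by (simp add: mult.assoc distrib_left[symmetric] del: distrib_left)
    ultimately have "?P ^ Suc n dvd (morita_block (?q * CARD('p)) x - (1 + ?P ^ n * (?P * z + ?P * of_nat s
        * D))) + ?P ^ n * (?P * z + ?P * of_nat s * D)"
      by (rule dvd_add)
    then show ?thesis by (simp add: mult.commute)
  qed
qed simp

text \<open>Moving the argument by p^k multiplies the value by a block that is 1 modulo p^k. No
  precision is lost, which makes the extension to p-adic arguments precision-preserving as
  well.\<close>

lemma morita_seq_cong:
  fixes m n :: nat
  assumes "odd CARD('p :: prime_card)" "padic_p ^ k dvd (of_nat m - of_nat n :: 'p padic_int)"
  shows "padic_p ^ k dvd (morita_seq m - morita_seq n :: 'p padic_int)"
proof -
  have le: "padic_p ^ k dvd (morita_seq m - morita_seq n :: 'p padic_int)"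
    if "n \<le> m" "padic_p ^ k dvd (of_nat m - of_nat n :: 'p padic_int)" for m n
  proof -
    have "padic_p ^ k dvd (of_nat (m - n) :: 'p padic_int)" using that by (simp add: of_nat_diff)
    then obtain j where "m - n = CARD('p) ^ k * j"
      unfolding padic_power_dvd_of_nat_iff by auto
    then have m: "m = n + CARD('p) ^ k * j" using that by simp
    show ?thesis unfolding m
    proof (induction j)
      case (Suc j)
      let ?a = "morita_seq (n + CARD('p) ^ k * j) :: 'p padic_int"
      have "morita_seq (n + CARD('p) ^ k * Suc j) = ?a * morita_block (CARD('p) ^ k) (of_nat (n
          + CARD('p) ^ k * j))"
        using morita_seq_add[of "n + CARD('p) ^ k * j" "CARD('p) ^ k", where 'p='p] by (simp add: ac_simps)
      then have "morita_seq (n + CARD('p) ^ k * Suc j) - morita_seq n =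
        ?a * (morita_block (CARD('p) ^ k) (of_nat (n + CARD('p) ^ k * j)) - 1) + (?a - morita_seq n)"
        by (simp only:) (simp add: algebra_simps)
      moreover have "padic_p ^ k dvd ?a * (morita_block (CARD('p) ^ k) (of_nat (n + CARD('p) ^ k * j)) - 1)
          + (?a - morita_seq n)"
        by (intro dvd_add dvd_mult morita_block_prime_power[OF assms(1)] Suc)
      ultimately show ?case by (simp only:)
    qed simp
  qed
  show ?thesis
  proof (cases "n \<le> m")
    case False
    then have "m \<le> n" by simp
    from le[OF this dvd_diff_swap[OF assms(2)]] show ?thesis
      by (rule dvd_diff_swap)
  qed (use le assms in blast)
qed

section \<open>The limit that defines Gamma_p\<close>

lemma padic_abs_le_iff_dvd:
  "padic_abs x \<le> inverse (real CARD('p)) ^ n \<longleftrightarrow> padic_p ^ n dvd (x :: 'p ::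
      prime_card padic_int)"
  by (simp add: padic_abs_le_iff padic_power_dvd_iff)

text \<open>The only place where the limit is evaluated. The natural numbers are dense in the p-adic
  integers, so the filter is nontrivial, and \<open>morita_seq_cong\<close> provides the limit;
  afterwards Gamma_p is handled through this congruence alone.\<close>

lemma morita_Gamma_approx:
  fixes x :: "'p :: prime_card padic_int"
  assumes odd: "odd CARD('p)" and m: "padic_p ^ n dvd x - of_nat m"
  shows "padic_p ^ n dvd morita_Gamma x - morita_seq m"
proof -
  let ?F = "filtercomap (of_nat :: nat \<Rightarrow> 'p padic_int) (nhds x)"
  have "\<forall>n. \<exists>m. padic_p ^ n dvd x - of_nat m"
    by (meson padic_approx_nat)
  then have "\<exists>m. \<forall>n. padic_p ^ n dvd x - of_nat (m n)"
    by (rule choice)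
  then obtain a :: "nat \<Rightarrow> nat" where a: "\<And>n. padic_p ^ n dvd x - of_nat (a n)" by blast
  have seq: "padic_p ^ n dvd (morita_seq i - morita_seq j :: 'p padic_int)"
    if "padic_p ^ n dvd x - of_nat i" "padic_p ^ n dvd x - of_nat j" for n i j
    using dvd_diff[OF that(2,1)] by (intro morita_seq_cong[OF odd]) simp
  have "padic_p ^ n dvd (morita_seq (a (Suc n)) - morita_seq (a n) :: 'p padic_int)" for n
    by (rule seq[OF dvd_trans[OF _ a] a]) (simp add: le_imp_power_dvd)
  then obtain L where L: "\<And>n. padic_p ^ n dvd L - (morita_seq (a n) :: 'p padic_int)"
    using padic_complete[of "\<lambda>n. morita_seq (a n)"] by blast
  have approx: "padic_p ^ n dvd L - morita_seq m" if "padic_p ^ n dvd x - of_nat m" for n m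
    using dvd_add[OF L[of n] seq[OF a[of n] that]] by simp
  have p1: "1 < real CARD('p)" using CARD_gt_1[where 'p='p] by simp
  have small: "\<exists>n. inverse (real CARD('p)) ^ n < e" if "e > 0" for e
    using real_arch_pow_inv[OF that, of "inverse (real CARD('p))"] p1 by (simp add: inverse_less_1_iff)
  have "?F \<noteq> bot"
  proof (rule filtercomap_neq_bot)
    fix P assume "eventually P (nhds x)"
    then obtain e where e: "e > 0" "\<And>y. dist y x < e \<Longrightarrow> P y"
      by (auto simp: eventually_nhds_metric)
    obtain n where n: "inverse (real CARD('p)) ^ n < e" using small e by blast
    have "padic_abs (of_nat (a n) - x) \<le> inverse (real CARD('p)) ^ n"
      unfolding padic_abs_le_iff_dvd using a[of n] by (rule dvd_diff_swap)
    then show "\<exists>m. P (of_nat m)" using n e by (intro exI[of _ "a n"]) (auto simp: dist_padic_int_def)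
  qed
  moreover have "(morita_seq \<longlongrightarrow> L) ?F"
  proof (rule tendstoI)
    fix e :: real assume "e > 0"
    then obtain n where n: "inverse (real CARD('p)) ^ n < e" using small by blast
    have "eventually (\<lambda>y. dist y x < inverse (real CARD('p)) ^ n) (nhds x)"
      using p1 by (auto simp: eventually_nhds_metric intro!: exI[of _ "inverse (real CARD('p)) ^ n"])
    then have "eventually (\<lambda>m. dist (of_nat m) x < inverse (real CARD('p)) ^ n) ?F"
      by (rule eventually_filtercomapI)
    then show "eventually (\<lambda>m. dist (morita_seq m) L < e) ?F"
    proof (rule eventually_mono)
      fix m assume "dist (of_nat m) x < inverse (real CARD('p)) ^ n"
      then have "padic_abs (of_nat m - x) \<le> inverse (real CARD('p)) ^ n"
        by (simp add: dist_padic_int_def)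
      then have "padic_p ^ n dvd x - of_nat m"
        unfolding padic_abs_le_iff_dvd by (rule dvd_diff_swap)
      then have "padic_p ^ n dvd morita_seq m - L"
        by (rule dvd_diff_swap[OF approx])
      then have "padic_abs (morita_seq m - L) \<le> inverse (real CARD('p)) ^ n"
        unfolding padic_abs_le_iff_dvd .
      then show "dist (morita_seq m) L < e" using n by (simp add: dist_padic_int_def)
    qed
  qed
  ultimately have "Lim ?F morita_seq = L" by (intro tendsto_Lim)
  moreover have "morita_Gamma x = Lim ?F morita_seq"
    unfolding morita_Gamma_def morita_seq_def[abs_def] ..
  ultimately show ?thesis using approx[OF m] by simp
qed

context
  assumes odd: "odd CARD('p :: prime_card)"
begin

lemma morita_Gamma_of_nat: "morita_Gamma (of_nat n) = (morita_seq n :: 'p padic_int)"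
  by (rule padic_eqI, rule morita_Gamma_approx[OF odd]) simp

lemma morita_Gamma_0: "morita_Gamma 0 = (1 :: 'p padic_int)"
  using morita_Gamma_of_nat[of 0] by simp

lemma morita_Gamma_cong:
  fixes x y :: "'p padic_int"
  assumes "padic_p ^ n dvd x - y"
  shows "padic_p ^ n dvd morita_Gamma x - morita_Gamma y"
proof -
  obtain m where m: "padic_p ^ n dvd y - of_nat m" by (rule padic_approx_nat)
  have "padic_p ^ n dvd x - of_nat m" using dvd_add[OF assms m] by simp
  from dvd_diff[OF morita_Gamma_approx[OF odd this] morita_Gamma_approx[OF odd m]]
  show ?thesis by simp
qed

lemma morita_factor_cong:
  fixes x y :: "'p padic_int"
  assumes "padic_p ^ Suc n dvd x - y"
  shows "padic_p ^ Suc n dvd morita_factor x - morita_factor y"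
proof -
  have "padic_p dvd x - y" using assms by (rule dvd_trans[rotated]) simp
  from morita_factor_shift[OF this, of y] show ?thesis
    using assms dvd_diff_swap[OF assms] by simp
qed

lemma morita_Gamma_plus_1:
  fixes x :: "'p padic_int"
  shows "morita_Gamma (x + 1) = morita_Gamma x * morita_factor x"
proof (rule padic_eqI)
  fix n
  obtain m where m: "padic_p ^ Suc n dvd x - of_nat m" by (rule padic_approx_nat)
  have "padic_p ^ Suc n dvd (x + 1) - of_nat (Suc m)" using m by simp
  from morita_Gamma_approx[OF odd this]
  have 1: "padic_p ^ Suc n dvd morita_Gamma (x + 1) - morita_seq m * morita_factor (of_nat m)"
    by (simp add: morita_seq_Suc)
  have 2: "padic_p ^ Suc n dvd (morita_Gamma x - morita_seq m) * morita_factor x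
       + morita_seq m * (morita_factor x - morita_factor (of_nat m))"
    by (intro dvd_add dvd_mult dvd_mult2 morita_Gamma_approx[OF odd m] morita_factor_cong[OF m])
  have "padic_p ^ Suc n dvd morita_Gamma (x + 1) - morita_Gamma x * morita_factor x"
    using dvd_diff[OF 1 2] by (simp add: algebra_simps)
  then show "padic_p ^ n dvd morita_Gamma (x + 1) - morita_Gamma x * morita_factor x"
    by (rule dvd_trans[rotated]) (simp add: le_imp_power_dvd)
qed

lemma morita_Gamma_unit: "\<not> padic_p dvd morita_Gamma (x :: 'p padic_int)"
proof -
  obtain m where "padic_p ^ 1 dvd x - of_nat m" by (rule padic_approx_nat)
  from morita_Gamma_approx[OF odd this] have *: "padic_p dvd morita_Gamma x - morita_seq m" by simp
  have "\<not> padic_p dvd (morita_seq m :: 'p padic_int)"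
    by (induction m) (simp_all add: padic_p_not_unit morita_seq_Suc padic_p_dvd_mult_iff morita_factor_unit)
  then show ?thesis using dvd_diff[OF _ *, of "morita_Gamma x"] by auto
qed

end

section \<open>Unconditional sums of $p$-adic numbers\<close>

text \<open>An opaque copy of \<open>padic_of_int\<close>, so that simplification uses the
  homomorphism rules below instead of calculating with fractions.\<close>

definition zp :: "'p :: prime_card padic_int \<Rightarrow> 'p padic" where
  "zp z = padic_of_int z"

lemma zp_0 [simp]: "zp 0 = 0" by (simp add: zp_def fract_collapse)
lemma zp_1 [simp]: "zp 1 = 1" by (simp add: zp_def fract_collapse)
lemma zp_add: "zp (x + y) = zp x + zp y" by (simp add: zp_def)
lemma zp_mult: "zp (x * y) = zp x * zp y" by (simp add: zp_def)
lemma zp_diff: "zp (x - y) = zp x - zp y" by (simp add: zp_def)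
lemma zp_uminus: "zp (- x) = - zp x" by (simp add: zp_def)
lemma zp_eq_iff [simp]: "zp x = zp y \<longleftrightarrow> x = y" by (simp add: zp_def eq_fract)
lemma zp_eq_0_iff [simp]: "zp x = 0 \<longleftrightarrow> x = 0" using zp_eq_iff[of x 0]
    by (simp del: zp_eq_iff)
lemma zp_of_nat [simp]: "zp (of_nat n) = of_nat n" by (simp add: zp_def of_nat_fract)
lemma zp_of_int [simp]: "zp (of_int n) = of_int n"
  by (cases n rule: int_diff_cases) (simp add: zp_diff)
lemma zp_power: "zp (x ^ n) = zp x ^ n" by (induction n) (simp_all add: zp_mult)
lemma zp_sum: "zp (sum f A) = (\<Sum>i\<in>A. zp (f i))"
  by (induction A rule: infinite_finite_induct) (simp_all add: zp_add)
abbreviation qp_p :: "'p :: prime_card padic" where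
  "qp_p \<equiv> of_nat CARD('p)"

text \<open>The closed ball of radius p^-n inside the field of p-adic numbers;
  \<open>zball 0\<close> is the ring of p-adic integers.\<close>

definition zball :: "nat \<Rightarrow> 'p :: prime_card padic set" where
  "zball n = {x. \<exists>z. x = qp_p ^ n * zp z}"

lemma zballI: "x = qp_p ^ n * zp z \<Longrightarrow> x \<in> zball n"
  by (auto simp: zball_def)

lemma zballE:
  assumes "x \<in> zball n"
  obtains z where "x = qp_p ^ n * zp z"
  using assms by (auto simp: zball_def)

lemma zp_in_zball_iff: "zp x \<in> zball n \<longleftrightarrow> padic_p ^ n dvd x"
proof -
  have "zp x = qp_p ^ n * zp z \<longleftrightarrow> x = padic_p ^ n * z" for z
    using zp_eq_iff[of x "padic_p ^ n * z"] by (simp add: zp_mult zp_power del: zp_eq_iff)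
  then show ?thesis by (auto simp: zball_def dvd_def)
qed

lemma zp_in_zball_0 [simp]: "zp x \<in> zball 0"
  by (simp add: zp_in_zball_iff)

lemma zball_0E:
  assumes "x \<in> zball 0"
  obtains z where "x = zp z"
  using assms by (auto simp: zball_def)

lemma zero_in_zball [simp]: "0 \<in> zball n"
  by (rule zballI[of _ _ 0]) simp

lemma of_nat_in_zball_0 [simp]: "of_nat m \<in> zball 0"
  using zp_in_zball_0[of "of_nat m"] by simp

lemma one_in_zball_0 [simp]: "1 \<in> zball 0"
  using of_nat_in_zball_0[of 1] by simp

lemma zball_add: "x \<in> zball n \<Longrightarrow> y \<in> zball n \<Longrightarrow> x + y \<in> zball n"
  by (elim zballE, rule zballI[of _ _ "z + w" for z w]) (simp add: zp_add distrib_left)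

lemma zball_uminus: "x \<in> zball n \<Longrightarrow> - x \<in> zball n"
  by (elim zballE, rule zballI[of _ _ "- z" for z]) (simp only: zp_uminus mult_minus_right)

lemma zball_diff: "x \<in> zball n \<Longrightarrow> y \<in> zball n \<Longrightarrow> x - y \<in> zball n"
  using zball_add[of x n "- y"] zball_uminus[of y n] by simp

lemma zball_mult: "x \<in> zball m \<Longrightarrow> y \<in> zball n \<Longrightarrow> x * y \<in> zball (m
    + n)"
  by (elim zballE, rule zballI[of _ _ "z * w" for z w]) (simp add: zp_mult power_add mult_ac)

lemma zball_mult_left: "x \<in> zball 0 \<Longrightarrow> y \<in> zball n \<Longrightarrow> x * y \<in> zball n"
  using zball_mult[of x 0 y n] by simp

lemma zball_mult_right: "x \<in> zball n \<Longrightarrow> y \<in> zball 0 \<Longrightarrow> x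
    * y \<in> zball n"
  using zball_mult[of x n y 0] by simp

lemma zball_sum: "(\<And>i. i \<in> A \<Longrightarrow> f i \<in> zball n) \<Longrightarrow> sum f A \<in>
    zball n"
  by (induction A rule: infinite_finite_induct) (simp_all add: zball_add)

lemma zball_0_power: "x \<in> zball 0 \<Longrightarrow> x ^ n \<in> zball 0"
  by (induction n) (simp_all add: zball_mult_left)

lemma qp_p_power_in_zball: "qp_p ^ n \<in> zball n"
  by (rule zballI[of _ _ 1]) simp

lemma zball_mono: "m \<le> n \<Longrightarrow> x \<in> zball n \<Longrightarrow> x \<in> zball m"
  by (elim zballE, rule zballI[of _ _ "padic_p ^ (n - m) * z" for z])
     (simp add: zp_mult zp_power mult.assoc[symmetric] power_add[symmetric])

lemma zball_scale_iff: "qp_p ^ m * x \<in> zball (m + n) \<longleftrightarrow> x \<in> zball n"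
  by (auto simp: zball_def power_add mult.assoc)

lemma zball_eq_0:
  assumes "\<And>n. x \<in> zball n"
  shows "x = 0"
proof -
  obtain z where z: "x = zp z" using assms[of 0] by (rule zball_0E)
  have "z = 0" by (rule padic_eqI) (use assms z zp_in_zball_iff in auto)
  then show ?thesis using z by simp
qed

lemma padic_factor:
  fixes x :: "'p :: prime_card padic_int"
  assumes "x \<noteq> 0"
  obtains n u where "x = padic_p ^ n * u" "\<not> padic_p dvd u"
proof -
  obtain N where "\<not> padic_p ^ N dvd x" using padic_eqI[of x 0] assms by auto
  then have *: "\<not> padic_p ^ (LEAST N. \<not> padic_p ^ N dvd x) dvd x" by (rule LeastI)
  define N where "N = (LEAST N. \<not> padic_p ^ N dvd x)"
  have "N \<noteq> 0" using * by (intro notI) (simp add: N_def)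
  then obtain n where n: "N = Suc n" by (cases N) auto
  have "padic_p ^ n dvd x" using not_less_Least[of n "\<lambda>N. \<not> padic_p ^ N dvd x"] n
      by (auto simp: N_def)
  then obtain u where u: "x = padic_p ^ n * u" by auto
  have "\<not> padic_p dvd u"
  proof
    assume "padic_p dvd u"
    then have "padic_p ^ n * padic_p dvd x" unfolding u by (rule mult_dvd_mono[OF dvd_refl])
    then show False using * by (simp add: N_def[symmetric] n mult.commute)
  qed
  then show ?thesis using u that by blast
qed

lemma inverse_zp_unit:
  assumes "\<not> padic_p dvd u"
  shows "inverse (zp u) \<in> zball 0"
proof -
  obtain v where "u * v = 1" using padic_inverse[OF assms] by blast
  then have "zp u * zp v = 1" by (simp flip: zp_mult)
  then have "inverse (zp u) = zp v" by (rule inverse_unique)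
  then show ?thesis by simp
qed

lemma qp_scale_integral:
  fixes x :: "'p :: prime_card padic"
  obtains e where "qp_p ^ e * x \<in> zball 0"
proof -
  obtain a b where x: "x = Fraction_Field.Fract a b" and b: "b \<noteq> 0" by (cases x) auto
  obtain e u where e: "b = padic_p ^ e * u" and u: "\<not> padic_p dvd u" using padic_factor[OF b] by blast
  have "x * zp b = zp a" using b by (simp add: x zp_def eq_fract)
  moreover have "zp u \<noteq> 0" using u by auto
  ultimately have "qp_p ^ e * x = zp a * inverse (zp u)" by (simp add: e zp_mult zp_power field_simps)
  then have "qp_p ^ e * x \<in> zball 0" using inverse_zp_unit[OF u] by (simp add: zball_mult_left)
  then show ?thesis by (rule that)
qed

lemma qp_scale_mono:
  "qp_p ^ d * x \<in> zball 0 \<Longrightarrow> d \<le> e \<Longrightarrow> qp_p ^ e * x \<in> zball 0"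
  using zball_mult_left[of "qp_p ^ (e - d)" "qp_p ^ d * x" 0] zball_0_power[of qp_p "e - d"]
  by (simp add: mult.assoc[symmetric] power_add[symmetric])

text \<open>The surplus precision e pays for the denominator of y.\<close>

lemma zball_mult_scaled:
  assumes "x \<in> zball (N + e)" "qp_p ^ e * y \<in> zball 0"
  shows "x * y \<in> zball N"
proof -
  obtain z where "x = qp_p ^ (N + e) * zp z" using assms(1) by (rule zballE)
  then have "x * y = qp_p ^ N * (zp z * (qp_p ^ e * y))" by (simp add: power_add mult_ac)
  also have "\<dots> \<in> zball N"
    using zball_mult[OF qp_p_power_in_zball zball_mult_left[OF zp_in_zball_0 assms(2)], of N z] by simp
  finally show ?thesis .
qed

section \<open>Completeness and sums of null families\<close>

lemma qp_complete:
  fixes f :: "nat \<Rightarrow> 'p :: prime_card padic"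
  assumes "\<And>n. f (Suc n) - f n \<in> zball n"
  obtains x where "\<And>n. x - f n \<in> zball n"
proof -
  have "f n - f 0 \<in> zball 0" for n
  proof (induction n)
    case (Suc n)
    show ?case using zball_add[OF zball_mono[OF _ assms[of n], of 0] Suc] by simp
  qed simp
  then have "\<forall>n. \<exists>z. f n - f 0 = zp z" by (meson zball_0E)
  then obtain g where g: "\<And>n. f n - f 0 = zp (g n)" by metis
  have "padic_p ^ n dvd g (Suc n) - g n" for n
    using assms[of n] by (simp add: zp_diff flip: zp_in_zball_iff g)
  then obtain z where z: "\<And>n. padic_p ^ n dvd z - g n" by (rule padic_complete) blast
  have "zp z + f 0 - f n \<in> zball n" for n
    using z[of n] by (simp add: zp_diff algebra_simps flip: zp_in_zball_iff g)
  then show ?thesis by (rule that)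
qed

text \<open>Over a nonarchimedean complete field a family is summable exactly if all but finitely
  many terms lie in every given ball, and modulo p^N its sum is the finite sum of the remaining
  terms. No order of the indices is involved, so regrouping and products need no further conditions
  of convergence.\<close>

definition null_fam :: "('i \<Rightarrow> 'p :: prime_card padic) \<Rightarrow> bool" where
  "null_fam f \<longleftrightarrow> (\<forall>N. finite {i. f i \<notin> zball N})"

definition has_psum :: "('i \<Rightarrow> 'p :: prime_card padic) \<Rightarrow> 'p padic \<Rightarrow>
    bool" where
  "has_psum f s \<longleftrightarrow> null_fam f \<and> (\<forall>N. s
      - sum f {i. f i \<notin> zball N} \<in> zball N)"

definition psum :: "('i \<Rightarrow> 'p :: prime_card padic) \<Rightarrow> 'p padic" where
  "psum f = (THE s. has_psum f s)"

lemma null_famD: "null_fam f \<Longrightarrow> finite {i. f i \<notin> zball N}"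
  by (simp add: null_fam_def)

lemma null_famI: "(\<And>N. \<exists>A. finite A \<and> (\<forall>i. i \<notin> A \<longrightarrow> f i
    \<in> zball N)) \<Longrightarrow> null_fam f"
  unfolding null_fam_def by (metis (mono_tags, lifting) mem_Collect_eq rev_finite_subset subsetI)

lemma has_psum_null: "has_psum f s \<Longrightarrow> null_fam f"
  by (simp add: has_psum_def)

lemma sum_zball_cong:
  assumes "finite A" "finite B" "\<And>i. i \<notin> A \<Longrightarrow> f i \<in> zball N" "\<And>i. i
      \<notin> B \<Longrightarrow> f i \<in> zball N"
  shows "sum f A - sum f B \<in> zball N"
proof -
  have "sum f A = sum f (A - B) + sum f (A \<inter> B)" "sum f B = sum f (B - A) + sum f (A \<inter> B)"
    using assms sum.Int_Diff[of A f B] sum.Int_Diff[of B f A] by (simp_all add: Int_commute add.commute)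
  then have "sum f A - sum f B = sum f (A - B) - sum f (B - A)" by simp
  then show ?thesis using assms by (auto intro!: zball_diff zball_sum)
qed

lemma has_psumD:
  assumes "has_psum f s" "finite A" "\<And>i. i \<notin> A \<Longrightarrow> f i \<in> zball N"
  shows "s - sum f A \<in> zball N"
proof -
  let ?B = "{i. f i \<notin> zball N}"
  have "sum f ?B - sum f A \<in> zball N"
    using assms null_famD[OF has_psum_null, of f s N] by (intro sum_zball_cong) auto
  moreover have "s - sum f ?B \<in> zball N" using assms by (simp add: has_psum_def)
  ultimately show ?thesis using zball_add by fastforce
qed

lemma has_psumI:
  assumes "\<And>N. \<exists>A. finite A \<and> (\<forall>i. i \<notin> A \<longrightarrow> f i \<in> zball
      N) \<and> s - sum f A \<in> zball N"
  shows "has_psum f s"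
proof -
  have null: "null_fam f" by (rule null_famI) (use assms in blast)
  have "s - sum f {i. f i \<notin> zball N} \<in> zball N" for N
  proof -
    obtain A where A: "finite A" "\<And>i. i \<notin> A \<Longrightarrow> f i \<in> zball N" "s
        - sum f A \<in> zball N"
      using assms by blast
    have "sum f A - sum f {i. f i \<notin> zball N} \<in> zball N"
      using A null_famD[OF null] by (intro sum_zball_cong) auto
    from zball_add[OF A(3) this] show ?thesis by simp
  qed
  then show ?thesis using null by (simp add: has_psum_def)
qed

lemma has_psum_unique:
  assumes "has_psum f s" "has_psum f t"
  shows "s = t"
proof -
  have "s - t \<in> zball N" for N
    using zball_diff[of "s - sum f {i. f i \<notin> zball N}" N "t - sum f {i. f i \<notin> zball N}"] assms
    by (simp add: has_psum_def)
  then have "s - t = 0" by (rule zball_eq_0)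
  then show ?thesis by simp
qed

lemma null_fam_has_psum:
  assumes "null_fam f"
  shows "has_psum f (psum f)"
proof -
  have "sum f {i. f i \<notin> zball (Suc n)} - sum f {i. f i \<notin> zball n} \<in> zball n" for n
    using null_famD[OF assms] zball_mono[of n "Suc n"] by (intro sum_zball_cong) auto
  then obtain s where "\<And>n. s - sum f {i. f i \<notin> zball n} \<in> zball n"
    by (rule qp_complete) blast
  then have s: "has_psum f s" using assms by (simp add: has_psum_def)
  show ?thesis unfolding psum_def by (rule theI[of _ s]) (use s has_psum_unique in blast)+
qed

lemma psum_eqI: "has_psum f s \<Longrightarrow> psum f = s"
  using has_psum_unique null_fam_has_psum has_psum_null by blast

lemma has_psum_0: "has_psum (\<lambda>_. 0) 0"
  by (rule has_psumI) (auto intro: exI[of _ "{}"])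

lemma has_psum_single: "has_psum (\<lambda>i. if i = k then x else 0) x"
  by (rule has_psumI) (auto intro!: exI[of _ "{k}"])

lemma has_psum_add:
  assumes "has_psum f s" "has_psum g t"
  shows "has_psum (\<lambda>i. f i + g i) (s + t)"
proof (rule has_psumI)
  fix N
  let ?A = "{i. f i \<notin> zball N} \<union> {i. g i \<notin> zball N}"
  have fin: "finite ?A" using assms has_psum_null null_famD by blast
  have "s - sum f ?A \<in> zball N" "t - sum g ?A \<in> zball N"
    by (rule has_psumD[OF assms(1) fin] has_psumD[OF assms(2) fin]; blast)+
  from zball_add[OF this] have "s + t - (\<Sum>i\<in>?A. f i + g i) \<in> zball N"
    by (simp add: sum.distrib algebra_simps)
  then show "\<exists>A. finite A \<and> (\<forall>i. i \<notin> A \<longrightarrow> f i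
      + g i \<in> zball N) \<and> s + t - (\<Sum>i\<in>A. f i + g i) \<in> zball N"
    using fin by (intro exI[of _ ?A]) (auto intro: zball_add)
qed

lemma has_psum_cmult:
  assumes "has_psum f s"
  shows "has_psum (\<lambda>i. c * f i) (c * s)"
proof (rule has_psumI)
  fix N
  obtain e where e: "qp_p ^ e * c \<in> zball 0" by (rule qp_scale_integral)
  let ?A = "{i. f i \<notin> zball (N + e)}"
  have fin: "finite ?A" using assms has_psum_null null_famD by blast
  have "s - sum f ?A \<in> zball (N + e)" by (rule has_psumD[OF assms(1) fin]) blast
  from zball_mult_scaled[OF this e] have "c * s - (\<Sum>i\<in>?A. c * f i) \<in> zball N"
    by (simp add: sum_distrib_left algebra_simps)
  moreover have "c * f i \<in> zball N" if "i \<notin> ?A" for i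
    using zball_mult_scaled[OF _ e, of "f i" N] that by (simp add: mult.commute)
  ultimately show "\<exists>A. finite A \<and> (\<forall>i. i \<notin> A \<longrightarrow> c
      * f i \<in> zball N) \<and> c * s - (\<Sum>i\<in>A. c * f i) \<in> zball N"
    using fin by (intro exI[of _ ?A]) auto
qed

lemma has_psum_diff:
  "has_psum f s \<Longrightarrow> has_psum g t \<Longrightarrow> has_psum (\<lambda>i. f i - g i) (s - t)"
  using has_psum_add[of f s "\<lambda>i. - 1 * g i" "- 1 * t"] has_psum_cmult[of g t "- 1"] by simp

lemma has_psum_sum:
  "(\<And>b. b \<in> B \<Longrightarrow> has_psum (f b) (s b)) \<Longrightarrow> has_psum (\<lambda>i.
      \<Sum>b\<in>B. f b i) (\<Sum>b\<in>B. s b)"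
  by (induction B rule: infinite_finite_induct) (simp_all add: has_psum_0 has_psum_add)

text \<open>Summation by fibres; with \<open>h\<close> the addition of exponents this yields the
  Cauchy product of two series.\<close>

lemma has_psum_group:
  assumes "has_psum f s" "\<And>n. finite {i. h i = n}"
  shows "has_psum (\<lambda>n. sum f {i. h i = n}) s"
proof (rule has_psumI)
  fix N
  let ?E = "{i. f i \<notin> zball N}"
  have fin: "finite ?E" using assms has_psum_null null_famD by blast
  let ?A = "h ` ?E" and ?C = "\<Union>n\<in>h ` ?E. {i. h i = n}"
  have C: "finite ?C" using fin assms by blast
  have "sum f ?C = (\<Sum>n\<in>?A. sum f {i. h i = n})"
    by (rule sum.UNION_disjoint) (use fin assms in auto)
  moreover have "s - sum f ?C \<in> zball N" by (rule has_psumD[OF assms(1) C]) blast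
  moreover have "sum f {i. h i = n} \<in> zball N" if "n \<notin> ?A" for n
    using that by (intro zball_sum) blast
  ultimately show "\<exists>A. finite A \<and> (\<forall>n. n \<notin> A \<longrightarrow> sum f {i. h i
      = n} \<in> zball N) \<and>
      s - (\<Sum>n\<in>A. sum f {i. h i = n}) \<in> zball N"
    using fin by (intro exI[of _ ?A]) auto
qed

lemma has_psum_reindex:
  assumes "has_psum f s" "inj g" "\<And>i. i \<notin> range g \<Longrightarrow> f i = 0"
  shows "has_psum (\<lambda>i. f (g i)) s"
proof (rule has_psumI)
  fix N
  let ?E = "{i. f i \<notin> zball N}"
  have fin: "finite ?E" using assms has_psum_null null_famD by blast
  let ?A = "g -` ?E"
  have "finite ?A" using fin assms(2) by (rule finite_vimageI)
  moreover have "g ` ?A = ?E" using assms(3) by force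
  then have "(\<Sum>i\<in>?A. f (g i)) = sum f ?E"
    using sum.reindex[of g ?A f] assms(2) by (simp add: inj_on_subset)
  moreover have "s - sum f ?E \<in> zball N" by (rule has_psumD[OF assms(1) fin]) blast
  ultimately show "\<exists>A. finite A \<and> (\<forall>i. i \<notin> A \<longrightarrow> f (g i) \<in>
      zball N) \<and> s - (\<Sum>i\<in>A. f (g i)) \<in> zball N"
    by (intro exI[of _ ?A]) auto
qed

lemma has_psum_subfamily:
  assumes "null_fam f" "inj g"
  shows "null_fam (\<lambda>i. f (g i))"
  unfolding null_fam_def
proof
  fix N
  have "{i. f (g i) \<notin> zball N} = g -` {i. f i \<notin> zball N}" by auto
  then show "finite {i. f (g i) \<notin> zball N}"
    using finite_vimageI[OF null_famD[OF assms(1)] assms(2)] by simp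
qed

lemma null_fam_mult:
  assumes "null_fam f" "\<And>i. c i \<in> zball 0"
  shows "null_fam (\<lambda>i. c i * f i)"
  by (rule null_famI) (use null_famD[OF assms(1)] zball_mult_left[OF assms(2)] in blast)

lemma null_fam_bounded:
  assumes "null_fam f"
  obtains e where "\<And>i. qp_p ^ e * f i \<in> zball 0"
proof -
  let ?E = "{i. f i \<notin> zball 0}"
  have fin: "finite ?E" using assms by (rule null_famD)
  have "\<forall>i. \<exists>e. qp_p ^ e * f i \<in> zball 0" by (meson qp_scale_integral)
  then obtain d where d: "\<And>i. qp_p ^ d i * f i \<in> zball 0" by metis
  have "qp_p ^ (sum d ?E) * f i \<in> zball 0" for i
  proof (cases "i \<in> ?E")
    case True
    then have "d i \<le> sum d ?E" using fin by (intro member_le_sum) auto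
    then show ?thesis using d qp_scale_mono by blast
  next
    case False
    then show ?thesis using qp_scale_mono[of 0 "f i"] by simp
  qed
  then show ?thesis by (rule that)
qed

lemma has_psum_times:
  assumes f: "has_psum f s" and g: "has_psum g t"
  shows "has_psum (\<lambda>(i, j). f i * g j) (s * t)"
proof (rule has_psumI)
  fix N
  obtain d where d: "\<And>i. qp_p ^ d * f i \<in> zball 0"
    using null_fam_bounded[OF has_psum_null[OF f]] by blast
  obtain e where e: "\<And>j. qp_p ^ e * g j \<in> zball 0"
    using null_fam_bounded[OF has_psum_null[OF g]] by blast
  obtain b where b: "qp_p ^ b * t \<in> zball 0" by (rule qp_scale_integral)
  \<comment> \<open>The thresholds make up for the denominators: p^d clears all terms of f, p^e all
    terms of g, and p^b the sum t.\<close>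
  let ?A = "{i. f i \<notin> zball (N + (b + e))}" and ?B = "{j. g j \<notin> zball (N + d)}"
  have A: "finite ?A" using f has_psum_null null_famD by blast
  have B: "finite ?B" using g has_psum_null null_famD by blast
  have small: "f i * g j \<in> zball N" if "(i, j) \<notin> ?A \<times> ?B" for i j
  proof (cases "i \<in> ?A")
    case True
    then have "g j \<in> zball (N + d)" using that by simp
    from zball_mult_scaled[OF this d[of i]] show ?thesis by (simp add: mult.commute)
  next
    case False
    then have "f i \<in> zball (N + e)" using zball_mono[of "N + e" "N + (b + e)"] by auto
    from zball_mult_scaled[OF this e[of j]] show ?thesis .
  qed
  have "s - sum f ?A \<in> zball (N + (b + e))" by (rule has_psumD[OF f A]) blast
  then have "s - sum f ?A \<in> zball (N + b)" by (rule zball_mono[rotated]) simp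
  from zball_mult_scaled[OF this b] have 1: "(s - sum f ?A) * t \<in> zball N" .
  have "qp_p ^ d * sum f ?A \<in> zball 0" unfolding sum_distrib_left by (intro zball_sum d)
  moreover have "t - sum g ?B \<in> zball (N + d)" by (rule has_psumD[OF g B]) blast
  ultimately have 2: "(t - sum g ?B) * sum f ?A \<in> zball N" using zball_mult_scaled by blast
  have "(\<Sum>(i, j)\<in>?A \<times> ?B. f i * g j) = sum f ?A * sum g ?B"
    by (simp add: sum_product sum.cartesian_product)
  then have "s * t - (\<Sum>(i, j)\<in>?A \<times> ?B. f i * g j)
      = (s - sum f ?A) * t + (t - sum g ?B) * sum f ?A"
    by (simp add: algebra_simps)
  then have "s * t - (\<Sum>(i, j)\<in>?A \<times> ?B. f i * g j) \<in> zball N" using zball_add[OF 1 2] by simp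
  then show "\<exists>A. finite A \<and> (\<forall>i. i \<notin> A \<longrightarrow> (case i of (i, j)
      \<Rightarrow> f i * g j) \<in> zball N) \<and>
      s * t - (\<Sum>(i, j)\<in>A. f i * g j) \<in> zball N"
    using A B small by (intro exI[of _ "?A \<times> ?B"]) auto
qed

section \<open>The Dwork exponential\<close>

text \<open>This is exp(sX + (sX)^p/p). At X = pi it is Dwork's exp(pi (s - s^p)) in formal terms,
  since pi^p/p = -pi.\<close>

definition dwork_fps :: "'p :: prime_card padic \<Rightarrow> 'p padic fps" where
  "dwork_fps s = fps_exp s * (fps_exp (s ^ CARD('p) / qp_p) oo fps_X ^ CARD('p))"

definition dwork_coeff :: "nat \<Rightarrow> 'p :: prime_card padic" where
  "dwork_coeff n = fps_nth (dwork_fps 1) n"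

text \<open>Only positions congruent to a modulo d contribute, and a < d makes the positions a + d *
  i with i <= k all of these.\<close>

lemma fps_mult_compose_X_power_nth:
  fixes f g :: "'a :: comm_ring_1 fps"
  assumes "a < d"
  shows "fps_nth (f * (g oo fps_X ^ d)) (a + d * k) = (\<Sum>i\<le>k. fps_nth f (a + d * i) * fps_nth g (k
      - i))"
proof -
  have d: "d > 0" using assms by simp
  let ?n = "a + d * k"
  let ?h = "\<lambda>j. fps_nth f j * fps_nth (g oo fps_X ^ d) (?n - j)"
  have "fps_nth (f * (g oo fps_X ^ d)) ?n = (\<Sum>j\<in>{0..?n}. ?h j)" by (simp add: fps_mult_nth)
  also have "\<dots> = (\<Sum>j\<in>(\<lambda>i. a + d * i) ` {..k}. ?h j)"
  proof (rule sum.mono_neutral_right)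
    show "(\<lambda>i. a + d * i) ` {..k} \<subseteq> {0..?n}" by auto
    show "\<forall>j\<in>{0..?n} - (\<lambda>i. a + d * i) ` {..k}. ?h j = 0"
    proof
      fix j assume j: "j \<in> {0..?n} - (\<lambda>i. a + d * i) ` {..k}"
      have "\<not> d dvd ?n - j"
      proof
        assume "d dvd ?n - j"
        then obtain i where i: "?n - j = d * i" by auto
        moreover have "j \<le> ?n" using j by simp
        ultimately have i': "a + d * k = j + d * i" by linarith
        have "i \<le> k"
        proof (rule ccontr)
          assume "\<not> i \<le> k"
          then have "d * Suc k \<le> d * i" by (intro mult_le_mono) auto
          then show False using i' assms by simp
        qed
        then have "j = a + d * (k - i)" using i' by (simp add: diff_mult_distrib2)
        then show False using j by auto
      qed
      then show "?h j = 0" by (simp add: fps_nth_compose_X_power)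
    qed
  qed simp
  also have "\<dots> = (\<Sum>i\<le>k. ?h (a + d * i))"
    using d by (subst sum.reindex) (auto simp: inj_on_def)
  also have "\<dots> = (\<Sum>i\<le>k. fps_nth f (a + d * i) * fps_nth g (k - i))"
  proof (rule sum.cong)
    fix i assume "i \<in> {..k}"
    then have "?n - (a + d * i) = d * (k - i)" by (simp add: diff_mult_distrib2)
    then show "?h (a + d * i) = fps_nth f (a + d * i) * fps_nth g (k - i)"
      using d by (simp add: fps_nth_compose_X_power)
  qed simp
  finally show ?thesis .
qed

lemma dwork_fps_mult:
  "dwork_fps s * dwork_fps t =
     fps_exp (s + t) * (fps_exp ((s ^ CARD('p) + t ^ CARD('p)) / qp_p) oo fps_X ^ CARD('p))"
  for s t :: "'p :: prime_card padic"
proof -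
  have "(fps_X ^ CARD('p) :: 'p padic fps) $ 0 = 0" by (simp add: fps_X_power_nth)
  then show ?thesis
    by (simp add: dwork_fps_def fps_exp_add_mult add_divide_distrib fps_compose_mult_distrib mult_ac)
qed

text \<open>Homogeneity: the series with parameter s arises from the one with parameter 1 by
  substituting sX for X.\<close>

lemma fps_nth_dwork_fps:
  "fps_nth (dwork_fps s) n = s ^ n * (dwork_coeff n :: 'p :: prime_card padic)"
proof -
  have p: "CARD('p) > 0" by simp
  define a k where "a = n mod CARD('p)" and "k = n div CARD('p)"
  have a: "a < CARD('p)" and n: "n = a + CARD('p) * k" using p by (simp_all add: a_def k_def)
  have "s ^ (a + CARD('p) * i) * (s ^ CARD('p)) ^ (k - i) = s ^ n" if "i \<le> k" for i
  proof -
    have "CARD('p) * i + CARD('p) * (k - i) = CARD('p) * k"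
      using that by (simp add: distrib_left[symmetric])
    then show ?thesis by (simp add: n power_add[symmetric] power_mult[symmetric] add.assoc)
  qed
  then have "s ^ (a + CARD('p) * i) / fact (a + CARD('p) * i) * ((s ^ CARD('p) / qp_p) ^ (k - i) / fact (k - i))
    = s ^ n * (1 / fact (a + CARD('p) * i) * ((1 / qp_p) ^ (k - i) / fact (k - i)))" if "i \<le> k" for i
    using that by (simp add: power_divide field_simps)
  then have "fps_nth (dwork_fps s) n = (\<Sum>i\<le>k. s ^ n * (1 / fact (a + CARD('p) * i)
      * ((1 / qp_p) ^ (k - i) / fact (k - i))))"
    unfolding dwork_fps_def n fps_mult_compose_X_power_nth[OF a] fps_exp_nth
    by (intro sum.cong) (simp_all add: n)
  then show ?thesis
    unfolding dwork_coeff_def dwork_fps_def n fps_mult_compose_X_power_nth[OF a] fps_exp_nth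
    by (simp add: sum_distrib_left)
qed

text \<open>The coefficient form of the differential equation F' = (1 + X^(p-1)) F.\<close>

lemma dwork_coeff_rec:
  "of_nat (n + CARD('p)) * dwork_coeff (n + CARD('p)) = dwork_coeff (n + CARD('p) - 1)
      + (dwork_coeff n :: 'p :: prime_card padic)"
proof -
  obtain q where q: "CARD('p) = Suc q" by (cases "CARD('p)") auto
  have X0: "(fps_X ^ CARD('p) :: 'p padic fps) $ 0 = 0" by (simp add: fps_X_power_nth)
  have "fps_deriv (fps_X ^ CARD('p) :: 'p padic fps) = fps_const qp_p * fps_X ^ q"
    unfolding q by (subst fps_deriv_power) (simp add: fps_of_nat)
  then have "fps_deriv (dwork_fps (1 :: 'p padic)) = dwork_fps 1 + dwork_fps 1 * (fps_const (inverse qp_p)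
      * fps_const qp_p) * fps_X ^ q"
    using X0 by (simp add: dwork_fps_def fps_compose_deriv fps_compose_mult_distrib field_simps del:
        fps_const_mult)
  then have "fps_deriv (dwork_fps (1 :: 'p padic)) = dwork_fps 1 + dwork_fps 1 * fps_X ^ q"
    by simp
  then have "fps_nth (fps_deriv (dwork_fps (1 :: 'p padic))) (n + q)
      = fps_nth (dwork_fps 1 + dwork_fps 1 * fps_X ^ q) (n + q)"
    by simp
  then show ?thesis by (simp add: dwork_coeff_def q fps_X_power_mult_right_nth)
qed

text \<open>The normalisation by (-p)^k k! turns the right side into the k-th difference of the
  numbers (-p)^i i! / (a + pi)!, which are the values Gamma_p(-(a + pi)) by
  \<open>morita_Gamma_minus_of_nat\<close>.\<close>

lemma dwork_coeff_eq_sum: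
  assumes "a < CARD('p)"
  shows "(- qp_p) ^ k * fact k * (dwork_coeff (a + CARD('p) * k) :: 'p :: prime_card padic) =
    (\<Sum>i\<le>k. (- 1) ^ (k - i) * of_nat (k choose i) * ((- qp_p) ^ i * fact i / fact (a + CARD('p) * i)))"
proof -
  have "(- qp_p) ^ k * fact k * (1 / fact (a + CARD('p) * i) * ((1 / qp_p) ^ (k - i) / fact (k - i))) =
      (- 1) ^ (k - i) * of_nat (k choose i) * ((- qp_p) ^ i * fact i / fact (a + CARD('p) * i) :: 'p padic)"
    if "i \<le> k" for i
  proof -
    obtain j where k: "k = i + j" using le_Suc_ex[OF \<open>i \<le> k\<close>] by blast
    have "of_nat (k choose i) = (fact k / (fact i * fact j) :: 'p padic)"
      using binomial_fact[OF that, where 'a="'p padic"] by (simp add: k)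
    then show ?thesis
      by (simp add: k power_add power_divide power_minus[of qp_p] field_simps)
  qed
  then show ?thesis
    unfolding dwork_coeff_def dwork_fps_def fps_mult_compose_X_power_nth[OF assms] sum_distrib_left
        fps_exp_nth power_one
    by (intro sum.cong) auto
qed

text \<open>The inverse relation, from exp X = F exp(-X^p/p). The binomial coefficients are written
  as rising factorials of -m because -m is later replaced by a p-adic integer that it
  approximates.\<close>

lemma sum_dwork_coeff:
  assumes "a < CARD('p)"
  shows "(\<Sum>i\<le>m. qp_p ^ i * pochhammer (- of_nat m) i * dwork_coeff (a + CARD('p) * i)) =
    ((- qp_p) ^ m * fact m / fact (a + CARD('p) * m) :: 'p :: prime_card padic)"
proof -
  let ?E = "\<lambda>c :: 'p padic. fps_exp c oo fps_X ^ CARD('p)"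
  have X0: "(fps_X ^ CARD('p) :: 'p padic fps) $ 0 = 0" by (simp add: fps_X_power_nth)
  have "?E (1 / qp_p) * ?E (- 1 / qp_p) = 1"
    using X0 by (simp add: fps_compose_mult_distrib[symmetric] fps_exp_add_mult[symmetric])
  then have "fps_exp 1 = dwork_fps 1 * ?E (- 1 / qp_p)"
    by (simp add: dwork_fps_def mult.assoc)
  then have "fps_nth (fps_exp 1) (a + CARD('p) * m) =
      (\<Sum>i\<le>m. dwork_coeff (a + CARD('p) * i) * ((- 1 / qp_p) ^ (m - i) / fact (m - i)) :: 'p padic)"
    using fps_mult_compose_X_power_nth[OF assms, of "dwork_fps 1 :: 'p padic fps" "fps_exp (- 1 / qp_p)" m]
    by (simp add: dwork_coeff_def)
  then have "(- qp_p) ^ m * fact m * fps_nth (fps_exp 1) (a + CARD('p) * m) = (\<Sum>i\<le>m.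
      (- qp_p) ^ m * fact m * (dwork_coeff (a + CARD('p) * i) * ((- 1 / qp_p) ^ (m - i) / fact (m
          - i)) :: 'p padic))"
    by (simp only: sum_distrib_left)
  then have *: "(- qp_p) ^ m * fact m / fact (a + CARD('p) * m) = (\<Sum>i\<le>m.
      (- qp_p) ^ m * fact m * (dwork_coeff (a + CARD('p) * i) * ((- 1 / qp_p) ^ (m - i) / fact (m
          - i)) :: 'p padic))"
    by simp
  have "(- qp_p) ^ m * fact m * (dwork_coeff (a + CARD('p) * i) * ((- 1 / qp_p) ^ (m - i) / fact (m - i))) =
       qp_p ^ i * pochhammer (- of_nat m) i * (dwork_coeff (a + CARD('p) * i) :: 'p padic)" if "i \<le> m" for i
  proof -
    obtain j where m: "m = i + j" using le_Suc_ex[OF \<open>i \<le> m\<close>] by blast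
    have "pochhammer (- of_nat m :: 'p padic) i = (- 1) ^ i * fact i * of_nat (m choose i)"
      unfolding binomial_gbinomial gbinomial_pochhammer by simp
    also have "of_nat (m choose i) = (fact m / (fact i * fact j) :: 'p padic)"
      using binomial_fact[OF that, where 'a="'p padic"] by (simp add: m)
    finally have "pochhammer (- of_nat m :: 'p padic) i = (- 1) ^ i * (fact m / fact j)" by simp
    moreover have "(- qp_p) ^ m * (- 1 / qp_p) ^ j = (- 1) ^ i * (qp_p ^ i :: 'p padic)"
    proof -
      have "(- qp_p) ^ j * (- 1 / qp_p) ^ j = (1 :: 'p padic)"
        by (simp add: power_mult_distrib[symmetric])
      moreover have "(- qp_p) ^ i = (- 1) ^ i * (qp_p ^ i :: 'p padic)" by (rule power_minus)
      ultimately show ?thesis by (simp add: m power_add mult.assoc)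
    qed
    then have "(- qp_p) ^ m * fact m * (dwork_coeff (a + CARD('p) * i) * ((- 1 / qp_p) ^ j / fact j)) =
       ((- 1) ^ i * qp_p ^ i) * fact m * (dwork_coeff (a + CARD('p) * i) / fact j :: 'p padic)"
      by (simp only: times_divide_eq_right mult_ac)
    ultimately show ?thesis by (auto simp add: m mult.commute)
  qed
  then show ?thesis unfolding * by (intro sum.cong refl) (metis atMost_iff)
qed

text \<open>Descending from 0, every unit up to n ends up in the denominator and every multiple of p
  contributes a sign. The product of the units up to n is n! / (p^k k!) with k = n div p.\<close>

lemma morita_Gamma_minus_of_nat:
  assumes "odd CARD('p)"
  shows "zp (morita_Gamma (- of_nat n :: 'p :: prime_card padic_int)) =
     (- qp_p) ^ (n div CARD('p)) * fact (n div CARD('p)) / fact n"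
proof (induction n)
  case 0
  show ?case by (simp add: morita_Gamma_0[OF assms])
next
  case (Suc n)
  let ?y = "- of_nat (Suc n) :: 'p padic_int" and ?p = "CARD('p)"
  have "morita_Gamma (?y + 1) = morita_Gamma ?y * morita_factor ?y" by (rule morita_Gamma_plus_1[OF assms])
  then have eq: "zp (morita_Gamma ?y) * zp (morita_factor ?y)
      = (- qp_p) ^ (n div ?p) * fact (n div ?p) / fact n"
    using Suc by (simp flip: zp_mult)
  have f: "morita_factor ?y = (if ?p dvd Suc n then - 1 else of_nat (Suc n))"
    unfolding morita_factor_def dvd_minus_iff padic_p_dvd_of_nat_iff by simp
  show ?case
  proof (cases "?p dvd Suc n")
    case True
    then obtain k where k: "Suc n = ?p * k" by auto
    then obtain j where j: "k = Suc j" by (cases k) auto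
    have "n div ?p = j"
      using k j CARD_gt_1[where 'p='p] by (intro div_nat_eqI) auto
    moreover have "Suc n div ?p = Suc j" using k j by simp
    moreover have "of_nat (Suc n) = (qp_p * of_nat (Suc j) :: 'p padic)" unfolding k j
        by (simp only: of_nat_mult)
    moreover have "zp (morita_Gamma ?y) = - ((- qp_p) ^ (n div ?p) * fact (n div ?p) / fact n)"
      using eq True by (simp only: f if_True zp_uminus zp_1) (metis add.inverse_inverse mult.right_neutral
          mult_minus_right)
    ultimately show ?thesis by (simp add: field_simps del: of_nat_Suc)
  next
    case False
    then have "Suc n div ?p = n div ?p" by (simp add: div_Suc dvd_eq_mod_eq_0)
    moreover have "(of_nat (Suc n) :: 'p padic) \<noteq> 0" by (simp only: of_nat_eq_0_iff)
    ultimately show ?thesis using eq False by (simp add: f field_simps del: of_nat_Suc)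
  qed
qed

subsection \<open>Estimates for the coefficients\<close>

text \<open>If $G(m + 1) = G(m) w(m)$, then the difference operator maps $G q$ to $G r$ where
  $r = (w - 1) q(X + 1) + (q(X + 1) - q)$. In the situation at hand $w - 1$ has index $1$ in the
  following sense, so that each difference raises the index of the polynomial factor by one and the
  $k$-th difference of $G$ is divisible by $p^{\lceil k/2 \rceil}$.\<close>

definition slope_half :: "nat \<Rightarrow> 'p :: prime_card padic_int poly \<Rightarrow> bool" where
  "slope_half j q \<longleftrightarrow> (\<forall>d. padic_p ^ ((j + d + 1) div 2) dvd coeff q d)"

lemma slope_half_dvdD: "slope_half j q \<Longrightarrow> 2 * e \<le> j + d
    + 1 \<Longrightarrow> padic_p ^ e dvd coeff q d"
  unfolding slope_half_def by (rule dvd_trans[OF le_imp_power_dvd[of e "(j + d + 1) div 2"]]) auto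

lemma slope_half_add: "slope_half j q \<Longrightarrow> slope_half j r \<Longrightarrow> slope_half j (q + r)"
  by (simp add: slope_half_def)

lemma slope_half_uminus: "slope_half j q \<Longrightarrow> slope_half j (- q)"
  by (simp add: slope_half_def)

lemma slope_half_mono:
  assumes "slope_half i q" "j \<le> i"
  shows "slope_half j q"
proof -
  have "2 * ((j + d + 1) div 2) \<le> i + d + 1" for d using assms(2) by linarith
  then show ?thesis using slope_half_dvdD[OF assms(1)] unfolding slope_half_def by blast
qed

lemma slope_half_mult:
  assumes "slope_half i q" "slope_half j r"
  shows "slope_half (i + j) (q * r)"
  unfolding slope_half_def coeff_mult
proof (intro allI dvd_sum)
  fix d l :: nat assume "l \<in> {..d}"
  then have "(i + j + d + 1) div 2 \<le> (i + l + 1) div 2 + (j + (d - l) + 1) div 2" by auto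
  then have "padic_p ^ ((i + j + d + 1) div 2) dvd (padic_p ^ ((i + l + 1) div 2) * padic_p ^ ((j + (d - l)
      + 1) div 2) :: 'a padic_int)"
    by (simp add: power_add[symmetric] le_imp_power_dvd)
  also have "\<dots> dvd coeff q l * coeff r (d - l)"
    using assms unfolding slope_half_def by (intro mult_dvd_mono) blast+
  finally show "padic_p ^ ((i + j + d + 1) div 2) dvd coeff q l * coeff r (d - l)" .
qed

lemma slope_half_pCons_iff:
  "slope_half j (pCons c r) \<longleftrightarrow> padic_p ^ ((j + 1) div 2) dvd c \<and> slope_half (Suc j) r"
proof -
  have *: "(\<forall>d. P d) \<longleftrightarrow> P 0 \<and> (\<forall>d. P (Suc d))" for P :: "nat
      \<Rightarrow> bool"
    by (metis not0_implies_Suc)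
  show ?thesis unfolding slope_half_def by (subst *) simp
qed

text \<open>The difference q(X + 1) - q lowers degrees by one. Degree and index enter the condition
  only through their sum, so the lost degree is regained as index.\<close>

lemma slope_half_shift:
  assumes "slope_half j q"
  shows "slope_half j (q \<circ>\<^sub>p [:1, 1:]) \<and> slope_half (Suc j) (q \<circ>\<^sub>p [:1, 1:] - q)"
  using assms
proof (induction q arbitrary: j rule: pCons_induct)
  case 0
  show ?case by (simp add: slope_half_def)
next
  case (pCons c r)
  let ?r = "r \<circ>\<^sub>p [:1, 1:]"
  have c: "padic_p ^ ((j + 1) div 2) dvd c" and "slope_half (Suc j) r"
    using pCons.prems by (simp_all add: slope_half_pCons_iff)
  then have IH: "slope_half (Suc j) ?r" "slope_half (Suc (Suc j)) (?r - r)"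
    using pCons.IH by blast+
  have 1: "pCons c r \<circ>\<^sub>p [:1, 1:] = pCons c ?r + ?r"
    by (simp add: pcompose_pCons algebra_simps)
  have 2: "pCons c r \<circ>\<^sub>p [:1, 1:] - pCons c r = pCons 0 (?r - r) + ?r"
    by (simp add: 1 algebra_simps)
  show ?case unfolding 2 unfolding 1
    using IH c by (auto intro!: slope_half_add simp: slope_half_pCons_iff intro: slope_half_mono[of "Suc j"
        _ j])
qed

context
  assumes odd: "odd CARD('p :: prime_card)"
begin

text \<open>Adding p m does not change which factors are units, so each factor is constant or linear
  in m with slope -p. Hence p^d divides the coefficient of m^d, which is at least the required power
  for d >= 1; the constant term is 1 modulo p by \<open>morita_block_prime\<close>.\<close>

lemma morita_block_poly:
  fixes x :: "'p padic_int"
  obtains w where "\<And>m. poly w (of_nat m) = morita_block CARD('p) (x + padic_p * of_nat m)"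
    and "slope_half 1 (w - 1)"
proof -
  define f :: "nat \<Rightarrow> 'p padic_int poly" where
    "f i = (if padic_p dvd x + of_nat i then [:- 1:] else [:- (x + of_nat i), - padic_p:])" for i
  define w where "w = (\<Prod>i<CARD('p). f i)"
  have "poly (f i) y = morita_factor (x + padic_p * y + of_nat i)" for i y
  proof -
    have "x + padic_p * y + of_nat i = x + of_nat i + padic_p * y" by (simp add: ac_simps)
    then have "morita_factor (x + padic_p * y + of_nat i) = morita_factor (x + of_nat i)
        - (if padic_p dvd x + of_nat i then 0 else padic_p * y)"
      by (simp only:) (rule morita_factor_shift, simp)
    then show ?thesis by (simp add: f_def morita_factor_def[of "x + of_nat i"])
  qed
  then have w: "poly w y = morita_block CARD('p) (x + padic_p * y)" for y
    by (simp add: w_def poly_prod morita_block_def)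
  have deg: "\<forall>d. padic_p ^ d dvd coeff (\<Prod>i<n. f i) d" for n
  proof (induction n)
    case (Suc n)
    have f: "padic_p ^ d dvd coeff (f n) d" for d
      by (cases d) (auto simp: f_def coeff_pCons split: nat.splits)
    show ?case
    proof
      fix d
      have "padic_p ^ d dvd (\<Sum>i\<le>d. coeff (\<Prod>i<n. f i) i * coeff (f n) (d - i))"
      proof (rule dvd_sum)
        fix i assume "i \<in> {..d}"
        then have "(padic_p ^ d :: 'p padic_int) = padic_p ^ i * padic_p ^ (d - i)"
            by (simp add: power_add[symmetric])
        then show "padic_p ^ d dvd coeff (\<Prod>i<n. f i) i * coeff (f n) (d - i)"
          using Suc f mult_dvd_mono by metis
      qed
      then show "padic_p ^ d dvd coeff (\<Prod>i<Suc n. f i) d" by (simp add: coeff_mult)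
    qed
  qed (simp add: coeff_1 split: if_splits)
  have "slope_half 1 (w - 1)"
    unfolding slope_half_def
  proof
    fix d
    show "padic_p ^ ((1 + d + 1) div 2) dvd coeff (w - 1) d"
    proof (cases d)
      case 0
      have "coeff w 0 = morita_block CARD('p) x" using w[of 0] by (simp add: poly_0_coeff_0)
      then show ?thesis using 0 morita_block_prime[OF odd, of x] by simp
    next
      case (Suc e)
      then have "(1 + d + 1) div 2 \<le> d" by simp
      then have "padic_p ^ ((1 + d + 1) div 2) dvd (padic_p ^ d :: 'p padic_int)" by (rule le_imp_power_dvd)
      also have "\<dots> dvd coeff w d" using deg w_def by blast
      finally show ?thesis using Suc by (simp add: coeff_1)
    qed
  qed
  then show ?thesis using w that by blast
qed

lemma morita_Gamma_difference:
  fixes x :: "'p padic_int"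
  shows "padic_p ^ ((k + 1) div 2) dvd
    (\<Sum>i\<le>k. (- 1) ^ i * of_nat (k choose i) * morita_Gamma (x + padic_p * of_nat i))"
proof -
  define G where "G m = morita_Gamma (x + padic_p * of_nat m)" for m
  obtain w where w: "\<And>m. poly w (of_nat m) = morita_block CARD('p) (x + padic_p * of_nat m)"
    and S: "slope_half 1 (w - 1)" using morita_block_poly by blast
  have Gamma_add: "morita_Gamma (y + of_nat n) = morita_Gamma y * morita_block n y" for y :: "'p padic_int"
      and n
  proof (induction n)
    case (Suc n)
    have "morita_Gamma (y + of_nat (Suc n)) = morita_Gamma ((y + of_nat n) + 1)" by (simp add: ac_simps)
    then show ?case by (simp only: morita_Gamma_plus_1[OF odd] Suc) (simp add: morita_block_def mult.assoc)
  qed (simp add: morita_block_def)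
  have G: "G (Suc m) = G m * poly w (of_nat m)" for m
    using Gamma_add[of "x + padic_p * of_nat m" "CARD('p)"] by (simp add: G_def w algebra_simps)
  define B where "B k m = (\<Sum>i\<le>k. (- 1) ^ i * of_nat (k choose i) * G (m + i))" for k m
  have B_Suc: "B (Suc k) m = B k m - B k (Suc m)" for k m
  proof -
    have "B (Suc k) m = G m + (\<Sum>i\<le>k. (- 1) ^ Suc i * of_nat (Suc k choose Suc i) * G (m + Suc i))"
      unfolding B_def by (subst sum.atMost_Suc_shift) simp
    also have "(\<Sum>i\<le>k. (- 1) ^ Suc i * of_nat (Suc k choose Suc i) * G (m + Suc i)) =
        (\<Sum>i\<le>k. (- 1) ^ Suc i * of_nat (k choose Suc i) * G (m + Suc i)) - B k (Suc m)"
      by (simp add: B_def algebra_simps sum.distrib sum_subtractf sum_negf)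
    also have "G m + \<dots> = (\<Sum>i\<le>Suc k. (- 1) ^ i * of_nat (k choose i) * G (m + i)) - B k (Suc m)"
      by (subst sum.atMost_Suc_shift) simp
    also have "(\<Sum>i\<le>Suc k. (- 1) ^ i * of_nat (k choose i) * G (m + i)) = B k m"
      by (simp add: B_def binomial_eq_0)
    finally show ?thesis .
  qed
  have "\<exists>q. slope_half k q \<and> (\<forall>m. B k m = G m * poly q (of_nat m))" for k
  proof (induction k)
    case 0
    have "slope_half 0 (1 :: 'p padic_int poly)" by (simp add: slope_half_def coeff_1)
    then show ?case by (intro exI[of _ 1]) (simp add: B_def)
  next
    case (Suc k)
    then obtain q where q: "slope_half k q" "\<And>m. B k m = G m * poly q (of_nat m)" by blast
    let ?q = "q \<circ>\<^sub>p [:1, 1:]"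
    \<comment> \<open>The minus sign is there because \<open>B\<close> takes differences as B k m -
      B k (m + 1).\<close>
    let ?r = "- ((w - 1) * ?q + (?q - q))"
    have "slope_half (Suc k) ?r"
      using slope_half_mult[OF S conjunct1[OF slope_half_shift[OF q(1)]]] slope_half_shift[OF q(1)]
      by (intro slope_half_uminus slope_half_add) simp_all
    moreover have "B (Suc k) m = G m * poly ?r (of_nat m)" for m
      by (simp add: B_Suc q G poly_pcompose algebra_simps)
    ultimately show ?case by blast
  qed
  then obtain q where q: "slope_half k q" "\<And>m. B k m = G m * poly q (of_nat m)" by blast
  have "padic_p ^ ((k + 1) div 2) dvd poly q 0"
    using q(1) slope_half_dvdD[of k q "(k + 1) div 2" 0] by (simp add: poly_0_coeff_0)
  then have "padic_p ^ ((k + 1) div 2) dvd B k 0" using q(2)[of 0] by simp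
  then show ?thesis by (simp add: B_def G_def)
qed

text \<open>The sum in \<open>dwork_coeff_eq_sum\<close>, read backwards, is a k-th difference of
  Gamma_p with step p that starts at -(a + pk).\<close>

lemma dwork_coeff_in_zball:
  assumes a: "a < CARD('p)"
  shows "(- qp_p) ^ k * fact k * (dwork_coeff (a + CARD('p) * k) :: 'p padic) \<in> zball ((k + 1) div 2)"
proof -
  define x :: "'p padic_int" where "x = - of_nat (a + CARD('p) * k)"
  have "(- qp_p) ^ i * fact i / fact (a + CARD('p) * i) = zp (morita_Gamma (x + padic_p * of_nat (k - i)))"
      if "i \<le> k" for i
  proof -
    have "x + padic_p * of_nat (k - i) = - of_nat (a + CARD('p) * i)"
      using that by (simp add: x_def of_nat_diff algebra_simps)
    moreover have "(a + CARD('p) * i) div CARD('p) = i" using a by simp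
    ultimately show ?thesis using morita_Gamma_minus_of_nat[OF odd, of "a + CARD('p) * i"] by simp
  qed
  then have "(- qp_p) ^ k * fact k * (dwork_coeff (a + CARD('p) * k) :: 'p padic) =
     (\<Sum>i\<le>k. (- 1) ^ (k - i) * of_nat (k choose i) * zp (morita_Gamma (x + padic_p * of_nat (k - i))))"
    unfolding dwork_coeff_eq_sum[OF a] by (intro sum.cong) auto
  also have "\<dots> = (\<Sum>i\<le>k. (- 1) ^ i * of_nat (k choose i) * zp (morita_Gamma (x + padic_p
      * of_nat i)))"
    by (rule sum.reindex_bij_witness[of _ "\<lambda>i. k - i" "\<lambda>i. k
        - i"]) (auto simp: binomial_symmetric[symmetric])
  also have "\<dots> = zp (\<Sum>i\<le>k. (- 1) ^ i * of_nat (k choose i) * morita_Gamma (x + padic_p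
      * of_nat i))"
    by (simp add: zp_sum zp_mult zp_power zp_uminus)
  finally show ?thesis using morita_Gamma_difference[of k x] by (simp only: zp_in_zball_iff)
qed

text \<open>Legendre's bound for the valuation of k!, by descent from k to q = k div p: since
  Gamma_p(-k) is integral, v(k!) <= q + v(q!).\<close>

lemma inverse_fact_in_zball:
  "qp_p ^ (k div (CARD('p) - 1)) * inverse (fact k) \<in> (zball 0 :: 'p padic set)"
proof (induction k rule: less_induct)
  case (less k)
  let ?p = "CARD('p)"
  define q where "q = k div ?p"
  have p: "?p \<ge> 3" by (rule CARD_ge_3[OF odd])
  show ?case
  proof (cases "k = 0")
    case False
    then have "q < k" using p by (simp add: q_def)
    have "(- qp_p) ^ q * fact q * inverse (fact k) = zp (morita_Gamma (- of_nat k :: 'p padic_int))"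
      using morita_Gamma_minus_of_nat[OF odd, of k] by (simp add: q_def field_simps)
    then have u: "(- qp_p) ^ q * fact q * inverse (fact k) \<in> (zball 0 :: 'p padic set)" by simp
    have "qp_p ^ (q + q div (?p - 1)) * inverse (fact k) =
        (- 1) ^ q * ((- qp_p) ^ q * fact q * inverse (fact k)) * (qp_p ^ (q div (?p - 1))
            * inverse (fact q) :: 'p padic)"
      by (cases "even q") (simp_all add: power_add)
    also have "\<dots> \<in> zball 0"
      by (rule zball_mult_left[OF zball_mult_left[OF zball_0_power[OF zball_uminus[OF one_in_zball_0]] u]
          less[OF \<open>q < k\<close>]])
    finally have 1: "qp_p ^ (q + q div (?p - 1)) * inverse (fact k) \<in> (zball 0 :: 'p padic set)" .
    have "(q + q div (?p - 1)) * (?p - 1) \<le> q * (?p - 1) + q"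
      by (simp add: distrib_right)
    also have "\<dots> = q * ?p" using p by (cases ?p) auto
    also have "\<dots> \<le> k" by (simp add: q_def)
    finally have "q + q div (?p - 1) \<le> k div (?p - 1)"
      using p by (simp add: less_eq_div_iff_mult_less_eq)
    with 1 show ?thesis by (rule qp_scale_mono)
  qed simp
qed

text \<open>Dividing the previous estimates gives v(c_n) >= ceiling(k/2) - k - floor(k/(p-1)) with k
  = n div p; the exponent e keeps the inequality within the natural numbers. As pi^n has valuation
  n/(p-1) >= k + k/(p-1), about k/2 is left over, and F converges at pi.\<close>

lemma dwork_coeff_bound:
  assumes "N + n div CARD('p) + n div CARD('p) div (CARD('p) - 1) \<le> e + (n div CARD('p) + 1) div 2"
  shows "qp_p ^ e * (dwork_coeff n :: 'p padic) \<in> zball N"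
proof -
  define k a where "k = n div CARD('p)" and "a = n mod CARD('p)"
  define s where "s = k + k div (CARD('p) - 1)"
  have n: "n = a + CARD('p) * k" and a: "a < CARD('p)" by (simp_all add: a_def k_def)
  let ?c = "dwork_coeff n :: 'p padic"
  have "qp_p ^ s * ?c = (- 1) ^ k * (qp_p ^ (k div (CARD('p) - 1)) * inverse (fact k)) * ((- qp_p) ^ k
      * fact k * ?c)"
    by (cases "even k") (simp_all add: s_def power_add)
  also have "\<dots> \<in> zball ((k + 1) div 2)"
    using dwork_coeff_in_zball[OF a, of k] unfolding n[symmetric]
    by (rule zball_mult_left[OF zball_mult_left[OF zball_0_power[OF zball_uminus[OF one_in_zball_0]]
        inverse_fact_in_zball]])
  finally have "qp_p ^ e * (qp_p ^ s * ?c) \<in> zball (e + (k + 1) div 2)"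
    by (rule zball_mult[OF qp_p_power_in_zball])
  then have "qp_p ^ e * (qp_p ^ s * ?c) \<in> zball (s + N)"
    by (rule zball_mono[rotated]) (use assms in \<open>simp add: s_def k_def\<close>)
  then have "qp_p ^ s * (qp_p ^ e * ?c) \<in> zball (s + N)" by (simp add: mult.left_commute)
  then show ?thesis unfolding zball_scale_iff .
qed

end

section \<open>The Gross--Koblitz formula\<close>

text \<open>The coefficient of pi^a in F(pi), since pi^(a + (p-1) j) = (-p)^j pi^a.\<close>

definition dwork_component :: "nat \<Rightarrow> 'p :: prime_card padic" where
  "dwork_component a = psum (\<lambda>j. (- qp_p) ^ j * dwork_coeff (a + (CARD('p) - 1) * j))"

lemma zp_pochhammer: "zp (pochhammer x n) = pochhammer (zp x) n"
  by (induction n) (simp_all add: pochhammer_Suc zp_mult zp_add)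

lemma pochhammer_cong_padic:
  fixes x y :: "'p :: prime_card padic_int"
  assumes "padic_p ^ N dvd x - y"
  shows "padic_p ^ N dvd pochhammer x i - pochhammer y i"
proof (induction i)
  case (Suc i)
  have "pochhammer x (Suc i) - pochhammer y (Suc i) =
      (pochhammer x i - pochhammer y i) * (x + of_nat i) + pochhammer y i * (x - y)"
    by (simp add: pochhammer_Suc algebra_simps)
  also have "padic_p ^ N dvd \<dots>" by (rule dvd_add[OF dvd_mult2[OF Suc] dvd_mult[OF assms]])
  finally show ?case .
qed simp

text \<open>Among p consecutive translates of x by integers one is divisible by p.\<close>

lemma padic_power_dvd_pochhammer:
  fixes x :: "'p :: prime_card padic_int"
  shows "padic_p ^ (n div CARD('p)) dvd pochhammer x n"
proof -
  let ?p = "CARD('p)"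
  have block: "padic_p dvd pochhammer z ?p" for z :: "'p padic_int"
  proof -
    obtain m where m: "padic_p ^ 1 dvd - z - of_nat m" by (rule padic_approx_nat)
    define i where "i = m mod ?p"
    have "(of_nat m :: 'p padic_int) = of_nat i + padic_p * of_nat (m div ?p)"
      unfolding i_def by (simp flip: of_nat_mult of_nat_add)
    then have "- z - of_nat m = - (z + of_nat i) - padic_p * of_nat (m div ?p)" by simp
    then have "padic_p dvd - (z + of_nat i) - padic_p * of_nat (m div ?p)" using m
        by (simp only: power_one_right)
    from dvd_add[OF this dvd_triv_left[of padic_p "of_nat (m div ?p)"]]
    have "padic_p dvd - (z + of_nat i)" by simp
    then have "padic_p dvd z + of_nat i" unfolding dvd_minus_iff .
    moreover have "i < ?p" by (simp add: i_def)
    ultimately show ?thesis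
      unfolding pochhammer_prod by (intro dvd_trans[OF _ dvd_prodI[of "{0..<?p}" i]]) auto
  qed
  have "padic_p ^ q dvd pochhammer x (?p * q)" for q
  proof (induction q)
    case (Suc q)
    have "pochhammer x (?p * Suc q) = pochhammer x (?p * q) * pochhammer (x + of_nat (?p * q)) ?p"
      using pochhammer_product'[of x "?p * q" ?p] by (simp add: add.commute)
    then show ?case by (simp only: power_Suc2 mult_dvd_mono[OF Suc block])
  qed simp
  moreover have "pochhammer x (?p * (n div ?p)) dvd pochhammer x n"
    using pochhammer_product'[of x "?p * (n div ?p)" "n mod ?p"] by simp
  ultimately show ?thesis using dvd_trans by blast
qed

text \<open>With k = n div p, the left side is at most kp/(p-1) <= n/(p-1), and n = a + I + (p-1)(j
  + I). It bounds the loss in \<open>dwork_coeff_bound\<close> for the indices that occur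
  below.\<close>

lemma div_bound:
  fixes a p I j :: nat
  assumes "3 \<le> p" "a < p - 1" "n = a + p * I + (p - 1) * j"
  shows "n div p + n div p div (p - 1) \<le> j + I + 1 + I div (p - 1)"
proof -
  let ?k = "n div p"
  obtain q where q: "p = Suc q" "q > 0" using assms(1) by (cases p) auto
  have "(?k + ?k div q) * q \<le> ?k * q + ?k" by (simp add: distrib_right)
  also have "\<dots> = p * ?k" using q by simp
  also have "\<dots> \<le> n" by simp
  also have "n = a + I + (j + I) * q" using assms(3) q by (simp add: algebra_simps)
  also have "\<dots> \<le> q + I + (j + I) * q" using assms(2) q by simp
  finally have "?k + ?k div q \<le> (I + (j + I + 1) * q) div q"
    using q by (simp add: less_eq_div_iff_mult_less_eq algebra_simps)
  also have "\<dots> = j + I + 1 + I div q" using q by (intro div_mult_self1) simp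
  finally show ?thesis using q by simp
qed

context
  fixes a :: nat and y :: "'p :: prime_card padic_int"
  assumes odd: "odd CARD('p)" and a: "a < CARD('p) - 1"
    and y: "of_nat (CARD('p) - 1) * y = of_nat a"
begin

private abbreviation cc :: "nat \<Rightarrow> nat \<Rightarrow> 'p padic" where
  "cc I j \<equiv> dwork_coeff ((a + CARD('p) * I + (CARD('p) - 1) * j))"

private abbreviation Y :: "'p padic" where "Y \<equiv> zp y"

private lemma zp_pochhammer_shift: "pochhammer (Y + of_nat j) I = zp (pochhammer (y + of_nat j) I)"
  by (simp add: zp_pochhammer zp_add)

private lemma null_base: "null_fam (\<lambda>j. qp_p ^ I * (- qp_p) ^ j * cc I j)"
proof (rule null_famI)
  fix N
  note p3 = CARD_ge_3[OF odd]
  \<comment> \<open>The gain (k + 1) div 2 has to cover N + 1 + Id, where Id <= I and k >= j div 2;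
    this leads to the threshold 4 (N + 1 + I) for j.\<close>
  have arith: "N + k + kd \<le> (I + j) + (k + 1) div 2"
    if "j div 2 \<le> k" "Id \<le> I" "k + kd \<le> j + I + 1 + Id" "4 * (N + 1
        + I) \<le> j" for j k kd Id :: nat
  proof -
    have "2 * (N + 1 + I) \<le> j div 2" using that(4) by (simp add: less_eq_div_iff_mult_less_eq)
    then have "N + 1 + I \<le> (k + 1) div 2" using that(1) by (simp add: less_eq_div_iff_mult_less_eq)
    then show ?thesis using that by linarith
  qed
  have "qp_p ^ I * (- qp_p) ^ j * cc I j \<in> zball N" if j: "j \<ge> 4 * (N + 1 + I)" for j
  proof -
    let ?k = "(a + CARD('p) * I + (CARD('p) - 1) * j) div CARD('p)"
    have k: "?k + ?k div (CARD('p) - 1) \<le> j + I + 1 + I div (CARD('p) - 1)"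
      by (rule div_bound[OF p3 a refl])
    have "CARD('p) * (j div 2) \<le> (2 * (CARD('p) - 1)) * (j div 2)"
      using p3 by (intro mult_right_mono) auto
    also have "\<dots> \<le> (CARD('p) - 1) * j" by simp
    finally have "j div 2 \<le> ?k" by (simp add: less_eq_div_iff_mult_less_eq mult.commute)
    moreover have "I div (CARD('p) - 1) \<le> I" by simp
    ultimately have "N + ?k + ?k div (CARD('p) - 1) \<le> (I + j) + (?k + 1) div 2"
      using k j arith by blast
    from dwork_coeff_bound[OF odd this]
    have "(- 1) ^ j * (qp_p ^ (I + j) * cc I j) \<in> zball N"
      by (rule zball_mult_left[OF zball_0_power[OF zball_uminus[OF one_in_zball_0]]])
    then show ?thesis by (simp add: power_add power_minus[of "qp_p :: 'p padic" j] mult_ac)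
  qed
  then show "\<exists>A. finite A \<and> (\<forall>j. j \<notin> A \<longrightarrow> qp_p ^ I
      * (- qp_p) ^ j * cc I j \<in> zball N)"
    by (intro exI[of _ "{..<4 * (N + 1 + I)}"]) auto
qed

text \<open>Let $n = a + p I + (p - 1) j$. The identity
  $n (Y + j + 1)_{I-1} = p (Y + j + 1)_I - (Y + j)_I$ says $V_I(j) - X_I(j) = T_{I-1}(j)$, and the
  recurrence for the coefficients says $T_I(j) = V_I(j) - X_I(j + 1)$. Hence
  $\sum_j T_I(j) = \sum_j T_{I-1}(j) + X_I(0)$, and these sums tend to $0$ as $I$ grows.\<close>

private definition Vs where "Vs I j = qp_p * pochhammer (Y + of_nat j + 1) I * (qp_p ^ I * (- qp_p) ^ j
    * cc I j)"
private definition Xs where "Xs I j = pochhammer (Y + of_nat j) I * (qp_p ^ I * (- qp_p) ^ j * cc I j)"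
private definition Ts where "Ts I j = qp_p ^ Suc I * (- qp_p) ^ j * of_nat ((a + CARD('p) * (Suc I)
    + (CARD('p) - 1) * j)) * pochhammer (Y + of_nat j + 1) I * cc (Suc I) j"

private lemma psum_V: "has_psum (Vs I) (psum (Vs I))"
proof (rule null_fam_has_psum)
  have "pochhammer (Y + of_nat j + 1) I \<in> zball 0" for j
    using zp_pochhammer_shift[of "Suc j" I] by (simp add: ac_simps)
  then show "null_fam (Vs I)"
    unfolding Vs_def by (intro null_fam_mult[OF null_base] zball_mult_left) auto
qed

private lemma psum_X: "has_psum (Xs I) (psum (Xs I))"
  unfolding Xs_def by (intro null_fam_has_psum null_fam_mult[OF null_base]) (simp add: zp_pochhammer_shift)

private lemma T_eq: "Ts I j = Vs I j - Xs I (Suc j)"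
proof -
  have p: "CARD('p) > 1" using CARD_gt_1 .
  have "(a + CARD('p) * (Suc I) + (CARD('p) - 1) * j) = (a + CARD('p) * I + (CARD('p) - 1) * j) + CARD('p)"
      by simp
  moreover have "(a + CARD('p) * I + (CARD('p) - 1) * j) + CARD('p) - 1
      = (a + CARD('p) * I + (CARD('p) - 1) * (Suc j))"
    using p unfolding mult_Suc_right by linarith
  ultimately have "of_nat ((a + CARD('p) * (Suc I) + (CARD('p) - 1) * j)) * cc (Suc I) j
      = cc I (Suc j) + cc I j"
    by (simp only: dwork_coeff_rec)
  then have "Ts I j = qp_p ^ Suc I * (- qp_p) ^ j * pochhammer (Y + of_nat j + 1) I * (cc I (Suc j) + cc I j)"
    by (simp only: Ts_def mult_ac)
  moreover have "Y + of_nat (Suc j) = Y + of_nat j + 1" by simp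
  then have "Xs I (Suc j) = pochhammer (Y + of_nat j + 1) I * (qp_p ^ I * (- qp_p) ^ Suc j * cc I (Suc j))"
    by (simp only: Xs_def)
  ultimately show ?thesis by (simp add: Vs_def algebra_simps)
qed

private lemma Y_eq: "of_nat (CARD('p) - 1) * Y = of_nat a"
  using arg_cong[OF y, of zp] unfolding zp_mult zp_of_nat .

private lemma V_minus_X:
  "Vs I j - Xs I j = (case I of 0 \<Rightarrow> of_nat (CARD('p) - 1) * ((- qp_p) ^ j
      * cc 0 j) | Suc I' \<Rightarrow> Ts I' j)"
proof (cases I)
  case 0
  have "of_nat (CARD('p) - 1) = (qp_p - 1 :: 'p padic)" using CARD_gt_1[where 'p='p] by (simp add: of_nat_diff)
  then show ?thesis using 0 by (simp add: Vs_def Xs_def algebra_simps)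
next
  case (Suc J)
  let ?z = "Y + of_nat j"
  have "of_nat (CARD('p) - 1) = (qp_p - 1 :: 'p padic)" using CARD_gt_1[where 'p='p] by (simp add: of_nat_diff)
  then have n: "of_nat (a + CARD('p) * (Suc J) + (CARD('p) - 1) * j)
      = (qp_p - 1) * Y + qp_p * (1 + of_nat J) + (qp_p - 1) * of_nat j"
    by (simp only: of_nat_add of_nat_mult Y_eq[symmetric] of_nat_Suc)
  have P: "pochhammer (?z + 1) (Suc J) = pochhammer (?z + 1) J * (?z + 1 + of_nat J)"
    "pochhammer ?z (Suc J) = ?z * pochhammer (?z + 1) J"
    by (rule pochhammer_Suc pochhammer_rec)+
  define K where "K = cc (Suc J) j"
  have "Vs (Suc J) j - Xs (Suc J) j = Ts J j"
    unfolding Vs_def Xs_def Ts_def P n K_def[symmetric] by (simp add: algebra_simps)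
  then show ?thesis by (simp add: Suc)
qed

private lemma psum_T: "has_psum (Ts I) (psum (Vs I) - psum (Xs I) + Xs I 0)"
proof -
  \<comment> \<open>Without its term at j = 0 the family vanishes off the range of
    \<open>Suc\<close> and can be reindexed.\<close>
  have "has_psum (\<lambda>j. Xs I j - (if j = 0 then Xs I 0 else 0)) (psum (Xs I) - Xs I 0)"
    by (intro has_psum_diff psum_X has_psum_single)
  then have "has_psum (\<lambda>j. Xs I (Suc j) - (if Suc j = 0 then Xs I 0 else 0)) (psum (Xs I) - Xs I 0)"
  proof (rule has_psum_reindex[of "\<lambda>j. Xs I j - (if j = 0 then Xs I 0 else 0)"])
    fix i assume "i \<notin> range Suc"
    then have "i = 0" by (cases i) auto
    then show "Xs I i - (if i = 0 then Xs I 0 else 0) = 0" by simp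
  qed simp
  then have "has_psum (\<lambda>j. Xs I (Suc j)) (psum (Xs I) - Xs I 0)" by simp
  from has_psum_diff[OF psum_V this, of I] show ?thesis unfolding T_eq by (simp add: algebra_simps)
qed

private lemma psum_T_0: "has_psum (Ts 0) (of_nat (CARD('p) - 1) * dwork_component a + Xs 0 0)"
proof -
  have "null_fam (\<lambda>j. (- qp_p) ^ j * cc 0 j)" using null_base[of 0] by simp
  then have "has_psum (\<lambda>j. (- qp_p) ^ j * cc 0 j) (dwork_component a)"
    using null_fam_has_psum by (simp add: dwork_component_def)
  then have "has_psum (\<lambda>j. of_nat (CARD('p) - 1) * ((- qp_p) ^ j * cc 0 j)) (of_nat (CARD('p) - 1)
      * dwork_component a)"
    by (rule has_psum_cmult)
  moreover have "has_psum (\<lambda>j. Vs 0 j - Xs 0 j) (psum (Vs 0) - psum (Xs 0))"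
    by (intro has_psum_diff psum_V psum_X)
  ultimately have "psum (Vs 0) - psum (Xs 0) = of_nat (CARD('p) - 1) * dwork_component a"
    using has_psum_unique unfolding V_minus_X by simp
  then show ?thesis using psum_T[of 0] by simp
qed

private lemma psum_T_sum:
  "has_psum (Ts I) (of_nat (CARD('p) - 1) * dwork_component a + (\<Sum>i\<le>I. Xs i 0))"
proof (induction I)
  case 0
  show ?case using psum_T_0 by simp
next
  case (Suc I)
  have "has_psum (\<lambda>j. Vs (Suc I) j - Xs (Suc I) j) (psum (Vs (Suc I)) - psum (Xs (Suc I)))"
    by (intro has_psum_diff psum_V psum_X)
  then have "has_psum (Ts I) (psum (Vs (Suc I)) - psum (Xs (Suc I)))" unfolding V_minus_X by simp
  note eq = has_psum_unique[OF this Suc]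
  show ?case using psum_T[of "Suc I"] unfolding eq by (simp only: sum.atMost_Suc add.assoc)
qed

private lemma T_small:
  assumes "I \<ge> 4 * N + 12"
  shows "Ts I j \<in> zball N"
proof -
  note p3 = CARD_ge_3[OF odd]
  let ?n = "(a + CARD('p) * (Suc I) + (CARD('p) - 1) * j)"
  let ?k = "?n div CARD('p)" and ?e = "Suc I + j + I div CARD('p)"
  have k: "?k + ?k div (CARD('p) - 1) \<le> j + Suc I + 1 + Suc I div (CARD('p) - 1)"
    by (rule div_bound[OF p3 a refl])
  have kI: "Suc I \<le> ?k" by (simp add: less_eq_div_iff_mult_less_eq mult.commute del: mult_Suc_right)
  have "N + ?k + ?k div (CARD('p) - 1) \<le> ?e + (?k + 1) div 2"
  \<comment> \<open>For p = 3 the loss Suc I div (p - 1) can use up the whole guaranteed gain (Suc I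
    + 1) div 2, and the factor p^(I div p) of the rising factorial must supply N. For p >= 5 the
    loss is at most a quarter of Suc I.\<close>
  proof (cases "CARD('p) = 3")
    case True
    have "N + 1 + Suc I div 2 \<le> I div 3 + (Suc I + 1) div 2" using assms by linarith
    also have "\<dots> \<le> I div 3 + (?k + 1) div 2" using kI by (intro add_left_mono div_le_mono) simp
    finally show ?thesis using k True by simp
  next
    case False
    moreover have "CARD('p) \<noteq> 4" using odd by auto
    ultimately have "CARD('p) - 1 \<ge> 4" using p3 by linarith
    then have "Suc I div (CARD('p) - 1) \<le> Suc I div 4" by (rule div_le_mono2[rotated]) simp
    then have "N + 1 + Suc I div (CARD('p) - 1) \<le> (Suc I + 1) div 2" using assms by linarith
    also have "\<dots> \<le> (?k + 1) div 2" using kI by (intro div_le_mono) simp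
    finally show ?thesis using k by linarith
  qed
  from dwork_coeff_bound[OF odd this] have c: "qp_p ^ ?e * cc (Suc I) j \<in> zball N" .
  obtain z where z: "pochhammer (y + of_nat (Suc j)) I = padic_p ^ (I div CARD('p)) * z"
    by (rule dvdE[OF padic_power_dvd_pochhammer])
  have "pochhammer (Y + of_nat j + 1) I = qp_p ^ (I div CARD('p)) * zp z"
    using zp_pochhammer_shift[of "Suc j" I] z by (simp add: zp_mult zp_power ac_simps)
  then have "Ts I j = of_nat ?n * ((- 1) ^ j * (zp z * (qp_p ^ ?e * cc (Suc I) j)))"
    unfolding Ts_def power_minus[of "qp_p :: 'p padic" j] power_add by (simp only: mult_ac)
  also have "\<dots> \<in> zball N"
    by (rule zball_mult_left[OF of_nat_in_zball_0 zball_mult_left[OF zball_0_power[OF zball_uminus[OF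
        one_in_zball_0]]
         zball_mult_left[OF zp_in_zball_0 c]]])
  finally show ?thesis .
qed

text \<open>For -m in place of y the sum is finite and equals Gamma_p(-(a + pm)) by
  \<open>sum_dwork_coeff\<close>. A natural number m close to -y reduces to this case, because (p-1)
  y = a gives -(a + pm) - y = -p (y + m).\<close>

private lemma X_sum_approx:
  assumes m: "padic_p ^ N dvd y + of_nat m" and "m \<le> I"
  shows "(\<Sum>i\<le>I. Xs i 0) - zp (morita_Gamma y) \<in> zball N"
proof -
  note p3 = CARD_ge_3[OF odd]
  have ap: "a < CARD('p)" using a by simp
  have int: "qp_p ^ i * (dwork_coeff (a + CARD('p) * i) :: 'p padic) \<in> zball 0" for i
  proof (rule dwork_coeff_bound[OF odd])
    have i: "(a + CARD('p) * i) div CARD('p) = i" using ap by simp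
    have "i div (CARD('p) - 1) \<le> i div 2" using p3 by (intro div_le_mono2) auto
    then show "0 + (a + CARD('p) * i) div CARD('p) + (a + CARD('p) * i) div CARD('p) div (CARD('p) - 1)
        \<le> i + ((a + CARD('p) * i) div CARD('p) + 1) div 2" unfolding i by linarith
  qed
  have "of_nat a = (padic_p - 1) * y"
    using y CARD_gt_1[where 'p='p] by (simp add: of_nat_diff)
  then have "- of_nat (a + CARD('p) * m) - y = - padic_p * (y + of_nat m)"
    by (simp add: algebra_simps)
  then have "padic_p ^ N dvd - of_nat (a + CARD('p) * m) - y" using m by (simp only: dvd_mult)
  from morita_Gamma_cong[OF odd this]
  have G: "zp (morita_Gamma (- of_nat (a + CARD('p) * m))) - zp (morita_Gamma y) \<in> zball N"
    by (simp only: zp_diff[symmetric] zp_in_zball_iff)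
  have "zp (morita_Gamma (- of_nat (a + CARD('p) * m) :: 'p padic_int))
      = (- qp_p) ^ m * fact m / fact (a + CARD('p) * m)"
    using morita_Gamma_minus_of_nat[OF odd, of "a + CARD('p) * m"] ap by simp
  also have "\<dots> = (\<Sum>i\<le>m. qp_p ^ i * pochhammer (- of_nat m) i * dwork_coeff (a + CARD('p) * i))"
    by (rule sum_dwork_coeff[OF ap, symmetric])
  also have "\<dots> = (\<Sum>i\<le>I. qp_p ^ i * pochhammer (- of_nat m) i * dwork_coeff (a + CARD('p) * i))"
    using \<open>m \<le> I\<close> by (intro sum.mono_neutral_left) (auto simp: pochhammer_of_nat_eq_0_iff)
  finally have "(\<Sum>i\<le>I. Xs i 0) - zp (morita_Gamma (- of_nat (a + CARD('p) * m))) =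
      (\<Sum>i\<le>I. zp (pochhammer y i - pochhammer (- of_nat m) i) * (qp_p ^ i * dwork_coeff (a
          + CARD('p) * i)))"
    by (simp add: sum_subtractf[symmetric] Xs_def zp_diff zp_pochhammer zp_uminus algebra_simps)
  also have "\<dots> \<in> zball N"
  proof (intro zball_sum zball_mult_right[OF _ int])
    fix i
    have "padic_p ^ N dvd y - (- of_nat m)" using m by simp
    from pochhammer_cong_padic[OF this] show "zp (pochhammer y i - pochhammer (- of_nat m) i) \<in> zball N"
      by (simp only: zp_in_zball_iff)
  qed
  finally show ?thesis using zball_add[OF _ G] by fastforce
qed

text \<open>As I grows, \<open>psum_T_sum\<close> leaves (p - 1) D + Gamma_p(y) = 0 for the
  component D. No Gauss sum occurs yet; the factor p - 1 reappears in \<open>gauss_sum_eq\<close> as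
  the number of nonzero elements.\<close>

theorem Gross_Koblitz:
  "(1 - qp_p) * dwork_component a = zp (morita_Gamma y)"
proof -
  have "(1 - qp_p) * dwork_component a - zp (morita_Gamma y) \<in> zball N" for N
  proof -
    obtain m where "padic_p ^ N dvd - y - of_nat m" by (rule padic_approx_nat)
    then have m: "padic_p ^ N dvd y + of_nat m"
      using dvd_minus_iff[of "padic_p ^ N" "y + of_nat m"] by (simp add: algebra_simps)
    define I where "I = m + 4 * N + 12"
    \<comment> \<open>All terms of \<open>Ts I\<close> lie in the ball, so the empty index set is an
      admissible truncation.\<close>
    have "of_nat (CARD('p) - 1) * dwork_component a + (\<Sum>i\<le>I. Xs i 0) - sum (Ts I) {} \<in> zball N"
      by (rule has_psumD[OF psum_T_sum]) (auto intro!: T_small simp: I_def)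
    moreover have "(\<Sum>i\<le>I. Xs i 0) - zp (morita_Gamma y) \<in> zball N"
      by (rule X_sum_approx[OF m]) (simp add: I_def)
    ultimately have "((\<Sum>i\<le>I. Xs i 0) - zp (morita_Gamma y)) - (of_nat (CARD('p) - 1)
        * dwork_component a + (\<Sum>i\<le>I. Xs i 0) - sum (Ts I) {}) \<in> zball N"
      by (rule zball_diff[rotated])
    moreover have "of_nat (CARD('p) - 1) = (qp_p - 1 :: 'p padic)" using CARD_gt_1[where 'p='p]
        by (simp add: of_nat_diff)
    ultimately show ?thesis by (simp add: algebra_simps)
  qed
  then have "(1 - qp_p) * dwork_component a - zp (morita_Gamma y) = 0" by (rule zball_eq_0)
  then show ?thesis by simp
qed

end

section \<open>The Teichmueller character\<close>

text \<open>In x^p - y^p = (x - y) S the factor S is p y^(p-1) modulo p, hence divisible by p: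
  raising to the p-th power gains one digit.\<close>

lemma padic_power_cong:
  fixes x y :: "'p :: prime_card padic_int"
  assumes "padic_p ^ Suc n dvd x - y"
  shows "padic_p ^ Suc (Suc n) dvd x ^ CARD('p) - y ^ CARD('p)"
proof -
  let ?S = "\<Sum>i<CARD('p). y ^ (CARD('p) - Suc i) * x ^ i"
  have *: "x ^ CARD('p) - y ^ CARD('p) = (x - y) * ?S" by (rule power_diff_sumr2)
  have xy: "padic_p dvd x - y" using assms by (rule dvd_trans[rotated]) simp
  have "padic_p dvd x ^ i - y ^ i" for i
    using power_diff_sumr2[of x i y] xy by simp
  then have "padic_p dvd (\<Sum>i<CARD('p). y ^ (CARD('p) - Suc i) * (x ^ i - y ^ i))"
    by (intro dvd_sum dvd_mult)
  moreover have "(\<Sum>i<CARD('p). y ^ (CARD('p) - Suc i) * y ^ i) = padic_p * y ^ (CARD('p) - 1)"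
    by (simp add: power_add[symmetric])
  ultimately have "padic_p dvd ?S"
    using dvd_add[of padic_p "\<Sum>i<CARD('p). y ^ (CARD('p) - Suc i) * (x ^ i - y ^ i)" "padic_p
        * y ^ (CARD('p) - 1)"]
    by (simp add: right_diff_distrib sum_subtractf)
  then have "padic_p ^ Suc n * padic_p dvd (x - y) * ?S" by (rule mult_dvd_mono[OF assms])
  then show ?thesis unfolding * by (simp only: power_Suc2)
qed

lemma teichmueller_representative_unique:
  fixes x y :: "'p :: prime_card padic_int"
  assumes "x ^ CARD('p) = x" "y ^ CARD('p) = y" "padic_p dvd x - y"
  shows "x = y"
proof (rule padic_eqI)
  fix n
  have "padic_p ^ Suc n dvd x - y"
    by (induction n) (use assms padic_power_cong[of _ x y] in auto)
  then show "padic_p ^ n dvd x - y" by (rule dvd_trans[rotated]) (simp add: le_imp_power_dvd)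
qed

text \<open>The representative is the limit of m^(p^n) for a natural number m congruent to z:
  Fermat's theorem gives the first congruence, and each p-th power gains a digit.\<close>

lemma teichmueller_representative_exists:
  fixes z :: "'p :: prime_card padic_int"
  obtains w where "w ^ CARD('p) = w" "padic_p dvd w - z"
proof -
  let ?p = "CARD('p)"
  obtain m where m: "padic_p ^ 1 dvd z - of_nat m" by (rule padic_approx_nat)
  define f where "f n = (of_nat m :: 'p padic_int) ^ (?p ^ n)" for n
  have f_Suc: "f (Suc n) = f n ^ ?p" for n by (simp add: f_def power_mult[symmetric] mult.commute)
  have "[m ^ ?p = m] (mod ?p)"
  proof (cases "?p dvd m")
    case True
    then have "?p dvd m ^ ?p" by (rule dvd_trans[OF _ dvd_power]) simp
    then show ?thesis using True by (simp add: cong_def)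
  next
    case False
    have "[m ^ (?p - 1) * m = 1 * m] (mod ?p)"
      by (rule cong_mult[OF fermat_theorem[OF prime_card False] cong_refl])
    then show ?thesis by (simp add: power_Suc2[symmetric] del: power_Suc)
  qed
  then have "int ?p dvd int (m ^ ?p) - int m" by (simp only: cong_int_iff cong_iff_dvd_diff[symmetric])
  then have "padic_p dvd (of_int (int (m ^ ?p) - int m) :: 'p padic_int)" by (simp only: padic_p_dvd_of_int_iff)
  then have base: "padic_p dvd f 1 - f 0" by (simp add: f_def)
  have step: "padic_p ^ Suc n dvd f (Suc n) - f n" for n
    by (induction n) (use base padic_power_cong f_Suc in \<open>simp_all del: power_Suc\<close>)
  have "padic_p ^ n dvd f (Suc n) - f n" for n
    by (rule dvd_trans[OF le_imp_power_dvd step]) simp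
  then obtain w where w: "\<And>n. padic_p ^ n dvd w - f n" using padic_complete by blast
  have "w ^ ?p = w"
  proof (rule padic_eqI)
    fix n
    have "w - f n dvd w ^ ?p - f n ^ ?p" using power_diff_sumr2[of w ?p "f n"] by simp
    then have 1: "padic_p ^ n dvd w ^ ?p - f (Suc n)" using w[of n] f_Suc by (metis dvd_trans)
    have 2: "padic_p ^ n dvd w - f (Suc n)"
      using dvd_trans[OF _ w[of "Suc n"], of "padic_p ^ n"] by (simp add: le_imp_power_dvd)
    show "padic_p ^ n dvd w ^ ?p - w" using dvd_diff[OF 1 2] by simp
  qed
  moreover have "padic_p dvd w - z"
  proof -
    have "padic_p dvd w - f 1" using w[of 1] by simp
    from dvd_add[OF dvd_add[OF this base] dvd_diff_swap[of padic_p z "of_nat m"]] m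
    show ?thesis by (simp add: f_def)
  qed
  ultimately show ?thesis by (rule that)
qed

text \<open>At 0 the value of \<open>teichmueller\<close> is unspecified. With the value 0 there,
  the equation w^p = w characterises all representatives at once and multiplicativity holds without
  exception.\<close>

definition teich0 :: "'p :: prime_card mod_ring \<Rightarrow> 'p padic_int" where
  "teich0 t = (if t = 0 then 0 else teichmueller t)"

lemma power_CARD_eq_self_iff:
  fixes x :: "'p :: prime_card padic_int"
  shows "x ^ CARD('p) = x \<longleftrightarrow> x = 0 \<or> x ^ (CARD('p) - 1) = 1"
proof -
  have "x ^ CARD('p) = x * x ^ (CARD('p) - 1)" by (simp add: power_Suc[symmetric] del: power_Suc)
  then show ?thesis by (metis mult_cancel_left1 mult_zero_left)
qed

lemma padic_res_1_eq_iff: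
  fixes w :: "'p :: prime_card padic_int" and t :: "'p mod_ring"
  shows "padic_res w 1 = to_int_mod_ring t \<longleftrightarrow> padic_p dvd w - of_int (to_int_mod_ring t)"
proof -
  have t: "to_int_mod_ring t mod int CARD('p) = to_int_mod_ring t"
    using range_to_int_mod_ring[where 'a='p] by (metis mod_pos_pos_trivial atLeastLessThan_iff rangeI)
  have w: "padic_res w 1 mod int CARD('p) = padic_res w 1" using padic_res_mod[of w 1] by simp
  have "padic_p dvd w - of_int (to_int_mod_ring t) \<longleftrightarrow> padic_res (w
      - of_int (to_int_mod_ring t)) 1 = 0"
    using padic_power_dvd_iff[of 1] by simp
  also have "\<dots> \<longleftrightarrow> (padic_res w 1 - to_int_mod_ring t) mod int CARD('p) = 0"
    by (simp add: minus_padic_int.rep_eq padic_res_of_int mod_simps)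
  also have "\<dots> \<longleftrightarrow> padic_res w 1 mod int CARD('p) = to_int_mod_ring t mod int CARD('p)"
    by (simp add: mod_eq_dvd_iff dvd_eq_mod_eq_0)
  finally show ?thesis using t w by simp
qed

lemma teich0_0 [simp]: "teich0 0 = 0" by (simp add: teich0_def)

lemma teichmueller:
  fixes t :: "'p :: prime_card mod_ring"
  assumes "t \<noteq> 0"
  shows "teichmueller t ^ (CARD('p) - 1) = 1" "padic_p dvd teichmueller t - of_int (to_int_mod_ring t)"
proof -
  let ?P = "\<lambda>w :: 'p padic_int. w ^ (CARD('p) - 1) = 1 \<and> padic_res w 1 = to_int_mod_ring t"
  obtain w :: "'p padic_int" where w: "w ^ CARD('p) = w" "padic_p dvd w - of_int (to_int_mod_ring t)"
    by (rule teichmueller_representative_exists)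
  have "to_int_mod_ring t \<in> {0..<int CARD('p)}" "to_int_mod_ring t \<noteq> 0"
    using range_to_int_mod_ring[where 'a='p] assms by auto
  then have "\<not> int CARD('p) dvd to_int_mod_ring t" using zdvd_imp_le by force
  then have "\<not> padic_p dvd (of_int (to_int_mod_ring t) :: 'p padic_int)"
      by (simp only: padic_p_dvd_of_int_iff not_False_eq_True)
  then have "w \<noteq> 0" using w(2) by auto
  then have "?P w" using w unfolding power_CARD_eq_self_iff padic_res_1_eq_iff by simp
  moreover have "v = w" if "?P v" for v
  proof (rule teichmueller_representative_unique)
    show "v ^ CARD('p) = v" using that by (simp add: power_CARD_eq_self_iff)
    have "padic_p dvd v - of_int (to_int_mod_ring t)" using that unfolding padic_res_1_eq_iff by simp
    from dvd_diff[OF this w(2)] show "padic_p dvd v - w" by simp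
  qed (rule w)
  ultimately have "?P (teichmueller t)" unfolding teichmueller_def by (rule theI)
  then show "teichmueller t ^ (CARD('p) - 1) = 1" "padic_p dvd teichmueller t - of_int (to_int_mod_ring t)"
    unfolding padic_res_1_eq_iff by blast+
qed

lemma teich0_power_CARD: "teich0 t ^ CARD('p) = teich0 (t :: 'p :: prime_card mod_ring)"
  using teichmueller(1)[of t] by (auto simp: power_CARD_eq_self_iff teich0_def)

lemma teich0_power_pred: "t \<noteq> 0 \<Longrightarrow> teich0 t ^ (CARD('p) - 1)
    = 1" for t :: "'p :: prime_card mod_ring"
  using teichmueller(1)[of t] by (simp add: teich0_def)

lemma teich0_cong: "padic_p dvd teich0 t - of_int (to_int_mod_ring (t :: 'p :: prime_card mod_ring))"
  by (simp add: teich0_def teichmueller)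

text \<open>The working form of uniqueness: an identity between representatives reduces to w^p = w
  and a congruence modulo p.\<close>

lemma teich0_eqI:
  fixes t :: "'p :: prime_card mod_ring"
  assumes "w ^ CARD('p) = w" "padic_p dvd w - of_int n" "of_int n = t"
  shows "teich0 t = w"
proof (rule teichmueller_representative_unique[OF teich0_power_CARD assms(1)])
  have "to_int_mod_ring t = n mod int CARD('p)"
    unfolding assms(3)[symmetric] of_int_of_int_mod_ring by transfer simp
  then have "int CARD('p) dvd to_int_mod_ring t - n" by (simp add: mod_eq_dvd_iff[symmetric])
  then have "padic_p dvd (of_int (to_int_mod_ring t - n) :: 'p padic_int)"
      by (simp only: padic_p_dvd_of_int_iff)
  then have "padic_p dvd (of_int (to_int_mod_ring t) - of_int n :: 'p padic_int)" by simp
  from dvd_diff[OF dvd_add[OF teich0_cong[of t] this] assms(2)]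
  show "padic_p dvd teich0 t - w" by simp
qed

lemma of_int_to_int_mod_ring: "of_int (to_int_mod_ring t) = (t :: 'p :: prime_card mod_ring)"
  by (simp add: of_int_of_int_mod_ring)

lemma teich0_mult: "teich0 (s * t) = teich0 s * teich0 (t :: 'p :: prime_card mod_ring)"
proof (rule teich0_eqI[of _ "to_int_mod_ring s * to_int_mod_ring t"])
  have "padic_p dvd (teich0 s - of_int (to_int_mod_ring s)) * teich0 t + of_int (to_int_mod_ring s)
      * (teich0 t - of_int (to_int_mod_ring t))"
    by (intro dvd_add dvd_mult dvd_mult2 teich0_cong)
  then show "padic_p dvd teich0 s * teich0 t - of_int (to_int_mod_ring s * to_int_mod_ring t)"
    by (simp add: algebra_simps)
qed (simp_all add: power_mult_distrib teich0_power_CARD of_int_to_int_mod_ring)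

lemma teich0_1 [simp]: "teich0 (1 :: 'p :: prime_card mod_ring) = 1"
  by (rule teich0_eqI[of _ 1]) simp_all

lemma teich0_add_cong: "padic_p dvd teich0 s + teich0 t - teich0 (s + t :: 'p :: prime_card mod_ring)"
proof -
  obtain w :: "'p padic_int" where w: "w ^ CARD('p) = w" "padic_p dvd w - of_int (to_int_mod_ring s
      + to_int_mod_ring t)"
    by (rule teichmueller_representative_exists)
  have "teich0 (s + t) = w" by (rule teich0_eqI[OF w]) (simp add: of_int_to_int_mod_ring)
  with dvd_diff[OF dvd_add[OF teich0_cong[of s] teich0_cong[of t]] w(2)] show ?thesis
      by (simp add: algebra_simps)
qed

lemma teich0_eq_iff: "teich0 s = teich0 t \<longleftrightarrow> s = (t :: 'p :: prime_card mod_ring)"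
proof
  assume "teich0 s = teich0 t"
  then have "padic_res (teich0 s) 1 = to_int_mod_ring t" using teich0_cong[of t]
      by (simp only: padic_res_1_eq_iff)
  moreover have "padic_res (teich0 s) 1 = to_int_mod_ring s" using teich0_cong[of s]
      by (simp only: padic_res_1_eq_iff)
  ultimately show "s = t" by simp
qed simp

definition omega :: "'p :: prime_card mod_ring \<Rightarrow> 'p padic" where
  "omega t = zp (teich0 t)"

lemma omega_0 [simp]: "omega 0 = 0" by (simp add: omega_def)
lemma omega_1 [simp]: "omega 1 = 1" by (simp add: omega_def)
lemma omega_mult: "omega (s * t) = omega s * omega t" by (simp add: omega_def teich0_mult zp_mult)
lemma omega_power: "omega (t ^ n) = omega t ^ n" by (induction n) (simp_all add: omega_mult)
lemma omega_eq_iff [simp]: "omega s = omega t \<longleftrightarrow> s = t"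
    by (simp add: omega_def teich0_eq_iff)
lemma omega_eq_0_iff [simp]: "omega t = 0 \<longleftrightarrow> t = 0" using omega_eq_iff[of t 0]
    by (simp del: omega_eq_iff)
lemma omega_eq_1_iff [simp]: "omega t = 1 \<longleftrightarrow> t = 1" using omega_eq_iff[of t 1]
    by (simp del: omega_eq_iff)
lemma omega_power_CARD: "omega t ^ CARD('p) = omega (t :: 'p :: prime_card mod_ring)"
  by (simp add: omega_def teich0_power_CARD flip: zp_power)
lemma omega_power_pred: "t \<noteq> 0 \<Longrightarrow> omega t ^ (CARD('p) - 1)
    = 1" for t :: "'p :: prime_card mod_ring"
  using teich0_power_pred[of t] by (simp add: omega_def flip: zp_power)
lemma omega_inverse: "omega (inverse t) = inverse (omega t)"
proof (cases "t = 0")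
  case False
  then have "omega t * omega (inverse t) = 1" by (simp flip: omega_mult)
  then show ?thesis by (rule inverse_unique[symmetric])
qed simp

lemma teichmueller_bar_power_eq:
  "teichmueller_bar_power a t = (if t = 0 then 0 else inverse (omega t) ^ a)"
  by (simp add: teichmueller_bar_power_def omega_def teich0_def zp_def)

section \<open>Evaluation of power series at Dwork's uniformizer\<close>

definition dwork_pi :: "'p :: prime_card padic alg_closure" where
  "dwork_pi = (SOME y. y ^ (CARD('p) - 1) = - of_nat CARD('p))"

lemma dwork_pi: "dwork_pi ^ (CARD('p) - 1) = (- of_nat CARD('p) :: 'p :: prime_card padic alg_closure)"
proof -
  have "CARD('p) - 1 > 0" using CARD_gt_1[where 'p='p] by simp
  then have "\<exists>y :: 'p padic alg_closure. y ^ (CARD('p) - 1) = - of_nat CARD('p)"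
    using nth_root_exists by blast
  then show ?thesis unfolding dwork_pi_def by (rule someI_ex)
qed

lemma dwork_pi_neq_0: "(dwork_pi :: 'p :: prime_card padic alg_closure) \<noteq> 0"
proof
  assume "(dwork_pi :: 'p padic alg_closure) = 0"
  then have "(0 :: 'p padic alg_closure) ^ (CARD('p) - 1) = - of_nat CARD('p)" using dwork_pi[where 'p='p]
      by simp
  then show False using CARD_gt_1[where 'p='p] by (simp add: power_0_left split: if_splits)
qed

text \<open>Since $\pi^{p-1} = -p$, the term $d_n \pi^n$ is
  $(-p)^{\lfloor n/(p-1) \rfloor} d_n$ times $\pi^{n \bmod (p-1)}$; the value of a series at $\pi$
  is therefore recorded by $p - 1$ sums of $p$-adic numbers.\<close>

definition pi_term :: "'p :: prime_card padic fps \<Rightarrow> nat \<Rightarrow> 'p padic" where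
  "pi_term f n = (- qp_p) ^ (n div (CARD('p) - 1)) * fps_nth f n"

definition pi_class :: "nat \<Rightarrow> 'p :: prime_card padic fps \<Rightarrow> nat \<Rightarrow> 'p
    padic" where
  "pi_class a f n = (if n mod (CARD('p) - 1) = a then pi_term f n else 0)"

definition pi_eval :: "'p :: prime_card padic fps \<Rightarrow> 'p padic alg_closure" where
  "pi_eval f = (\<Sum>a<CARD('p) - 1. to_ac (psum (pi_class a f)) * dwork_pi ^ a)"

lemma has_psum_pi_class: "null_fam (pi_term f) \<Longrightarrow> has_psum (pi_class a f) (psum (pi_class a f))"
proof (rule null_fam_has_psum)
  assume "null_fam (pi_term f)"
  then have "null_fam (\<lambda>n. (if n mod (CARD('a) - 1) = a then 1 else 0) * pi_term f n)"
    by (rule null_fam_mult) auto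
  moreover have "(\<lambda>n. (if n mod (CARD('a) - 1) = a then 1 else 0) * pi_term f n) = pi_class a f"
    by (auto simp: pi_class_def)
  ultimately show "null_fam (pi_class a f)" by simp
qed

lemma has_psum_extend:
  assumes "has_psum (\<lambda>i. f (g i)) s" "inj g" "\<And>i. i \<notin> range g \<Longrightarrow> f i = 0"
  shows "has_psum f s"
proof (rule has_psumI)
  fix N
  let ?E = "{i. f (g i) \<notin> zball N}"
  have fin: "finite ?E" using assms has_psum_null null_famD by blast
  have "s - (\<Sum>i\<in>?E. f (g i)) \<in> zball N" by (rule has_psumD[OF assms(1) fin]) blast
  moreover have "sum f (g ` ?E) = (\<Sum>i\<in>?E. f (g i))"
    using sum.reindex[of g ?E f] inj_on_subset[OF assms(2) subset_UNIV] by (simp add: o_def)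
  ultimately have "s - sum f (g ` ?E) \<in> zball N" by (simp only:)
  moreover have "f i \<in> zball N" if "i \<notin> g ` ?E" for i
    using that assms(3)[of i] by (cases "i \<in> range g") auto
  ultimately show "\<exists>A. finite A \<and> (\<forall>i. i \<notin> A \<longrightarrow> f i \<in> zball
      N) \<and> s - sum f A \<in> zball N"
    using finite_imageI[OF fin, of g] by (intro exI[of _ "g ` ?E"] conjI allI impI)
qed

text \<open>The Cauchy product, graded by exponents modulo p - 1. Residues b and c with b + c >= p -
  1 produce a carry, which pi^(p-1) = -p turns into the factor -p.\<close>

lemma pi_class_mult:
  fixes f g :: "'p :: prime_card padic fps"
  defines "q \<equiv> CARD('p) - 1"
  assumes f: "null_fam (pi_term f)" and g: "null_fam (pi_term g)"
  shows "has_psum (pi_class a (f * g))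
    (\<Sum>b<q. \<Sum>c<q. if (b + c) mod q = a then (if b + c \<ge> q then - qp_p else 1)
        * (psum (pi_class b f) * psum (pi_class c g)) else 0)"
proof -
  have q0: "q > 0" using CARD_gt_1[where 'p='p] by (simp add: q_def)
  define k :: "nat \<Rightarrow> nat \<Rightarrow> 'p padic" where
    "k b c = (if (b + c) mod q = a then (if b + c \<ge> q then - qp_p else 1) else 0)" for b c
  have "has_psum (\<lambda>(i, j). pi_class b f i * pi_class c g j) (psum (pi_class b f)
      * psum (pi_class c g))" for b c
    by (intro has_psum_times has_psum_pi_class f g)
  then have all: "has_psum (\<lambda>ij. \<Sum>b<q. \<Sum>c<q. k b c
      * (case ij of (i, j) \<Rightarrow> pi_class b f i * pi_class c g j))
     (\<Sum>b<q. \<Sum>c<q. k b c * (psum (pi_class b f) * psum (pi_class c g)))"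
    by (intro has_psum_sum has_psum_cmult)
  have pt: "(\<Sum>b<q. \<Sum>c<q. k b c * (pi_class b f i * pi_class c g j)) =
      (if (i + j) mod q = a then (- qp_p) ^ ((i + j) div q) * (fps_nth f i * fps_nth g j) else 0)" for i j
  proof -
    let ?b = "i mod q" and ?c = "j mod q"
    have "k b c * (pi_class b f i * pi_class c g j) = (if c = ?c then if b
        = ?b then k b c * (pi_term f i * pi_term g j) else 0 else 0)" for b c
      by (auto simp: pi_class_def q_def)
    then have "(\<Sum>b<q. \<Sum>c<q. k b c * (pi_class b f i * pi_class c g j)) =
        (\<Sum>b<q. \<Sum>c<q. if c = ?c then if b = ?b then k b c * (pi_term f i * pi_term g j) else 0 else 0)"
      by simp
    also have "\<dots> = (\<Sum>b<q. if b = ?b then k b ?c * (pi_term f i * pi_term g j) else 0)"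
      using q0 by (intro sum.cong refl) (subst sum.delta, auto)
    also have "\<dots> = k ?b ?c * (pi_term f i * pi_term g j)"
      using q0 by (subst sum.delta) auto
    also have "\<dots> = (if (i + j) mod q = a then (- qp_p) ^ ((i + j) div q) * (fps_nth f i
        * fps_nth g j) else 0)"
    proof -
      have 1: "(?b + ?c) mod q = (i + j) mod q" by (simp add: mod_simps)
      have 2: "(i + j) div q = i div q + j div q + (if ?b + ?c \<ge> q then 1 else 0)"
      proof -
        have "?b + ?c < 2 * q" using q0 by (simp add: add_strict_mono mult_2)
        then have "(?b + ?c) div q = (if ?b + ?c \<ge> q then 1 else 0)"
          using q0 by (auto intro!: div_nat_eqI)
        then show ?thesis by (simp add: div_add1_eq[of i j q])
      qed
      show ?thesis unfolding k_def 1 2 pi_term_def q_def[symmetric] by (simp add: power_add)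
    qed
    finally show ?thesis .
  qed
  have "(\<lambda>ij. \<Sum>b<q. \<Sum>c<q. k b c * (case ij of (i, j) \<Rightarrow> pi_class b f i
      * pi_class c g j)) =
     (\<lambda>(i, j). if (i + j) mod q = a then (- qp_p) ^ ((i + j) div q) * (fps_nth f i
         * fps_nth g j) else 0)"
    by (simp add: fun_eq_iff pt)
  with all have "has_psum (\<lambda>(i, j). if (i + j) mod q
      = a then (- qp_p) ^ ((i + j) div q) * (fps_nth f i * fps_nth g j) else 0)
      (\<Sum>b<q. \<Sum>c<q. k b c * (psum (pi_class b f) * psum (pi_class c g)))"
    by simp
  note group = has_psum_group[OF this, of "\<lambda>(i, j). i + j"]
  have fib: "{ij. (case ij of (i, j) \<Rightarrow> i + j) = n} = (\<lambda>i. (i, n - i)) ` {0..n}" for n :: nat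
    by (auto simp: image_iff)
  have "(\<lambda>n. \<Sum>ij | (case ij of (i, j) \<Rightarrow> i + j) = n. case ij of (i, j) \<Rightarrow>
         if (i + j) mod q = a then (- qp_p) ^ ((i + j) div q) * (fps_nth f i * fps_nth g j) else 0)
             = pi_class a (f * g)"
    unfolding fib
    by (rule ext, subst sum.reindex)
       (auto simp: inj_on_def pi_class_def pi_term_def q_def fps_mult_nth sum_distrib_left intro!: sum.neutral)
  then have "has_psum (pi_class a (f * g)) (\<Sum>b<q. \<Sum>c<q. k b c * (psum (pi_class b f)
      * psum (pi_class c g)))"
    using group by (simp add: fib)
  then show ?thesis by (simp add: k_def if_distrib[of "\<lambda>x. x * _"] cong: if_cong)
qed

lemma null_fam_pi_term_mult:
  fixes f g :: "'p :: prime_card padic fps"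
  assumes "null_fam (pi_term f)" "null_fam (pi_term g)"
  shows "null_fam (pi_term (f * g))"
proof -
  let ?q = "CARD('p) - 1"
  have q0: "?q > 0" using CARD_gt_1[where 'p='p] by simp
  have "has_psum (\<lambda>n. \<Sum>a<?q. pi_class a (f * g) n) (\<Sum>a<?q. psum (pi_class a (f * g)))"
    by (intro has_psum_sum null_fam_has_psum has_psum_null[OF pi_class_mult[OF assms]])
  moreover have "(\<Sum>a<?q. pi_class a (f * g) n) = pi_term (f * g) n" for n
    using q0 by (simp add: pi_class_def sum.delta')
  ultimately show ?thesis using has_psum_null by simp
qed

lemma pi_eval_mult:
  fixes f g :: "'p :: prime_card padic fps"
  assumes "null_fam (pi_term f)" "null_fam (pi_term g)"
  shows "pi_eval (f * g) = pi_eval f * pi_eval g"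
proof -
  let ?q = "CARD('p) - 1" and ?pi = "dwork_pi :: 'p padic alg_closure"
  have q0: "?q > 0" using CARD_gt_1[where 'p='p] by simp
  let ?k = "\<lambda>b c. if b + c \<ge> ?q then - qp_p else 1 :: 'p padic"
  let ?P = "\<lambda>b c. psum (pi_class b f) * psum (pi_class c g)"
  have "pi_eval (f * g) = (\<Sum>a<?q. \<Sum>b<?q. \<Sum>c<?q. (if (b + c) mod ?q
      = a then to_ac (?k b c * ?P b c) * ?pi ^ a else 0))"
    unfolding pi_eval_def psum_eqI[OF pi_class_mult[OF assms]] to_ac_sum sum_distrib_right
    by (intro sum.cong refl) auto
  also have "\<dots> = (\<Sum>b<?q. \<Sum>c<?q. \<Sum>a<?q. (if (b + c) mod ?q
      = a then to_ac (?k b c * ?P b c) * ?pi ^ a else 0))"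
    by (subst sum.swap, rule sum.cong[OF refl], rule sum.swap)
  also have "\<dots> = (\<Sum>b<?q. \<Sum>c<?q. to_ac (?k b c * ?P b c) * ?pi ^ ((b + c) mod ?q))"
    using q0 by (simp add: sum.delta')
  also have "\<dots> = (\<Sum>b<?q. \<Sum>c<?q. (to_ac (psum (pi_class b f)) * ?pi ^ b)
      * (to_ac (psum (pi_class c g)) * ?pi ^ c))"
  proof (intro sum.cong refl)
    fix b c assume bc: "b \<in> {..<?q}" "c \<in> {..<?q}"
    have "to_ac (?k b c) * ?pi ^ ((b + c) mod ?q) = ?pi ^ b * ?pi ^ c"
    proof (cases "b + c \<ge> ?q")
      case True
      then have "(b + c) mod ?q = b + c - ?q" using bc by (simp add: le_mod_geq)
      moreover have "?pi ^ (b + c) = ?pi ^ ?q * ?pi ^ (b + c - ?q)" using True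
          by (simp add: power_add[symmetric])
      ultimately have "to_ac (- qp_p) * ?pi ^ ((b + c) mod ?q) = ?pi ^ (b + c)"
        by (simp only: dwork_pi to_ac_minus to_ac_of_nat)
      then show ?thesis using True by (simp only: if_True power_add)
    qed (simp add: power_add)
    then have "to_ac (?P b c) * (to_ac (?k b c) * ?pi ^ ((b + c) mod ?q))
        = to_ac (?P b c) * (?pi ^ b * ?pi ^ c)"
      by (simp only:)
    then show "to_ac (?k b c * ?P b c) * ?pi ^ ((b + c) mod ?q) =
        (to_ac (psum (pi_class b f)) * ?pi ^ b) * (to_ac (psum (pi_class c g)) * ?pi ^ c)"
      by (simp only: to_ac_mult mult_ac)
  qed
  also have "\<dots> = pi_eval f * pi_eval g" by (simp only: pi_eval_def sum_product)
  finally show ?thesis .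
qed

lemma pi_eval_1: "pi_eval (1 :: 'p :: prime_card padic fps) = 1"
proof -
  have "pi_class a (1 :: 'p padic fps) = (\<lambda>n. if n = 0 then if a = 0 then 1 else 0 else 0)" for a
    by (auto simp: pi_class_def pi_term_def fun_eq_iff)
  then have "psum (pi_class a (1 :: 'p padic fps)) = (if a = 0 then 1 else 0)" for a
    using psum_eqI[OF has_psum_single[of 0 "if a = 0 then 1 else 0 :: 'p padic"]] by simp
  then show ?thesis
    using CARD_gt_1[where 'p='p] unfolding pi_eval_def
    by (simp add: if_distrib[of to_ac] if_distrib[of "\<lambda>x. x * _"] cong: if_cong)
qed

section \<open>Dwork's additive character\<close>

text \<open>The series is expanded before it is evaluated. Inserting omega(t)^p = omega(t) in the
  exponent pi (X - X^p) would give exp(0) = 1, but exp does not converge at pi, and the value of the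
  expanded series is a nontrivial character.\<close>

definition dwork_char :: "'p :: prime_card mod_ring \<Rightarrow> 'p padic alg_closure" where
  "dwork_char t = pi_eval (dwork_fps (omega t))"

context
  assumes odd: "odd CARD('p :: prime_card)"
begin

lemma null_fam_dwork_coeff: "null_fam (\<lambda>n. (- qp_p) ^ (n div (CARD('p) - 1))
    * (dwork_coeff n :: 'p padic))"
proof (rule null_famI)
  fix N
  note p3 = CARD_ge_3[OF odd]
  let ?q = "CARD('p) - 1"
  have "(- qp_p) ^ (n div ?q) * dwork_coeff n \<in> (zball N :: 'p padic set)"
      if n: "n \<ge> CARD('p) * (2 * N + 2)" for n
  proof -
    let ?k = "n div CARD('p)"
    have "n mod ?q < ?q" using p3 by simp
    moreover have "n = n mod ?q + CARD('p) * 0 + ?q * (n div ?q)" by simp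
    ultimately have "?k + ?k div ?q \<le> n div ?q + 0 + 1 + 0 div ?q" by (rule div_bound[OF p3])
    moreover have "2 * N + 2 \<le> ?k" using n by (simp add: less_eq_div_iff_mult_less_eq mult.commute)
    then have "N + 1 \<le> (?k + 1) div 2" by (simp add: less_eq_div_iff_mult_less_eq)
    ultimately have "N + ?k + ?k div ?q \<le> n div ?q + (?k + 1) div 2" by simp
    from dwork_coeff_bound[OF odd this]
    have "(- 1) ^ (n div ?q) * (qp_p ^ (n div ?q) * dwork_coeff n) \<in> (zball N :: 'p padic set)"
      by (rule zball_mult_left[OF zball_0_power[OF zball_uminus[OF one_in_zball_0]]])
    then show ?thesis by (simp add: power_minus[of "qp_p :: 'p padic"] mult.assoc)
  qed
  then show "\<exists>A. finite A \<and> (\<forall>n. n \<notin> A \<longrightarrow> (- qp_p) ^ (n div ?q)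
      * dwork_coeff n \<in> (zball N :: 'p padic set))"
    by (intro exI[of _ "{..<CARD('p) * (2 * N + 2)}"]) auto
qed

lemma null_fam_dwork_fps:
  assumes "s \<in> zball 0"
  shows "null_fam (pi_term (dwork_fps (s :: 'p padic)))"
proof -
  have "null_fam (\<lambda>n. s ^ n * ((- qp_p) ^ (n div (CARD('p) - 1)) * dwork_coeff n))"
    by (rule null_fam_mult[OF null_fam_dwork_coeff]) (simp add: zball_0_power assms)
  then show ?thesis by (simp add: pi_term_def[abs_def] fps_nth_dwork_fps mult_ac)
qed

lemma null_fam_fps_exp:
  fixes v :: "'p padic"
  assumes "v \<in> zball 0"
  shows "null_fam (pi_term (fps_exp (qp_p * v)))"
proof (rule null_famI)
  fix N
  let ?q = "CARD('p) - 1"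
  have "pi_term (fps_exp (qp_p * v)) n \<in> zball N" if "n \<ge> N" for n
  proof -
    have "pi_term (fps_exp (qp_p * v)) n = qp_p ^ n * ((- 1) ^ (n div ?q) * v ^ n * (qp_p ^ (n div ?q)
        * inverse (fact n)))"
      unfolding pi_term_def power_minus[of "qp_p :: 'p padic"] by (simp add: power_mult_distrib field_simps)
    also have "\<dots> \<in> zball (n + 0)"
      by (intro zball_mult qp_p_power_in_zball zball_mult_left[OF zball_mult_left] zball_0_power
          zball_uminus one_in_zball_0 assms inverse_fact_in_zball[OF odd])
    finally show ?thesis using zball_mono[OF that] by simp
  qed
  then show "\<exists>A. finite A \<and> (\<forall>n. n \<notin> A \<longrightarrow> pi_term (fps_exp (qp_p
      * v)) n \<in> zball N)"
    by (intro exI[of _ "{..<N}"]) auto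
qed

text \<open>Substituting $X^p$ and evaluating at $\pi$ amounts to evaluating at $\pi^p = -p\pi$.\<close>

lemma pi_eval_fps_exp_compose:
  fixes v :: "'p padic"
  assumes v: "v \<in> zball 0"
  shows "null_fam (pi_term (fps_exp v oo fps_X ^ CARD('p)))"
    and "pi_eval (fps_exp v oo fps_X ^ CARD('p)) = pi_eval (fps_exp (qp_p * (- v)))"
proof -
  let ?p = "CARD('p)"
  let ?q = "?p - 1" and ?f = "fps_exp v oo fps_X ^ ?p" and ?g = "fps_exp (qp_p * (- v))"
  have p: "?p > 1" by (rule CARD_gt_1)
  have inj: "inj (\<lambda>l. ?p * l)" using p by (auto simp: inj_on_def)
  have pl: "?p * l = l + ?q * l" for l using p by (cases ?p) auto
  have divl: "?p * l div ?q = l + l div ?q" and modl: "?p * l mod ?q = l mod ?q" for l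
    using p by (simp_all add: pl)
  have tm: "pi_term ?f (?p * l) = pi_term ?g l" for l
  proof -
    have "(- qp_p) ^ l * v ^ l = (qp_p * (- v)) ^ l" by (simp flip: power_mult_distrib)
    then have "(- qp_p) ^ (l + l div ?q) * (v ^ l / fact l) = (- qp_p) ^ (l div ?q) * ((qp_p
        * (- v)) ^ l / fact l)"
      unfolding power_add by (simp add: mult_ac)
    then show ?thesis using p unfolding pi_term_def divl by (simp add: fps_nth_compose_X_power)
  qed
  have zero: "pi_term ?f n = 0" if "n \<notin> range (\<lambda>l. ?p * l)" for n
  proof -
    have "\<not> ?p dvd n" using that by auto
    then show ?thesis by (simp add: pi_term_def fps_nth_compose_X_power)
  qed
  have g: "null_fam (pi_term ?g)" by (rule null_fam_fps_exp[OF zball_uminus[OF v]])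
  have "has_psum (\<lambda>l. pi_term ?f (?p * l)) (psum (pi_term ?g))"
    unfolding tm by (rule null_fam_has_psum[OF g])
  then show "null_fam (pi_term ?f)"
    by (rule has_psum_null[OF has_psum_extend[OF _ inj zero]])
  have "has_psum (pi_class a ?f) (psum (pi_class a ?g))" for a
  proof (rule has_psum_extend[OF _ inj])
    have "(\<lambda>l. pi_class a ?f (?p * l)) = pi_class a ?g"
      unfolding pi_class_def[abs_def] modl tm ..
    then show "has_psum (\<lambda>l. pi_class a ?f (?p * l)) (psum (pi_class a ?g))"
      using has_psum_pi_class[OF g, of a] by simp
    show "pi_class a ?f n = 0" if "n \<notin> range (\<lambda>l. ?p * l)" for n
      using zero[OF that] by (simp add: pi_class_def)
  qed
  then have "psum (pi_class a ?f) = psum (pi_class a ?g)" for a by (rule psum_eqI)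
  then show "pi_eval ?f = pi_eval ?g" unfolding pi_eval_def by (simp only:)
qed

text \<open>Teichmueller representatives are additive up to an error p v. In the product of the two
  series the error splits off as exp(p v X) exp(v X^p), and at X = pi the second factor becomes
  exp(-p v pi), which cancels the first.\<close>

lemma dwork_char_add: "dwork_char (s + t :: 'p mod_ring) = dwork_char s * dwork_char t"
proof -
  let ?p = "CARD('p)"
  obtain w where w: "teich0 s + teich0 t - teich0 (s + t) = padic_p * w" using teich0_add_cong[of s t]
      by (auto elim: dvdE)
  define v where "v = zp w"
  have v: "v \<in> zball 0" by (simp add: v_def)
  have st: "omega s + omega t = omega (s + t) + qp_p * v"
    using arg_cong[OF w, of zp] by (simp add: omega_def v_def zp_add zp_diff zp_mult algebra_simps)
  let ?H = "fps_exp v oo fps_X ^ ?p"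
  have X0: "(fps_X ^ ?p :: 'p padic fps) $ 0 = 0" by (simp add: fps_X_power_nth)
  have "dwork_fps (omega s) * dwork_fps (omega t) = fps_exp (omega (s + t) + qp_p * v)
      * (fps_exp ((omega (s + t) + qp_p * v) / qp_p) oo fps_X ^ ?p)"
    by (simp add: dwork_fps_mult omega_power_CARD st)
  also have "(omega (s + t) + qp_p * v) / qp_p = omega (s + t) / qp_p + v" by (simp add: add_divide_distrib)
  also have "fps_exp (omega (s + t) + qp_p * v) * (fps_exp (omega (s + t) / qp_p + v) oo fps_X ^ ?p)
      = dwork_fps (omega (s + t)) * (fps_exp (qp_p * v) * ?H)"
    using X0 by (simp add: dwork_fps_def omega_power_CARD fps_exp_add_mult fps_compose_mult_distrib mult_ac)
  finally have eq: "dwork_fps (omega s) * dwork_fps (omega t)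
      = dwork_fps (omega (s + t)) * (fps_exp (qp_p * v) * ?H)" .
  have om0: "omega u \<in> zball 0" for u :: "'p mod_ring" by (simp add: omega_def)
  note null = null_fam_dwork_fps[OF om0] null_fam_fps_exp[OF v] pi_eval_fps_exp_compose(1)[OF v]
  have "pi_eval (fps_exp (qp_p * v) * ?H) = pi_eval (fps_exp (qp_p * v)) * pi_eval (fps_exp (qp_p * (- v)))"
    by (simp only: pi_eval_mult null pi_eval_fps_exp_compose(2)[OF v])
  also have "\<dots> = pi_eval (fps_exp (qp_p * v) * fps_exp (qp_p * (- v)))"
    by (rule pi_eval_mult[symmetric]) (rule null_fam_fps_exp[OF v] null_fam_fps_exp[OF zball_uminus[OF v]])+
  also have "\<dots> = 1" by (simp add: fps_exp_add_mult[symmetric] pi_eval_1)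
  finally have "pi_eval (fps_exp (qp_p * v) * ?H) = 1" .
  moreover have "dwork_char s * dwork_char t = pi_eval (dwork_fps (omega (s + t)) * (fps_exp (qp_p * v) * ?H))"
    unfolding dwork_char_def eq[symmetric] by (rule pi_eval_mult[OF null(1) null(1), symmetric])
  moreover have "\<dots> = dwork_char (s + t) * pi_eval (fps_exp (qp_p * v) * ?H)"
    unfolding dwork_char_def by (rule pi_eval_mult[OF null(1) null_fam_pi_term_mult[OF null(2,3)]])
  ultimately show ?thesis by simp
qed

lemma dwork_char_0: "dwork_char (0 :: 'p mod_ring) = 1"
  by (simp add: dwork_char_def dwork_fps_def pi_eval_1 power_0_left)

lemma dwork_char_eq:
  fixes t :: "'p mod_ring"
  assumes "t \<noteq> 0"
  shows "dwork_char t = (\<Sum>a<CARD('p) - 1. to_ac (omega t ^ a * dwork_component a) * dwork_pi ^ a)"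
proof -
  let ?q = "CARD('p) - 1"
  have q0: "?q > 0" using CARD_gt_1[where 'p='p] by simp
  have "has_psum (pi_class a (dwork_fps (omega t))) (omega t ^ a * dwork_component a)" if a: "a < ?q" for a
  proof (rule has_psum_extend)
    let ?g = "\<lambda>j. a + ?q * j"
    show inj: "inj ?g" using q0 by (auto simp: inj_on_def)
    have "null_fam (\<lambda>j. (- qp_p) ^ (?g j div ?q) * (dwork_coeff (?g j) :: 'p padic))"
      by (rule has_psum_subfamily[OF null_fam_dwork_coeff inj])
    then have "null_fam (\<lambda>j. (- qp_p) ^ j * (dwork_coeff (?g j) :: 'p padic))"
      using a q0 by simp
    then have "has_psum (\<lambda>j. omega t ^ a * ((- qp_p) ^ j * dwork_coeff (?g j))) (omega t ^ a
        * dwork_component a)"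
      unfolding dwork_component_def by (intro has_psum_cmult null_fam_has_psum)
    moreover have "pi_class a (dwork_fps (omega t)) (?g j) = omega t ^ a * ((- qp_p) ^ j
        * dwork_coeff (?g j))" for j
      using a q0 omega_power_pred[OF assms]
      by (simp add: pi_class_def pi_term_def fps_nth_dwork_fps power_add power_mult)
    ultimately show "has_psum (\<lambda>j. pi_class a (dwork_fps (omega t)) (?g j)) (omega t ^ a
        * dwork_component a)"
      by simp
    show "pi_class a (dwork_fps (omega t)) n = 0" if "n \<notin> range ?g" for n
    proof -
      have "n mod ?q \<noteq> a" using that by (metis mod_mult_div_eq rangeI)
      then show ?thesis by (simp add: pi_class_def)
    qed
  qed
  then have "psum (pi_class a (dwork_fps (omega t))) = omega t ^ a * dwork_component a" if "a < ?q" for a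
    using that by (intro psum_eqI)
  then show ?thesis unfolding dwork_char_def pi_eval_def by (intro sum.cong refl) (simp only: lessThan_iff)
qed

end

section \<open>Quadratic character sums\<close>

lemma of_int_mod_ring_eq_iff:
  "(of_int a :: 'p :: prime_card mod_ring) = of_int b \<longleftrightarrow> [a = b] (mod int CARD('p))"
  by (simp add: of_int_eq_iff_cong_CHAR)

lemma quad_char_cases: "quad_char t \<in> {- 1, 0, 1}"
  by (simp add: quad_char_def Legendre_def)

lemma quad_char_eq_0_iff [simp]: "quad_char t = 0 \<longleftrightarrow> t = 0"
  using of_int_mod_ring_eq_iff[of "to_int_mod_ring t" 0]
  by (auto simp: quad_char_def Legendre_def of_int_to_int_mod_ring)

lemma quad_char_0 [simp]: "quad_char 0 = 0" by simp

lemma quad_char_eq_1_iff: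
  fixes t :: "'p :: prime_card mod_ring"
  shows "quad_char t = 1 \<longleftrightarrow> t \<noteq> 0 \<and> (\<exists>y. y ^ 2 = t)"
proof -
  have "QuadRes (int CARD('p)) (to_int_mod_ring t) \<longleftrightarrow> (\<exists>y. y ^ 2 = t)"
  proof
    assume "QuadRes (int CARD('p)) (to_int_mod_ring t)"
    then obtain y where "[y ^ 2 = to_int_mod_ring t] (mod int CARD('p))" by (auto simp: QuadRes_def)
    then have "(of_int (y ^ 2) :: 'p mod_ring) = of_int (to_int_mod_ring t)"
        by (simp only: of_int_mod_ring_eq_iff)
    then have "(of_int y) ^ 2 = t" by (simp add: of_int_to_int_mod_ring)
    then show "\<exists>y. y ^ 2 = t" ..
  next
    assume "\<exists>y. y ^ 2 = t"
    then obtain y where "y ^ 2 = t" ..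
    then have "(of_int (to_int_mod_ring y ^ 2) :: 'p mod_ring) = of_int (to_int_mod_ring t)"
      by (simp add: of_int_to_int_mod_ring)
    then show "QuadRes (int CARD('p)) (to_int_mod_ring t)"
      unfolding of_int_mod_ring_eq_iff QuadRes_def by blast
  qed
  moreover have "[to_int_mod_ring t = 0] (mod int CARD('p)) \<longleftrightarrow> t = 0"
    using of_int_mod_ring_eq_iff[of "to_int_mod_ring t" 0, where 'p='p] by (simp add: of_int_to_int_mod_ring)
  ultimately show ?thesis by (simp add: quad_char_def Legendre_def)
qed

context
  assumes odd: "odd CARD('p :: prime_card)"
begin

lemma two_neq_0: "(2 :: 'p mod_ring) \<noteq> 0"
proof
  assume "(2 :: 'p mod_ring) = 0"
  then have "CARD('p) dvd 2" using of_nat_0_mod_ring_dvd[of 2, where 'a='p] by simp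
  then have "CARD('p) \<le> 2" by (rule dvd_imp_le) simp
  then show False using CARD_ge_3[OF odd] by simp
qed

lemma four_neq_0: "(4 :: 'p mod_ring) \<noteq> 0"
proof -
  have "2 * 2 \<noteq> (0 :: 'p mod_ring)" using two_neq_0 by (simp only: mult_eq_0_iff) simp
  then show ?thesis by simp
qed

text \<open>For t nonzero both sides are 1 or -1 and agree modulo p by Euler's criterion; p being
  odd, they are equal. Multiplicativity of \<open>quad_char\<close> is then inherited from
  \<open>omega\<close>.\<close>

lemma of_int_quad_char: "of_int (quad_char t) = omega (t :: 'p mod_ring) ^ ((CARD('p) - 1) div 2)"
proof (cases "t = 0")
  case True
  then show ?thesis using CARD_ge_3[OF odd] by (simp add: power_0_left)
next
  case False
  let ?h = "(CARD('p) - 1) div 2" and ?n = "to_int_mod_ring t"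
  have h: "CARD('p) - 1 = ?h * 2" using odd by simp
  have h': "nat ((int CARD('p) - 1) div 2) = ?h"
    using CARD_gt_1[where 'p='p] by (simp add: nat_div_distrib nat_diff_distrib)
  have "[Legendre ?n (int CARD('p)) = ?n ^ nat ((int CARD('p) - 1) div 2)] (mod int CARD('p)) \<or>
      [Legendre ?n (int CARD('p)) = ?n ^ ?h] (mod int CARD('p))"
    using euler_criterion[of "CARD('p)" ?n] prime_card[where 'a='p] CARD_ge_3[OF odd] by auto
  then have "[quad_char t = ?n ^ ?h] (mod int CARD('p))" by (auto simp: quad_char_def h')
  then have "int CARD('p) dvd quad_char t - ?n ^ ?h" by (simp only: cong_iff_dvd_diff)
  then have "padic_p dvd (of_int (quad_char t - ?n ^ ?h) :: 'p padic_int)"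
      by (simp only: padic_p_dvd_of_int_iff)
  then have 1: "padic_p dvd (of_int (quad_char t) - of_int ?n ^ ?h :: 'p padic_int)" by simp
  have "teich0 t - of_int ?n dvd teich0 t ^ ?h - of_int ?n ^ ?h"
    using power_diff_sumr2[of "teich0 t" ?h "of_int ?n"] by simp
  then have "padic_p dvd teich0 t ^ ?h - of_int ?n ^ ?h" using teich0_cong[of t] dvd_trans by blast
  from dvd_diff[OF 1 this] have d: "padic_p dvd of_int (quad_char t) - teich0 t ^ ?h" by simp
  have "(teich0 t ^ ?h) ^ 2 = teich0 t ^ (CARD('p) - 1)" by (simp only: power_mult[symmetric] h[symmetric])
  also have "\<dots> = 1" by (rule teich0_power_pred[OF False])
  finally have "(teich0 t ^ ?h) ^ 2 = 1" .
  then have "teich0 t ^ ?h = 1 \<or> teich0 t ^ ?h = - 1" by (simp add: power2_eq_1_iff)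
  moreover have "quad_char t = 1 \<or> quad_char t = - 1" using quad_char_cases[of t] False by auto
  moreover have "\<not> padic_p dvd (2 :: 'p padic_int)"
    using padic_p_dvd_of_nat_iff[of 2, where 'p='p] CARD_ge_3[OF odd] by (auto dest: dvd_imp_le)
  then have "\<not> padic_p dvd (- 2 :: 'p padic_int)" by (simp only: dvd_minus_iff not_False_eq_True)
  ultimately have "of_int (quad_char t) = teich0 t ^ ?h"
    using d \<open>\<not> padic_p dvd (2 :: 'p padic_int)\<close> by auto
  from arg_cong[OF this, of zp] show ?thesis by (simp add: omega_def zp_power)
qed

lemma quad_char_mult: "quad_char (s * t :: 'p mod_ring) = quad_char s * quad_char t"
proof -
  have "(of_int (quad_char (s * t)) :: 'p padic) = of_int (quad_char s * quad_char t)"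
    unfolding of_int_mult of_int_quad_char by (simp add: omega_mult power_mult_distrib)
  then show ?thesis by (simp only: of_int_eq_iff)
qed

lemma quad_char_square: "c \<noteq> 0 \<Longrightarrow> quad_char c * quad_char (c :: 'p mod_ring) = 1"
  using quad_char_cases[of c] by auto

lemma quad_char_square_left: "c \<noteq> 0 \<Longrightarrow> quad_char c * (quad_char (c :: 'p mod_ring)
    * x) = x"
  by (simp add: mult.assoc[symmetric] quad_char_square)

lemma quad_char_1 [simp]: "quad_char (1 :: 'p mod_ring) = 1"
  by (auto simp: quad_char_eq_1_iff intro: exI[of _ 1])

lemma quad_char_4 [simp]: "quad_char (4 :: 'p mod_ring) = 1"
proof -
  have "(4 :: 'p mod_ring) = 2 * 2" by simp
  then show ?thesis using two_neq_0 by (simp only: quad_char_mult quad_char_square not_False_eq_True)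
qed

lemma quad_char_inverse: "quad_char (inverse t :: 'p mod_ring) = quad_char t"
proof (cases "t = 0")
  case False
  then have "quad_char t * quad_char (inverse t) = 1" by (simp flip: quad_char_mult)
  then show ?thesis using quad_char_cases[of t] by auto
qed simp

lemma quad_char_divide: "quad_char (s / t :: 'p mod_ring) = quad_char s * quad_char t"
  by (simp add: divide_inverse quad_char_mult quad_char_inverse)

section \<open>Counting roots, and complete sums of the quadratic character\<close>

lemma card_square_roots: "int (card {y :: 'p mod_ring. y ^ 2 = t}) = 1 + quad_char t"
proof (cases "\<exists>y. y ^ 2 = t")
  case True
  then obtain y where y: "y ^ 2 = t" ..
  have "{x. x ^ 2 = t} = {y, - y}" using y by (auto simp: power2_eq_iff)
  moreover have "y \<noteq> - y \<longleftrightarrow> t \<noteq> 0"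
  proof -
    have "y = - y \<longleftrightarrow> 2 * y = 0" by (metis add_eq_0_iff mult_2)
    then show ?thesis using y two_neq_0 by auto
  qed
  ultimately show ?thesis using True quad_char_eq_1_iff[of t] by (cases "t = 0") auto
next
  case False
  then have "t \<noteq> 0" by auto
  then have "quad_char t = - 1" using False quad_char_eq_1_iff[of t] quad_char_cases[of t] by auto
  then show ?thesis using False by simp
qed

text \<open>Completing the square. The middle coefficient 2b keeps the discriminant free of the
  factor 4.\<close>

lemma card_quadratic_roots:
  fixes a b c :: "'p mod_ring"
  assumes "a \<noteq> 0"
  shows "int (card {x. a * x ^ 2 + 2 * b * x + c = 0}) = 1 + quad_char (b ^ 2 - a * c)"
proof -
  have eq: "a * (a * x ^ 2 + 2 * b * x + c) = (a * x + b) ^ 2 - (b ^ 2 - a * c)" for x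
    by (simp add: power2_eq_square algebra_simps)
  have "bij_betw (\<lambda>x. a * x + b) {x. a * x ^ 2 + 2 * b * x + c = 0} {y. y ^ 2 = b ^ 2 - a * c}"
  proof (rule bij_betwI[of _ _ _ "\<lambda>y. (y - b) / a"])
    show "(\<lambda>x. a * x + b) \<in> {x. a * x ^ 2 + 2 * b * x + c = 0} \<rightarrow> {y. y ^ 2
        = b ^ 2 - a * c}"
    proof clarify
      fix x assume "a * x ^ 2 + 2 * b * x + c = 0"
      then show "(a * x + b) ^ 2 = b ^ 2 - a * c" using eq[of x] by simp
    qed
    show "(\<lambda>y. (y - b) / a) \<in> {y. y ^ 2 = b ^ 2 - a * c} \<rightarrow> {x. a * x ^ 2 + 2 * b
        * x + c = 0}"
    proof clarify
      fix y assume y: "y ^ 2 = b ^ 2 - a * c"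
      have "a * ((y - b) / a) + b = y" using assms by simp
      then have "a * (a * ((y - b) / a) ^ 2 + 2 * b * ((y - b) / a) + c) = 0" unfolding eq using y by simp
      then show "a * ((y - b) / a) ^ 2 + 2 * b * ((y - b) / a) + c = 0" using assms by simp
    qed
  qed (use assms in simp_all)
  then show ?thesis using card_square_roots[of "b ^ 2 - a * c"] by (simp add: bij_betw_same_card)
qed

lemma sum_fibers:
  fixes g :: "'a :: finite \<Rightarrow> 'b :: finite" and f :: "'b \<Rightarrow> int"
  shows "(\<Sum>x\<in>UNIV. f (g x)) = (\<Sum>y\<in>UNIV. int (card {x. g x = y}) * f y)"
proof -
  have "(\<Sum>y\<in>UNIV. sum (\<lambda>x. f (g x)) {x \<in> UNIV. g x = y}) = (\<Sum>x\<in>UNIV. f (g x))"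
    by (rule sum.group) auto
  moreover have "sum (\<lambda>x. f (g x)) {x \<in> UNIV. g x = y} = int (card {x. g x = y}) * f y" for y
    by simp
  ultimately show ?thesis by simp
qed

lemma sum_affine:
  fixes f :: "'p mod_ring \<Rightarrow> 'b :: comm_monoid_add"
  assumes "a \<noteq> 0"
  shows "(\<Sum>x\<in>UNIV. f (a * x + b)) = (\<Sum>x\<in>UNIV. f x)"
  by (rule sum.reindex_bij_witness[of _ "\<lambda>y. (y - b) / a" "\<lambda>x. a * x
      + b"]) (use assms in simp_all)

lemma sum_scale:
  fixes f :: "'p mod_ring \<Rightarrow> 'b :: comm_monoid_add"
  assumes "a \<noteq> 0"
  shows "(\<Sum>x\<in>UNIV. f (a * x)) = (\<Sum>x\<in>UNIV. f x)"
  using sum_affine[OF assms, of f 0] by simp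

lemma sum_translate:
  fixes f :: "'p mod_ring \<Rightarrow> 'b :: comm_monoid_add"
  shows "(\<Sum>x\<in>UNIV. f (x + b)) = (\<Sum>x\<in>UNIV. f x)"
  using sum_affine[of 1 f b] by simp

lemma sum_squares: "(\<Sum>x\<in>UNIV. f (x ^ 2)) = (\<Sum>t\<in>UNIV. (1 + quad_char t) * f t)"
  for f :: "'p mod_ring \<Rightarrow> int"
  unfolding sum_fibers[of f "\<lambda>x. x ^ 2"] card_square_roots ..

lemma sum_quad_char: "(\<Sum>t\<in>UNIV. quad_char (t :: 'p mod_ring)) = 0"
proof -
  have "(\<Sum>x\<in>(UNIV :: 'p mod_ring set). 1 :: int) = (\<Sum>t\<in>(UNIV :: 'p mod_ring set). (1
      + quad_char t) * 1)"
    by (rule sum_squares)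
  then show ?thesis by (simp add: sum.distrib)
qed

lemma sum_quad_char_affine: "a \<noteq> 0 \<Longrightarrow> (\<Sum>t\<in>UNIV. quad_char (a * t
    + b :: 'p mod_ring)) = 0"
  by (simp add: sum_affine[of a quad_char] sum_quad_char)

lemma sum_nonzero:
  fixes f :: "'p mod_ring \<Rightarrow> 'b :: ab_group_add"
  shows "(\<Sum>x\<in>- {0}. f x) = (\<Sum>x\<in>UNIV. f x) - f 0"
proof -
  have "(UNIV :: 'p mod_ring set) = insert 0 (- {0})" by auto
  then have "(\<Sum>x\<in>UNIV. f x) = f 0 + (\<Sum>x\<in>- {0}. f x)"
      by (metis Compl_iff finite insertI1 sum.insert)
  then show ?thesis by simp
qed

lemma sum_nonzero_inverse:
  fixes f :: "'p mod_ring \<Rightarrow> 'b :: comm_monoid_add"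
  shows "(\<Sum>x\<in>- {0}. f (inverse x)) = (\<Sum>x\<in>- {0}. f x)"
  by (rule sum.reindex_bij_witness[of _ inverse inverse]) simp_all

lemma sum_nonzero_scale:
  fixes f :: "'p mod_ring \<Rightarrow> 'b :: comm_monoid_add"
  assumes "a \<noteq> 0"
  shows "(\<Sum>x\<in>- {0}. f (a * x)) = (\<Sum>x\<in>- {0}. f x)"
  by (rule sum.reindex_bij_witness[of _ "\<lambda>y. y / a" "\<lambda>x. a * x"]) (use assms in simp_all)

text \<open>For d nonzero the sum becomes that of phi(t) phi(t - d) = phi(1 - d/t) over t nonzero.
  This is a complete sum over an affine function without its value 1 at the missing point.\<close>

lemma sum_quad_char_square_minus:
  "(\<Sum>x\<in>UNIV. quad_char (x ^ 2 - d :: 'p mod_ring)) = (if d = 0 then int CARD('p) - 1 else - 1)"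
proof (cases "d = 0")
  case True
  have "(\<Sum>x\<in>(UNIV :: 'p mod_ring set). quad_char (x ^ 2))
      = (\<Sum>x\<in>(UNIV :: 'p mod_ring set). if x = 0 then 0 else 1)"
    by (intro sum.cong refl) (auto simp: power2_eq_square quad_char_mult quad_char_square)
  also have "\<dots> = (\<Sum>x\<in>(- {0} :: 'p mod_ring set). 1)"
    by (rule sum.mono_neutral_cong_right) auto
  also have "\<dots> = int CARD('p) - 1" by (subst sum_nonzero) simp
  finally show ?thesis using True by simp
next
  case False
  have "(\<Sum>x\<in>UNIV. quad_char (x ^ 2 - d :: 'p mod_ring))
      = (\<Sum>t\<in>UNIV. (1 + quad_char t) * quad_char (t - d))"
    by (rule sum_squares[of "\<lambda>t. quad_char (t - d)"])
  also have "\<dots> = (\<Sum>t\<in>UNIV. quad_char (t + (- d))) + (\<Sum>t\<in>UNIV. quad_char t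
      * quad_char (t - d))"
    by (simp add: distrib_right sum.distrib)
  also have "(\<Sum>t\<in>UNIV. quad_char (t + (- d))) = 0" by (simp only: sum_translate sum_quad_char)
  also have "(\<Sum>t\<in>UNIV. quad_char t * quad_char (t - d))
      = (\<Sum>t\<in>- {0}. quad_char t * quad_char (t - d))"
    by (simp add: sum_nonzero)
  also have "\<dots> = (\<Sum>t\<in>- {0}. quad_char (- d * inverse t + 1))"
  proof (intro sum.cong refl)
    fix t :: "'p mod_ring" assume "t \<in> - {0}"
    then have t: "t \<noteq> 0" by simp
    then have "t - d = t * (- d * inverse t + 1)" by (simp add: field_simps)
    then show "quad_char t * quad_char (t - d) = quad_char (- d * inverse t + 1)"
      using t by (simp only: quad_char_mult quad_char_square_left not_False_eq_True)
  qed
  also have "\<dots> = (\<Sum>t\<in>- {0}. quad_char (- d * t + 1))" by (rule sum_nonzero_inverse)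
  also have "\<dots> = - 1" unfolding sum_nonzero using False by (subst sum_quad_char_affine) simp_all
  finally show ?thesis using False by simp
qed

lemma sum_quad_char_quadratic:
  fixes a b c :: "'p mod_ring"
  assumes "a \<noteq> 0"
  shows "(\<Sum>x\<in>UNIV. quad_char (a * x ^ 2 + 2 * b * x + c)) =
    quad_char a * (if b ^ 2 - a * c = 0 then int CARD('p) - 1 else - 1)"
proof -
  have "quad_char (a * x ^ 2 + 2 * b * x + c) = quad_char a * quad_char ((a * x + b) ^ 2 - (b ^ 2 - a
      * c))" for x
  proof -
    have "a * (a * x ^ 2 + 2 * b * x + c) = (a * x + b) ^ 2 - (b ^ 2 - a * c)"
      by (simp add: power2_eq_square algebra_simps)
    from arg_cong[OF this, of "\<lambda>y. quad_char a * quad_char y"] show ?thesis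
      using assms by (simp only: quad_char_mult quad_char_square_left not_False_eq_True)
  qed
  then have "(\<Sum>x\<in>UNIV. quad_char (a * x ^ 2 + 2 * b * x + c)) =
     quad_char a * (\<Sum>x\<in>UNIV. quad_char ((a * x + b) ^ 2 - (b ^ 2 - a * c)))"
    by (simp only: sum_distrib_left)
  also have "(\<Sum>x\<in>UNIV. quad_char ((a * x + b) ^ 2 - (b ^ 2 - a * c)))
      = (\<Sum>x\<in>UNIV. quad_char (x ^ 2 - (b ^ 2 - a * c)))"
    by (rule sum_affine[OF assms, of "\<lambda>y. quad_char (y ^ 2 - (b ^ 2 - a * c))"])
  finally show ?thesis by (simp only: sum_quad_char_square_minus)
qed

lemma double_half: "2 * (- v / 2) = (- v :: 'p mod_ring)"
  using two_neq_0 by simp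

lemma four_times_discriminant: "4 * ((- v / 2) ^ 2 - 1 * c) = v ^ 2 - 4 * (c :: 'p mod_ring)"
proof -
  have "4 * (- v / 2) ^ 2 = (2 * (- v / 2)) ^ 2" by (simp only: power_mult_distrib) simp
  then show ?thesis unfolding double_half right_diff_distrib by simp
qed

text \<open>The fibre over v consists of the roots of a^2 - v a + c. The lemma serves twice: for the
  sum attached to the parameters 1/4 and 3/4, and for the isogeny in
  \<open>clausen_quad_char\<close>.\<close>

lemma sum_plus_quotient:
  fixes c :: "'p mod_ring" and f :: "'p mod_ring \<Rightarrow> int"
  assumes "c \<noteq> 0"
  shows "(\<Sum>a\<in>- {0}. f (a + c / a)) = (\<Sum>v\<in>UNIV. (1 + quad_char (v ^ 2 - 4 * c)) * f v)"
proof -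
  have "(\<Sum>v\<in>UNIV. sum (\<lambda>a. f (a + c / a)) {a \<in> - {0}. a + c / a = v})
      = (\<Sum>a\<in>- {0}. f (a + c / a))"
    by (rule sum.group) auto
  moreover have "sum (\<lambda>a. f (a + c / a)) {a \<in> - {0}. a + c / a = v}
      = (1 + quad_char (v ^ 2 - 4 * c)) * f v" for v
  proof -
    have "a \<noteq> 0 \<and> a + c / a = v \<longleftrightarrow> 1 * a ^ 2 + - v * a + c = 0" for a
    proof (cases "a = 0")
      case False
      then have "a + c / a = (a ^ 2 + c) / a" by (simp add: add_divide_distrib power2_eq_square)
      then have "a + c / a = v \<longleftrightarrow> (a ^ 2 + c) - v * a = 0" using False
          by (simp add: nonzero_divide_eq_eq)
      then show ?thesis using False by (simp add: algebra_simps)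
    qed (use assms in simp)
    then have "{a \<in> - {0}. a + c / a = v} = {a. 1 * a ^ 2 + 2 * (- v / 2) * a + c = 0}"
      unfolding double_half by auto
    then have "int (card {a \<in> - {0}. a + c / a = v}) = 1 + quad_char ((- v / 2) ^ 2 - 1 * c)"
      using card_quadratic_roots[of 1 "- v / 2" c] by simp
    also have "quad_char ((- v / 2) ^ 2 - 1 * c) = quad_char (4 * ((- v / 2) ^ 2 - 1 * c))"
      by (simp only: quad_char_mult quad_char_4 mult_1)
    also note four_times_discriminant
    finally have "int (card {a \<in> - {0}. a + c / a = v}) = 1 + quad_char (v ^ 2 - 4 * c)" .
    then show ?thesis by simp
  qed
  ultimately show ?thesis by (simp only:)
qed

lemma sum_symmetric:
  fixes f :: "'p mod_ring \<Rightarrow> 'p mod_ring \<Rightarrow> int"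
  shows "(\<Sum>v\<in>UNIV. \<Sum>w\<in>UNIV. f (v + w) (v * w))
      = (\<Sum>s\<in>UNIV. \<Sum>P\<in>UNIV. (1 + quad_char (s ^ 2 - 4 * P)) * f s P)"
proof -
  have "(\<Sum>v\<in>UNIV. \<Sum>w\<in>UNIV. f (v + w) (v * w))
      = (\<Sum>v\<in>UNIV. \<Sum>s\<in>UNIV. f s (v * (s - v)))"
  proof (rule sum.cong[OF refl])
    fix v :: "'p mod_ring"
    have "(\<Sum>s\<in>UNIV. f s (v * (s - v))) = (\<Sum>w\<in>UNIV. f (w + v) (v * (w + v - v)))"
      by (rule sum_translate[of "\<lambda>s. f s (v * (s - v))", symmetric])
    then show "(\<Sum>w\<in>UNIV. f (v + w) (v * w)) = (\<Sum>s\<in>UNIV. f s (v * (s - v)))"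
      by (simp add: add.commute)
  qed
  also have "\<dots> = (\<Sum>s\<in>UNIV. \<Sum>v\<in>UNIV. f s (v * (s - v)))" by (rule sum.swap)
  also have "\<dots> = (\<Sum>s\<in>UNIV. \<Sum>P\<in>UNIV. (1 + quad_char (s ^ 2 - 4 * P)) * f s P)"
  proof (rule sum.cong[OF refl])
    fix s :: "'p mod_ring"
    have "int (card {v. v * (s - v) = P}) = 1 + quad_char (s ^ 2 - 4 * P)" for P
    proof -
      have "v * (s - v) = P \<longleftrightarrow> 1 * v ^ 2 + - s * v + P = 0" for v
      proof -
        have "1 * v ^ 2 + - s * v + P = P - v * (s - v)" by (simp add: algebra_simps power2_eq_square)
        then show ?thesis by auto
      qed
      then have "{v. v * (s - v) = P} = {v. 1 * v ^ 2 + 2 * (- s / 2) * v + P = 0}"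
        unfolding double_half by auto
      then have "int (card {v. v * (s - v) = P}) = 1 + quad_char ((- s / 2) ^ 2 - 1 * P)"
        using card_quadratic_roots[of 1 "- s / 2" P] by simp
      also have "quad_char ((- s / 2) ^ 2 - 1 * P) = quad_char (4 * ((- s / 2) ^ 2 - 1 * P))"
        by (simp only: quad_char_mult quad_char_4 mult_1)
      also note four_times_discriminant
      finally show ?thesis .
    qed
    then show "(\<Sum>v\<in>UNIV. f s (v * (s - v))) = (\<Sum>P\<in>UNIV. (1 + quad_char (s ^ 2 - 4 * P))
        * f s P)"
      using sum_fibers[of "f s" "\<lambda>v. v * (s - v)"] by simp
  qed
  finally show ?thesis .
qed

text \<open>Sorting the points $P$ by the value $z$ of $q_1(P)/q_2(P)$ replaces the product of two
  quadratics by $z$ times the discriminant of $q_1 - z q_2$; a common zero of $q_1$ and $q_2$ is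
  counted for every $z$ and contributes $\sum_z \varphi(z) = 0$.\<close>

lemma sum_quad_char_two_quadratics:
  fixes a1 b1 c1 b2 c2 :: "'p mod_ring"
  defines "q1 \<equiv> \<lambda>P. a1 * P ^ 2 + 2 * b1 * P + c1"
      and "q2 \<equiv> \<lambda>P. P ^ 2 + 2 * b2 * P + c2"
  assumes nondeg: "b1 - a1 * b2 \<noteq> 0 \<or> c1 - a1 * c2 \<noteq> 0"
  shows "(\<Sum>P\<in>UNIV. quad_char (q1 P) * quad_char (q2 P)) =
    (\<Sum>z\<in>UNIV. quad_char z * quad_char ((b1 - z * b2) ^ 2 - (a1 - z) * (c1 - z * c2))) - quad_char a1"
proof -
  let ?D = "\<lambda>z. (b1 - z * b2) ^ 2 - (a1 - z) * (c1 - z * c2)"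
  \<comment> \<open>At z = a1 the polynomial q1 - z q2 drops to degree at most one and a root
    escapes to infinity; the correction 1 accounts for it and becomes the final term
    \<open>quad_char a1\<close>.\<close>
  have count: "int (card {P. q1 P = z * q2 P}) = 1 + quad_char (?D z) - (if z = a1 then 1 else 0)" for z
  proof -
    have eq: "{P. q1 P = z * q2 P} = {P. (a1 - z) * P ^ 2 + 2 * (b1 - z * b2) * P + (c1 - z * c2) = 0}"
      by (auto simp: q1_def q2_def algebra_simps)
    show ?thesis
    proof (cases "z = a1")
      case False
      then show ?thesis unfolding eq using card_quadratic_roots[of "a1 - z" "b1 - z * b2" "c1 - z * c2"] by simp
    next
      case True
      let ?b = "b1 - a1 * b2" and ?c = "c1 - a1 * c2"
      show ?thesis
      proof (cases "?b = 0")
        case b: False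
        then have b2: "2 * ?b \<noteq> 0" using two_neq_0 by simp
        have "(a1 - a1) * P ^ 2 + 2 * ?b * P + ?c = 0 \<longleftrightarrow> P = - ?c / (2 * ?b)" for P
          unfolding nonzero_eq_divide_eq[OF b2] eq_neg_iff_add_eq_0 by (simp add: mult.commute)
        then have "{P. q1 P = z * q2 P} = {- ?c / (2 * ?b)}"
          unfolding eq unfolding True by simp
        then show ?thesis using True b by (simp add: power2_eq_square quad_char_mult quad_char_square)
      next
        case b: True
        then have "{P. q1 P = z * q2 P} = {}" unfolding eq unfolding True using nondeg by auto
        then show ?thesis using True b by simp
      qed
    qed
  qed
  have expand: "quad_char z * (1 + d - (if z = a1 then 1 else 0)) =
      quad_char z + quad_char z * d - (if z = a1 then quad_char a1 else 0)" for z d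
    by (simp add: algebra_simps)
  have "(\<Sum>P\<in>UNIV. quad_char (q1 P) * quad_char (q2 P)) = (\<Sum>P\<in>UNIV. \<Sum>z\<in>UNIV.
      if q1 P = z * q2 P then quad_char z else 0)"
  proof (rule sum.cong[OF refl])
    fix P
    show "quad_char (q1 P) * quad_char (q2 P) = (\<Sum>z\<in>UNIV. if q1 P = z * q2 P then quad_char z else 0)"
    proof (cases "q2 P = 0")
      case False
      then have "q1 P = z * q2 P \<longleftrightarrow> z = q1 P / q2 P" for z by (auto simp: field_simps)
      then show ?thesis by (simp add: quad_char_divide)
    next
      case True
      then show ?thesis by (cases "q1 P = 0") (simp_all add: sum_quad_char)
    qed
  qed
  also have "\<dots> = (\<Sum>z\<in>UNIV. \<Sum>P\<in>UNIV. if q1 P = z * q2 P then quad_char z else 0)"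
      by (rule sum.swap)
  also have "\<dots> = (\<Sum>z\<in>UNIV. quad_char z * (1 + quad_char (?D z) - (if z = a1 then 1 else 0)))"
    unfolding count[symmetric] by (intro sum.cong refl) (simp add: sum.If_cases)
  also have "\<dots> = (\<Sum>z\<in>(UNIV :: 'p mod_ring set). quad_char z)
      + (\<Sum>z\<in>UNIV. quad_char z * quad_char (?D z)) - (\<Sum>z\<in>UNIV. if z
      = a1 then quad_char a1 else 0)"
    by (simp only: expand sum.distrib sum_subtractf)
  finally show ?thesis by (simp add: sum_quad_char)
qed

text \<open>A finite-field counterpart of Clausen's formula, by which the square of a 2F1 is a 3F2.
  The left side is the sum over u and v after w = u v, with denominators cleared.\<close>

theorem clausen_quad_char:
  fixes k m :: "'p mod_ring"
  assumes k: "k \<noteq> 0" and m: "m \<noteq> 0" and mk: "m = k + 1"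
  shows "(\<Sum>u\<in>UNIV. \<Sum>w\<in>UNIV. quad_char (u * (u + 1)) * quad_char (w * (w + k) * (w + u))) =
    quad_char m * ((\<Sum>v\<in>UNIV. quad_char (1 + v) * quad_char (m * v ^ 2 - 1)) ^ 2 - int CARD('p))"
proof -
  let ?B = "\<Sum>v\<in>UNIV. quad_char (1 + v) * quad_char (m * v ^ 2 - 1)"
  \<comment> \<open>Here r stands for 1 + s + P = (1 + v)(1 + w). \<open>?Q1\<close> is (m v^2 -
    1)(m w^2 - 1), and \<open>?Q2\<close> is (v - w)^2, the discriminant of the pair, both in terms
    of r and P.\<close>
  let ?Q1 = "\<lambda>r P. (m * P + 1) ^ 2 - m * (r - 1 - P) ^ 2" and ?Q2
      = "\<lambda>r P. (r - 1 - P) ^ 2 - 4 * P"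
  let ?f = "\<lambda>s P. quad_char (1 + s + P) * quad_char ((m * P + 1) ^ 2 - m * s ^ 2)"
  have expand: "(1 + x) * (y * z) = y * z + y * (z * x)" for x y z :: int
    by (simp add: algebra_simps)
  have "?B ^ 2 = (\<Sum>v\<in>UNIV. \<Sum>w\<in>UNIV. ?f (v + w) (v * w))"
    unfolding power2_eq_square[of ?B] sum_product
  proof (intro sum.cong refl)
    fix v w :: "'p mod_ring"
    have "1 + (v + w) + v * w = (1 + v) * (1 + w)" by (simp add: algebra_simps)
    moreover have "(m * (v * w) + 1) ^ 2 - m * (v + w) ^ 2 = (m * v ^ 2 - 1) * (m * w ^ 2 - 1)"
      by (simp add: power2_eq_square algebra_simps)
    ultimately show "quad_char (1 + v) * quad_char (m * v ^ 2 - 1) * (quad_char (1 + w) * quad_char (m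
        * w ^ 2 - 1)) = ?f (v + w) (v * w)"
      by (simp only: quad_char_mult mult_ac)
  qed
  also have "\<dots> = (\<Sum>s\<in>UNIV. \<Sum>P\<in>UNIV. (1 + quad_char (s ^ 2 - 4 * P)) * ?f s P)"
      by (rule sum_symmetric)
  also have "\<dots> = (\<Sum>P\<in>UNIV. \<Sum>s\<in>UNIV. (1 + quad_char (s ^ 2 - 4 * P)) * ?f s P)"
      by (rule sum.swap)
  also have "\<dots> = (\<Sum>P\<in>UNIV. \<Sum>r\<in>UNIV. (1 + quad_char (?Q2 r P)) * (quad_char r
      * quad_char (?Q1 r P)))"
  proof (rule sum.cong[OF refl])
    fix P :: "'p mod_ring"
    have "(\<Sum>s\<in>UNIV. (1 + quad_char (s ^ 2 - 4 * P)) * ?f s P) =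
        (\<Sum>r\<in>UNIV. (1 + quad_char ((r + (- 1 - P)) ^ 2 - 4 * P)) * ?f (r + (- 1 - P)) P)"
      by (rule sum_translate[symmetric])
    also have "\<dots> = (\<Sum>r\<in>UNIV. (1 + quad_char (?Q2 r P)) * (quad_char r * quad_char (?Q1 r P)))"
    proof (rule sum.cong[OF refl])
      fix r :: "'p mod_ring"
      have "r + (- 1 - P) = r - 1 - P" "1 + (r - 1 - P) + P = r" by simp_all
      then show "(1 + quad_char ((r + (- 1 - P)) ^ 2 - 4 * P)) * ?f (r + (- 1 - P)) P =
          (1 + quad_char (?Q2 r P)) * (quad_char r * quad_char (?Q1 r P))" by (simp only:)
    qed
    finally show "(\<Sum>s\<in>UNIV. (1 + quad_char (s ^ 2 - 4 * P)) * ?f s P) =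
        (\<Sum>r\<in>UNIV. (1 + quad_char (?Q2 r P)) * (quad_char r * quad_char (?Q1 r P)))" .
  qed
  also have "\<dots> = (\<Sum>r\<in>UNIV. \<Sum>P\<in>UNIV. (1 + quad_char (?Q2 r P)) * (quad_char r
      * quad_char (?Q1 r P)))"
    by (rule sum.swap)
  also have "\<dots> = (\<Sum>r\<in>UNIV. quad_char r * (\<Sum>P\<in>UNIV. quad_char (?Q1 r P))) +
      (\<Sum>r\<in>UNIV. quad_char r * (\<Sum>P\<in>UNIV. quad_char (?Q1 r P) * quad_char (?Q2 r P)))"
    by (simp only: expand sum_distrib_left sum.distrib)
  finally have B2: "?B ^ 2 = (\<Sum>r\<in>UNIV. quad_char r * (\<Sum>P\<in>UNIV. quad_char (?Q1 r P))) +
      (\<Sum>r\<in>UNIV. quad_char r * (\<Sum>P\<in>UNIV. quad_char (?Q1 r P) * quad_char (?Q2 r P)))" .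
  have mk0: "m * k \<noteq> 0" using m k by simp
  \<comment> \<open>As a polynomial in P, \<open>?Q1\<close> has discriminant m (m r - k)^2. It
    vanishes only for r = k/m, and this single r produces the term p.\<close>
  have Q1: "?Q1 r P = (m * k) * P ^ 2 + 2 * (m * r) * P + (1 - m * (r - 1) ^ 2)" for r P
    by (simp add: mk power2_eq_square algebra_simps)
  have "(\<Sum>P\<in>UNIV. quad_char (?Q1 r P)) = quad_char (m * k) * ((if r
      = k / m then int CARD('p) else 0) - 1)" for r
  proof -
    have "(m * r) ^ 2 - (m * k) * (1 - m * (r - 1) ^ 2) = m * (m * r - k) ^ 2"
      by (simp add: mk power2_eq_square algebra_simps)
    moreover have "m * (m * r - k) ^ 2 = 0 \<longleftrightarrow> r = k / m" using m by (auto simp: field_simps)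
    ultimately show ?thesis unfolding Q1 sum_quad_char_quadratic[OF mk0] by simp
  qed
  note sum_Q1 = this
  have "(\<Sum>r\<in>UNIV. quad_char r * (\<Sum>P\<in>UNIV. quad_char (?Q1 r P))) =
      (\<Sum>r\<in>UNIV. (if r = k / m then quad_char (m * k) * quad_char (k / m) * int CARD('p) else 0)
          - quad_char (m * k) * quad_char r)"
    unfolding sum_Q1 by (intro sum.cong refl) (simp add: algebra_simps)
  also have "\<dots> = quad_char (m * k) * quad_char (k / m) * int CARD('p)"
    by (simp add: sum_subtractf sum_distrib_left[symmetric] sum_quad_char)
  also have "quad_char (m * k) * quad_char (k / m) = 1"
    using quad_char_square[OF m] quad_char_square[OF k]
    by (simp add: quad_char_mult quad_char_divide) (metis mult.assoc mult.commute mult.right_neutral)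
  finally have T1: "(\<Sum>r\<in>UNIV. quad_char r * (\<Sum>P\<in>UNIV. quad_char (?Q1 r P)))
      = int CARD('p)" by simp
  let ?Y = "\<lambda>r. (m * r - k) ^ 2"
  have inner: "(\<Sum>P\<in>UNIV. quad_char (?Q1 r P) * quad_char (?Q2 r P)) =
      (\<Sum>z\<in>UNIV. quad_char (z * (z + 1)) * quad_char (4 * r * m * z + ?Y r)) - quad_char (m * k)" for r
  proof -
    have Q2: "?Q2 r P = P ^ 2 + 2 * (- (r + 1)) * P + (r - 1) ^ 2" for P
      by (simp add: power2_eq_square algebra_simps)
    \<comment> \<open>If the middle coefficients are proportional, then m r = -k, and the constant
      terms fail to be proportional by -4 m k.\<close>
    have nondeg: "m * r - (m * k) * (- (r + 1)) \<noteq> 0 \<or> (1 - m * (r - 1) ^ 2) - (m * k) * (r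
        - 1) ^ 2 \<noteq> 0"
    proof (cases "m * r - (m * k) * (- (r + 1)) = 0")
      case True
      have "m * r - (m * k) * (- (r + 1)) = m * (m * r + k)" by (simp add: mk algebra_simps)
      then have "m * r = - k" using True m by (simp add: add_eq_0_iff)
      then have "m * (r - 1) = - k - m" by (simp add: algebra_simps)
      then have "m * ((1 - m * (r - 1) ^ 2) - (m * k) * (r - 1) ^ 2) = m - (k + 1) * (- k - m) ^ 2"
        by (simp add: power2_eq_square algebra_simps flip: \<open>m * (r - 1) = - k - m\<close>)
      also have "\<dots> = - (4 * m * m * k)" by (simp add: mk power2_eq_square algebra_simps)
      also have "\<dots> \<noteq> 0" using m k four_neq_0 by simp
      finally show ?thesis by auto
    qed simp
    \<comment> \<open>The discriminant has a factor z + m that is free of r. After scaling z by m it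
      joins phi(z) to form phi(z (z + 1)), and r remains in one other factor only.\<close>
    have D: "(m * r - z * (- (r + 1))) ^ 2 - (m * k - z) * ((1 - m * (r - 1) ^ 2) - z * (r - 1) ^ 2) =
        (4 * r * z + ?Y r) * (z + m)" for z
      by (simp add: mk power2_eq_square algebra_simps)
    have "(\<Sum>P\<in>UNIV. quad_char (?Q1 r P) * quad_char (?Q2 r P)) =
        (\<Sum>z\<in>UNIV. quad_char z * quad_char ((4 * r * z + ?Y r) * (z + m))) - quad_char (m * k)"
      unfolding Q1 Q2 sum_quad_char_two_quadratics[OF nondeg] D ..
    also have "(\<Sum>z\<in>UNIV. quad_char z * quad_char ((4 * r * z + ?Y r) * (z + m))) =
        (\<Sum>z\<in>UNIV. quad_char (m * z) * quad_char ((4 * r * (m * z) + ?Y r) * (m * z + m)))"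
      by (rule sum_scale[OF m, symmetric])
    also have "\<dots> = (\<Sum>z\<in>UNIV. quad_char (z * (z + 1)) * quad_char (4 * r * m * z + ?Y r))"
    proof (rule sum.cong[OF refl])
      fix z :: "'p mod_ring"
      have "m * z + m = m * (z + 1)" "4 * r * (m * z) = 4 * r * m * z" by (simp_all add: algebra_simps)
      then have "quad_char (m * z) * quad_char ((4 * r * (m * z) + ?Y r) * (m * z + m)) =
          (quad_char m * quad_char m) * (quad_char z * quad_char (z + 1) * quad_char (4 * r * m * z + ?Y r))"
        by (simp only: quad_char_mult mult_ac)
      then show "quad_char (m * z) * quad_char ((4 * r * (m * z) + ?Y r) * (m * z + m)) =
          quad_char (z * (z + 1)) * quad_char (4 * r * m * z + ?Y r)"
        by (simp only: quad_char_square[OF m] mult_1 quad_char_mult[of z])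
    qed
    finally show ?thesis .
  qed
  have "(\<Sum>r\<in>UNIV. quad_char r * (\<Sum>P\<in>UNIV. quad_char (?Q1 r P) * quad_char (?Q2 r P))) =
      (\<Sum>r\<in>UNIV. \<Sum>z\<in>UNIV. quad_char r * (quad_char (z * (z + 1)) * quad_char (4 * r * m
          * z + ?Y r))) - (\<Sum>r\<in>(UNIV :: 'p mod_ring set). quad_char r * quad_char (m * k))"
    unfolding inner right_diff_distrib sum_subtractf sum_distrib_left ..
  also have "(\<Sum>r\<in>(UNIV :: 'p mod_ring set). quad_char r * quad_char (m * k)) = 0"
    by (simp add: sum_distrib_right[symmetric] sum_quad_char)
  finally have "quad_char m * (\<Sum>r\<in>UNIV. quad_char r * (\<Sum>P\<in>UNIV. quad_char (?Q1 r P)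
      * quad_char (?Q2 r P))) =
      (\<Sum>r\<in>UNIV. \<Sum>z\<in>UNIV. quad_char m * (quad_char r * (quad_char (z * (z + 1))
          * quad_char (4 * r * m * z + ?Y r))))"
    by (simp add: sum_distrib_left)
  also have "\<dots> = (\<Sum>z\<in>UNIV. \<Sum>r\<in>UNIV. quad_char m * (quad_char r * (quad_char (z * (z
      + 1)) * quad_char (4 * r * m * z + ?Y r))))"
    by (rule sum.swap)
  also have "\<dots> = (\<Sum>z\<in>UNIV. \<Sum>u\<in>UNIV. quad_char (z * (z + 1)) * quad_char (u * (u
      + k) * (u + z)))"
  proof (rule sum.cong[OF refl])
    fix z :: "'p mod_ring"
    \<comment> \<open>With R = m r this is a sum over the curve y^2 = R (R^2 + (4z - 2k) R + k^2).
      The map v = R + k^2/R passes to the quotient by the 2-torsion point (0, 0), the isogenous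
      curve y^2 = (v^2 - 4 k^2)(v + 4z - 2k).\<close>
    let ?g = "\<lambda>R. quad_char R * quad_char (4 * R * z + (R - k) ^ 2)"
    have k2: "k ^ 2 \<noteq> 0" using k by simp
    have "(\<Sum>r\<in>UNIV. ?g (m * r)) = (\<Sum>R\<in>UNIV. ?g R)" by (rule sum_scale[OF m])
    also have "\<dots> = (\<Sum>R\<in>- {0}. ?g R)" by (simp add: sum_nonzero)
    also have "\<dots> = (\<Sum>R\<in>- {0}. quad_char ((R + k ^ 2 / R) + (4 * z - 2 * k)))"
    proof (intro sum.cong refl)
      fix R :: "'p mod_ring" assume "R \<in> - {0}"
      then have R: "R \<noteq> 0" by simp
      have "R * ((R + k ^ 2 / R) + (4 * z - 2 * k)) = R * R + R * (k ^ 2 / R) + R * (4 * z - 2 * k)"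
        by (simp only: distrib_left)
      also have "R * (k ^ 2 / R) = k ^ 2" using R by simp
      also have "R * R + k ^ 2 + R * (4 * z - 2 * k) = 4 * R * z + (R - k) ^ 2"
        by (simp add: algebra_simps power2_eq_square)
      finally have "4 * R * z + (R - k) ^ 2 = R * ((R + k ^ 2 / R) + (4 * z - 2 * k))" ..
      then show "?g R = quad_char ((R + k ^ 2 / R) + (4 * z - 2 * k))"
        using R by (simp only: quad_char_mult quad_char_square_left not_False_eq_True)
    qed
    also have "\<dots> = (\<Sum>v\<in>UNIV. (1 + quad_char (v ^ 2 - 4 * k ^ 2)) * quad_char (v + (4 * z - 2
        * k)))"
      by (rule sum_plus_quotient[OF k2, of "\<lambda>v. quad_char (v + (4 * z - 2 * k))"])
    also have "\<dots> = (\<Sum>v\<in>UNIV. quad_char (v + (4 * z - 2 * k)))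
        + (\<Sum>v\<in>UNIV. quad_char (v ^ 2 - 4 * k ^ 2) * quad_char (v + (4 * z - 2 * k)))"
      by (simp only: distrib_right sum.distrib mult_1)
    also have "(\<Sum>v\<in>UNIV. quad_char (v + (4 * z - 2 * k))) = 0"
        by (simp only: sum_translate sum_quad_char)
    \<comment> \<open>The substitution v = 4u + 2k moves the roots 2k, -2k and 2k - 4z to 0, -k and
      -z, at the cost of square factors only.\<close>
    also have "(\<Sum>v\<in>UNIV. quad_char (v ^ 2 - 4 * k ^ 2) * quad_char (v + (4 * z - 2 * k))) =
        (\<Sum>u\<in>UNIV. quad_char ((4 * u + 2 * k) ^ 2 - 4 * k ^ 2) * quad_char ((4 * u + 2 * k) + (4
            * z - 2 * k)))"
      by (rule sum_affine[OF four_neq_0, symmetric])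
    also have "\<dots> = (\<Sum>u\<in>UNIV. quad_char (u * (u + k) * (u + z)))"
    proof (rule sum.cong[OF refl])
      fix u :: "'p mod_ring"
      have "(4 * u + 2 * k) ^ 2 - 4 * k ^ 2 = 4 * (4 * (u * (u + k)))" "(4 * u + 2 * k) + (4 * z - 2 * k)
          = 4 * (u + z)"
        by (simp_all add: power2_eq_square algebra_simps)
      then show "quad_char ((4 * u + 2 * k) ^ 2 - 4 * k ^ 2) * quad_char ((4 * u + 2 * k) + (4 * z - 2
          * k)) = quad_char (u * (u + k) * (u + z))"
        by (simp only: quad_char_mult quad_char_4 mult_1)
    qed
    finally have g: "(\<Sum>r\<in>UNIV. ?g (m * r)) = (\<Sum>u\<in>UNIV. quad_char (u * (u + k) * (u
        + z)))" by simp
    have "(\<Sum>r\<in>UNIV. quad_char m * (quad_char r * (quad_char (z * (z + 1)) * quad_char (4 * r * m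
        * z + ?Y r)))) =
       (\<Sum>r\<in>UNIV. quad_char (z * (z + 1)) * ?g (m * r))"
    proof (rule sum.cong[OF refl])
      fix r :: "'p mod_ring"
      have "4 * r * m * z = 4 * (m * r) * z" by simp
      then show "quad_char m * (quad_char r * (quad_char (z * (z + 1)) * quad_char (4 * r * m * z + ?Y r)))
          = quad_char (z * (z + 1)) * ?g (m * r)"
        by (simp only: quad_char_mult[of m r] mult_ac)
    qed
    also have "\<dots> = quad_char (z * (z + 1)) * (\<Sum>r\<in>UNIV. ?g (m * r))"
        by (simp only: sum_distrib_left)
    finally show "(\<Sum>r\<in>UNIV. quad_char m * (quad_char r * (quad_char (z * (z + 1)) * quad_char (4
        * r * m * z + ?Y r)))) =
       (\<Sum>u\<in>UNIV. quad_char (z * (z + 1)) * quad_char (u * (u + k) * (u + z)))"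
      unfolding g by (simp only: sum_distrib_left)
  qed
  finally show ?thesis using B2 T1 by simp
qed

end

section \<open>The duplication formula\<close>

fun unit_count :: "nat \<Rightarrow> nat \<Rightarrow> nat" where
  "unit_count p 0 = 0"
| "unit_count p (Suc n) = unit_count p n + (if p dvd n then 0 else 1)"

lemma unit_count_eq: "0 < p \<Longrightarrow> unit_count p n + (n + p - 1) div p = n"
proof (induction n)
  case (Suc n)
  have "Suc n + p - 1 = Suc (n + p - 1)" using Suc.prems by simp
  moreover have "Suc (n + p - 1) mod p = 0 \<longleftrightarrow> p dvd n" using Suc.prems
      by (simp add: dvd_eq_mod_eq_0)
  ultimately have "(Suc n + p - 1) div p = (n + p - 1) div p + (if p dvd n then 1 else 0)"
    by (simp only: div_Suc) simp
  then show ?case using Suc by simp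
qed simp

context
  assumes odd: "odd CARD('p :: prime_card)"
begin

lemma padic_two_unit: "\<not> padic_p dvd (2 :: 'p padic_int)"
  using padic_p_dvd_of_nat_iff[of 2, where 'p='p] CARD_ge_3[OF odd] by (auto dest: dvd_imp_le)

text \<open>Raising n by one replaces Gamma_p(n/2) by Gamma_p(n/2 + 1) in the product on the left.
  The factors at n and n/2 differ by 2 if n is prime to p and agree otherwise, so the power of 2
  counts the units below n.\<close>

lemma morita_Gamma_duplication_nat:
  fixes i2 :: "'p padic_int"
  assumes i2: "2 * i2 = 1"
  shows "2 ^ unit_count CARD('p) n * (morita_Gamma (of_nat n * i2) * morita_Gamma (of_nat n * i2 + i2)) =
    morita_Gamma (of_nat n) * morita_Gamma i2"
proof (induction n)
  case 0
  show ?case by (simp add: morita_Gamma_0[OF odd])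
next
  case (Suc n)
  let ?X = "of_nat n * i2"
  have n: "of_nat n = 2 * ?X" using i2 by (simp add: mult.left_commute)
  have f: "morita_factor (of_nat n) = (if CARD('p) dvd n then 1 else 2) * morita_factor ?X"
  proof -
    have "padic_p dvd ?X \<longleftrightarrow> padic_p dvd 2 * ?X"
      unfolding padic_p_dvd_mult_iff[of 2] using padic_two_unit by simp
    also have "\<dots> \<longleftrightarrow> padic_p dvd (of_nat n :: 'p padic_int)"
        by (simp only: n[symmetric])
    also have "\<dots> \<longleftrightarrow> CARD('p) dvd n" by (rule padic_p_dvd_of_nat_iff)
    finally have dvd: "padic_p dvd ?X \<longleftrightarrow> CARD('p) dvd n" .
    have "2 * - ?X = - of_nat n" by (simp only: mult_minus_right n[symmetric])
    then show ?thesis unfolding morita_factor_def padic_p_dvd_of_nat_iff dvd by simp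
  qed
  have "of_nat (Suc n) * i2 + i2 = ?X + 1"
    using i2 by (simp add: algebra_simps mult_2 flip: mult_2)
  moreover have "of_nat (Suc n) * i2 = ?X + i2" by (simp add: algebra_simps)
  ultimately have "morita_Gamma (of_nat (Suc n) * i2) * morita_Gamma (of_nat (Suc n) * i2 + i2) =
      (morita_Gamma ?X * morita_Gamma (?X + i2)) * morita_factor ?X"
    by (simp only: morita_Gamma_plus_1[OF odd] mult_ac)
  then have "2 ^ unit_count CARD('p) (Suc n) * (morita_Gamma (of_nat (Suc n) * i2)
      * morita_Gamma (of_nat (Suc n) * i2 + i2)) =
      (2 ^ unit_count CARD('p) n * (morita_Gamma ?X * morita_Gamma (?X + i2)))
          * ((if CARD('p) dvd n then 1 else 2) * morita_factor ?X)"
    by (simp add: mult_ac)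
  also have "\<dots> = (morita_Gamma (of_nat n) * morita_factor (of_nat n)) * morita_Gamma i2"
    unfolding Suc f[symmetric] by (simp only: mult_ac)
  also have "morita_Gamma (of_nat n) * morita_factor (of_nat n) = morita_Gamma (of_nat (Suc n) :: 'p padic_int)"
    using morita_Gamma_plus_1[OF odd, of "of_nat n"] by (simp add: add.commute)
  finally show ?case .
qed

text \<open>This is how a growing power of 2 turns into a Teichmueller value when n approaches a
  p-adic argument.\<close>

lemma teich0_two_cong: "padic_p ^ Suc N dvd 2 ^ (CARD('p) ^ N) - (teich0 2 :: 'p padic_int)"
proof (induction N)
  case 0
  have "to_int_mod_ring (2 :: 'p mod_ring) = 2"
    using to_int_mod_ring_of_int_mod_ring[of 2, where 'a='p] CARD_ge_3[OF odd]
    by (simp flip: of_int_of_int_mod_ring)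
  then show ?case using dvd_diff_swap[OF teich0_cong[of "2 :: 'p mod_ring"]] by simp
next
  case (Suc N)
  from padic_power_cong[OF this] show ?case
    by (simp only: teich0_power_CARD power_mult[symmetric] power_Suc2)
qed

lemma power_diff_dvd: "(d :: 'a :: comm_ring_1) dvd x - y \<Longrightarrow> d dvd x ^ n - y ^ n"
  using power_diff_sumr2[of x n y] by (simp add: dvd_mult2)

text \<open>The natural number $n = p n' - r$ below approximates $2Z = r/(p-1)$ modulo $p^{M+1}$ and has
  exactly $p^M (p - 1 - r)$ smaller natural numbers prime to $p$.\<close>

lemma morita_Gamma_duplication:
  fixes Z i2 :: "'p padic_int"
  assumes i2: "2 * i2 = 1" and Z: "of_nat (CARD('p) - 1) * (2 * Z) = of_nat r" and r: "r < CARD('p) - 1"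
  shows "morita_Gamma Z * morita_Gamma (Z + i2) = teich0 2 ^ r * (morita_Gamma (2 * Z) * morita_Gamma i2)"
proof -
  let ?p = "CARD('p)"
  define q where "q = ?p - 1"
  have p: "?p = Suc q" and q0: "q > 0" and rq: "r < q"
    using CARD_gt_1[where 'p='p] r by (simp_all add: q_def)
  have q_unit: "\<not> padic_p dvd (of_nat q :: 'p padic_int)"
    unfolding padic_p_dvd_of_nat_iff using q0 p by (auto dest: dvd_imp_le)
  \<comment> \<open>The unit count is p^M (q - r), so the power of 2 approximates omega(2)^(q-r);
    omega(2)^q = 1 then moves it to the other side.\<close>
  have "morita_Gamma (2 * Z) * morita_Gamma i2 = teich0 2 ^ (q - r) * (morita_Gamma Z * morita_Gamma (Z + i2))"
  proof (rule padic_eqI)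
    fix M
    let ?P = "padic_p ^ Suc M :: 'p padic_int"
    have "[?p ^ M * (q - r) + r = 1 ^ M * (q - r) + r] (mod q)"
      by (intro cong_add cong_mult cong_pow cong_refl) (simp only: p cong_def Suc_eq_plus1 mod_add_self1)
    then have "q dvd ?p ^ M * (q - r) + r" using rq by (simp add: cong_def dvd_eq_mod_eq_0)
    then obtain n' where n': "?p ^ M * (q - r) + r = q * n'" by auto
    have "n' > 0" using n' rq by (intro gr0I) auto
    then have le: "r \<le> ?p * n'" using rq p by (cases n') auto
    define n where "n = ?p * n' - r"
    have "q * n + q * r = ?p * (q * n')" using le by (simp add: n_def distrib_left[symmetric])
    also have "\<dots> = ?p ^ Suc M * (q - r) + (1 + q) * r"
      unfolding n'[symmetric] by (simp only: distrib_left power_Suc mult.assoc p plus_1_eq_Suc)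
    also have "(1 + q) * r = r + q * r" by simp
    finally have qn: "q * n = ?p ^ Suc M * (q - r) + r" by linarith
    have count: "unit_count ?p n = ?p ^ M * (q - r)"
    proof -
      have "n + ?p - 1 = (q - r) + ?p * n'" using le rq p by (simp add: n_def)
      moreover have "((q - r) + ?p * n') div ?p = n'" using p by (intro div_nat_eqI) auto
      ultimately have "(n + ?p - 1) div ?p = n'" by (simp only:)
      then have "unit_count ?p n + n' = n" using unit_count_eq[of ?p n] by simp
      then have "unit_count ?p n + n' + r = q * n' + n'" using le p by (simp add: n_def)
      then show ?thesis using n' by simp
    qed
    have "of_nat q * (of_nat n - 2 * Z) = of_nat (q * n) - of_nat r"
      using Z by (simp add: q_def right_diff_distrib)
    also have "\<dots> = ?P * of_nat (q - r)" unfolding qn by simp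
    finally have "?P dvd (of_nat n - 2 * Z) * of_nat q" by (simp add: mult.commute)
    then have n: "?P dvd of_nat n - 2 * Z" by (rule padic_power_dvd_mult_cancel[OF q_unit])
    have "of_nat n * i2 - Z = (of_nat n - 2 * Z) * i2"
      using i2 by (simp add: left_diff_distrib)
    then have nZ: "?P dvd of_nat n * i2 - Z" using n by simp
    have "(of_nat n * i2 + i2) - (Z + i2) = of_nat n * i2 - Z" by simp
    then have nZ': "?P dvd (of_nat n * i2 + i2) - (Z + i2)" using nZ by (simp only:)
    let ?a = "2 ^ unit_count ?p n :: 'p padic_int" and ?b = "morita_Gamma (of_nat n * i2)" and ?c
        = "morita_Gamma (of_nat n * i2 + i2)"
    let ?a' = "teich0 2 ^ (q - r) :: 'p padic_int" and ?b' = "morita_Gamma Z" and ?c' = "morita_Gamma (Z + i2)"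
    have a: "?P dvd ?a - ?a'"
      unfolding count power_mult by (rule power_diff_dvd[OF teich0_two_cong])
    have "?P dvd (?a - ?a') * (?b * ?c) + ?a' * ((?b - ?b') * ?c + ?b' * (?c - ?c'))"
      by (intro dvd_add dvd_mult[OF dvd_add] dvd_mult dvd_mult2 a morita_Gamma_cong[OF odd] nZ nZ')
    then have 1: "?P dvd ?a * (?b * ?c) - ?a' * (?b' * ?c')" by (simp add: algebra_simps)
    have 2: "?P dvd (morita_Gamma (of_nat n) - morita_Gamma (2 * Z)) * morita_Gamma i2"
      by (intro dvd_mult2 morita_Gamma_cong[OF odd] n)
    have "?P dvd morita_Gamma (2 * Z) * morita_Gamma i2 - ?a' * (?b' * ?c')"
      using dvd_diff[OF 1 2] unfolding morita_Gamma_duplication_nat[OF i2] by (simp add: algebra_simps)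
    then show "padic_p ^ M dvd morita_Gamma (2 * Z) * morita_Gamma i2 - ?a' * (?b' * ?c')"
      by (rule dvd_trans[rotated]) (simp add: le_imp_power_dvd)
  qed
  moreover have "teich0 2 ^ r * teich0 2 ^ (q - r) = (1 :: 'p padic_int)"
    using rq teich0_power_pred[OF two_neq_0[OF odd]] by (simp add: power_add[symmetric] q_def)
  ultimately show ?thesis by (simp add: mult.assoc[symmetric])
qed

section \<open>Gamma values at rational arguments\<close>

lemma padic_int_of_rat_eqI: "zp z = of_rat r \<Longrightarrow> padic_int_of_rat r = z"
  unfolding padic_int_of_rat_def by (rule the_equality) (auto simp: zp_def eq_fract dest: sym)

lemma Gamma_rat_eq: "zp z = of_rat r \<Longrightarrow> Gamma_rat r = zp (morita_Gamma z)"
  unfolding Gamma_rat_def using padic_int_of_rat_eqI by (auto simp: zp_def)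

lemma zp_rational_exists:
  assumes "\<not> CARD('p) dvd d"
  obtains z :: "'p padic_int" where "of_nat d * z = of_nat a" "zp z = of_rat (of_nat a / of_nat d)"
proof -
  have "\<not> padic_p dvd (of_nat d :: 'p padic_int)" unfolding padic_p_dvd_of_nat_iff by (rule assms)
  then obtain i where i: "of_nat d * i = (1 :: 'p padic_int)" using padic_inverse by blast
  have d: "d \<noteq> 0" using assms by (metis dvd_0_right)
  have z: "of_nat d * (i * of_nat a) = (of_nat a :: 'p padic_int)" using i by (simp add: mult.assoc[symmetric])
  moreover have "zp (i * of_nat a) = of_rat (of_nat a / of_nat d)"
    using arg_cong[OF z, of zp] d by (simp add: zp_mult of_rat_divide field_simps)
  ultimately show ?thesis by (rule that)
qed

lemma pred_not_dvd: "\<not> CARD('p) dvd CARD('p) - 1"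
  using CARD_gt_1[where 'p='p] by (auto dest: dvd_imp_le)

definition gam :: "nat \<Rightarrow> 'p padic" where
  "gam a = Gamma_rat (of_nat a / of_nat (CARD('p) - 1))"

lemma gam_eq:
  assumes "a < CARD('p) - 1"
  shows "gam a = (1 - qp_p) * dwork_component a"
proof -
  obtain y :: "'p padic_int" where y: "of_nat (CARD('p) - 1) * y = of_nat a" "zp y
      = of_rat (of_nat a / of_nat (CARD('p) - 1))"
    using zp_rational_exists[OF pred_not_dvd] by blast
  show ?thesis unfolding gam_def Gamma_rat_eq[OF y(2)] by (rule Gross_Koblitz[OF odd assms y(1), symmetric])
qed

lemma gam_neq_0: "gam a \<noteq> 0"
proof -
  obtain y :: "'p padic_int" where y: "zp y = of_rat (of_nat a / of_nat (CARD('p) - 1))"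
    using zp_rational_exists[OF pred_not_dvd] by blast
  have "morita_Gamma y \<noteq> 0" using morita_Gamma_unit[OF odd, of y] by auto
  then show ?thesis unfolding gam_def Gamma_rat_eq[OF y] by simp
qed

lemma gam_0: "gam 0 = 1"
proof -
  have "zp (0 :: 'p padic_int) = of_rat (of_nat 0 / of_nat (CARD('p) - 1))" by simp
  from Gamma_rat_eq[OF this] show ?thesis unfolding gam_def by (simp add: morita_Gamma_0[OF odd])
qed

text \<open>The arguments on the left have denominator 2 (p - 1); those on the right are multiples
  of 1/(p - 1) and thus within reach of Gauss sums.\<close>

lemma Gamma_rat_duplication:
  assumes r: "r < CARD('p) - 1"
  shows "Gamma_rat (of_nat r / of_nat (2 * (CARD('p) - 1))) * Gamma_rat (of_nat r / of_nat (2 * (CARD('p)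
      - 1)) + 1 / 2) =
    omega (2 :: 'p mod_ring) ^ r * (gam r * gam ((CARD('p) - 1) div 2))"
proof -
  define q where "q = CARD('p) - 1"
  have q0: "q > 0" using CARD_gt_1[where 'p='p] by (simp add: q_def)
  have "\<not> CARD('p) dvd 2" using CARD_ge_3[OF odd] by (auto dest: dvd_imp_le)
  then have 2: "\<not> CARD('p) dvd 2 * q"
    using pred_not_dvd prime_card[where 'a='p] by (simp add: prime_dvd_mult_iff q_def)
  obtain Z :: "'p padic_int" where Z: "of_nat (2 * q) * Z = of_nat r" "zp Z
      = of_rat (of_nat r / of_nat (2 * q))"
    using zp_rational_exists[OF 2] by blast
  obtain i2 :: "'p padic_int" where i2: "of_nat 2 * i2 = of_nat 1" "zp i2 = of_rat (of_nat 1 / of_nat 2)"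
    using zp_rational_exists[OF \<open>\<not> CARD('p) dvd 2\<close>] by blast
  have i2': "2 * i2 = 1" using i2(1) by simp
  have Z': "of_nat (CARD('p) - 1) * (2 * Z) = of_nat r" using Z(1) by (simp add: q_def mult_ac)
  have half: "of_nat (q div 2) / of_nat q = (1 / 2 :: rat)"
  proof -
    have "q = q div 2 * 2" using odd by (simp add: q_def)
    then have "of_nat q = (of_nat (q div 2) * 2 :: rat)" by (metis of_nat_mult of_nat_numeral)
    then show ?thesis using q0 by (simp add: field_simps)
  qed
  have "zp (Z + i2) = of_rat (of_nat r / of_nat (2 * q) + 1 / 2)"
    using Z(2) i2(2) by (simp add: zp_add of_rat_add)
  note G2 = Gamma_rat_eq[OF this]
  have zp2: "zp (2 :: 'p padic_int) = 2" using zp_of_nat[of 2] by simp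
  have "zp (2 * Z) = of_rat (of_nat r / of_nat q)"
    using Z(2) zp2 q0 by (simp add: zp_mult of_rat_divide of_rat_mult)
  then have G3: "gam r = zp (morita_Gamma (2 * Z))" unfolding gam_def q_def by (rule Gamma_rat_eq)
  have "zp i2 = of_rat (of_nat (q div 2) / of_nat q)" unfolding half using i2(2) by simp
  then have G4: "gam (q div 2) = zp (morita_Gamma i2)" unfolding gam_def q_def by (rule Gamma_rat_eq)
  show ?thesis
    unfolding q_def[symmetric] Gamma_rat_eq[OF Z(2)] G2 G3 G4 omega_def
    using morita_Gamma_duplication[OF i2' Z' r] by (simp flip: zp_mult zp_power)
qed

section \<open>Gauss sums\<close>

text \<open>X^n - 1 has at most n < p - 1 roots, so s^n differs from 1 for some nonzero s. Scaling t
  by s multiplies the sum by omega(s)^n, which is not 1.\<close>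

lemma sum_omega_power:
  assumes n: "0 < n" "n < CARD('p) - 1"
  shows "(\<Sum>t\<in>- {0 :: 'p mod_ring}. omega t ^ n) = 0"
proof -
  have "\<exists>s :: 'p mod_ring. s \<noteq> 0 \<and> s ^ n \<noteq> 1"
  proof (rule ccontr)
    assume "\<not> ?thesis"
    then have sub: "- {0 :: 'p mod_ring} \<subseteq> {x. poly (Polynomial.monom 1 n - 1) x = 0}"
      by (auto simp: poly_monom)
    have nz: "Polynomial.monom 1 n - 1 \<noteq> (0 :: 'p mod_ring poly)"
    proof
      assume "Polynomial.monom 1 n - 1 = (0 :: 'p mod_ring poly)"
      then have "poly (Polynomial.monom 1 n - 1) (0 :: 'p mod_ring) = 0" by simp
      then show False using n(1) by (simp add: poly_monom power_0_left)
    qed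
    have "CARD('p) - 1 = card (- {0 :: 'p mod_ring})" by (simp add: Compl_eq_Diff_UNIV card_Diff_subset)
    also have "\<dots> \<le> card {x :: 'p mod_ring. poly (Polynomial.monom 1 n - 1) x = 0}"
      by (rule card_mono[OF _ sub]) simp
    also have "\<dots> \<le> Polynomial.degree (Polynomial.monom 1 n - 1 :: 'p mod_ring poly)"
        by (rule card_poly_roots_bound[OF nz])
    also have "\<dots> \<le> n" by (rule degree_diff_le) (simp_all add: degree_monom_le)
    finally show False using n(2) by simp
  qed
  then obtain s :: "'p mod_ring" where s: "s \<noteq> 0" "s ^ n \<noteq> 1" by blast
  have "(\<Sum>t\<in>- {0 :: 'p mod_ring}. omega t ^ n) = (\<Sum>t\<in>- {0 :: 'p mod_ring}. omega (s * t) ^ n)"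
    by (rule sum_nonzero_scale[OF odd s(1), symmetric])
  also have "\<dots> = omega s ^ n * (\<Sum>t\<in>- {0 :: 'p mod_ring}. omega t ^ n)"
    by (simp add: omega_mult power_mult_distrib sum_distrib_left)
  finally have "(omega s ^ n - 1) * (\<Sum>t\<in>- {0 :: 'p mod_ring}. omega t ^ n) = 0"
      by (simp add: algebra_simps)
  moreover have "omega s ^ n \<noteq> 1" using s(2) by (simp flip: omega_power)
  ultimately show ?thesis by simp
qed

lemma omega_orthogonality:
  assumes "a < CARD('p) - 1" "b < CARD('p) - 1"
  shows "(\<Sum>t\<in>- {0 :: 'p mod_ring}. inverse (omega t) ^ a * omega t ^ b) = (if a
      = b then of_nat (CARD('p) - 1) else 0)"
proof -
  consider "a = b" | "a < b" | "b < a" by linarith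
  then show ?thesis
  proof cases
    case 1
    then have "(\<Sum>t\<in>- {0 :: 'p mod_ring}. inverse (omega t) ^ a * omega t ^ b)
        = (\<Sum>t\<in>- {0 :: 'p mod_ring}. 1)"
      by (intro sum.cong) (auto simp flip: power_mult_distrib)
    then show ?thesis using 1 by (simp add: Compl_eq_Diff_UNIV card_Diff_subset)
  next
    case 2
    have "(\<Sum>t\<in>- {0 :: 'p mod_ring}. inverse (omega t) ^ a * omega t ^ b)
        = (\<Sum>t\<in>- {0 :: 'p mod_ring}. omega t ^ (b - a))"
      using 2 by (intro sum.cong) (auto simp: power_diff field_simps)
    then show ?thesis using 2 sum_omega_power[of "b - a"] assms by simp
  next
    case 3
    have "(\<Sum>t\<in>- {0 :: 'p mod_ring}. inverse (omega t) ^ a * omega t ^ b)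
        = (\<Sum>t\<in>- {0 :: 'p mod_ring}. omega (inverse t) ^ (a - b))"
    proof (rule sum.cong[OF refl])
      fix t :: "'p mod_ring" assume "t \<in> - {0}"
      then have "inverse (omega t) ^ b * omega t ^ b = 1" by (simp flip: power_mult_distrib)
      moreover have "inverse (omega t) ^ a = inverse (omega t) ^ (a - b) * inverse (omega t) ^ b"
        unfolding power_add[symmetric] using 3 by simp
      ultimately show "inverse (omega t) ^ a * omega t ^ b = omega (inverse t) ^ (a - b)"
        by (simp only: omega_inverse mult.assoc mult_1_right)
    qed
    also have "\<dots> = (\<Sum>t\<in>- {0 :: 'p mod_ring}. omega t ^ (a - b))"
        by (rule sum_nonzero_inverse[OF odd])
    finally show ?thesis using 3 sum_omega_power[of "a - b"] assms by simp
  qed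
qed

lemma sum_omega_powers:
  fixes t :: "'p mod_ring"
  assumes "t \<noteq> 0"
  shows "(\<Sum>a<CARD('p) - 1. omega t ^ a) = (if t = 1 then of_nat (CARD('p) - 1) else 0)"
proof (cases "t = 1")
  case False
  then have "omega t \<noteq> 1" by simp
  then show ?thesis using False omega_power_pred[OF assms] geometric_sum[of "omega t" "CARD('p) - 1"] by simp
qed simp

section \<open>Gauss sums and their relation to Jacobi sums\<close>

definition gauss_sum :: "nat \<Rightarrow> 'p padic alg_closure" where
  "gauss_sum a = (\<Sum>t\<in>- {0}. to_ac (inverse (omega t) ^ a) * dwork_char t)"

text \<open>Orthogonality picks the a-th component out of \<open>dwork_char_eq\<close> with the
  factor p - 1, which \<open>gam_eq\<close> converts into -Gamma_p(a/(p-1)).\<close>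

lemma gauss_sum_eq:
  assumes a: "a < CARD('p) - 1"
  shows "gauss_sum a = - to_ac (gam a) * dwork_pi ^ a"
proof -
  let ?q = "CARD('p) - 1" and ?pi = "dwork_pi :: 'p padic alg_closure"
  have "gauss_sum a = (\<Sum>t\<in>- {0 :: 'p mod_ring}. \<Sum>b<?q. to_ac (inverse (omega t) ^ a
      * omega t ^ b) * (to_ac (dwork_component b) * ?pi ^ b))"
    unfolding gauss_sum_def
  proof (rule sum.cong[OF refl])
    fix t :: "'p mod_ring" assume "t \<in> - {0}"
    then have "t \<noteq> 0" by simp
    show "to_ac (inverse (omega t) ^ a) * dwork_char t =
      (\<Sum>b<?q. to_ac (inverse (omega t) ^ a * omega t ^ b) * (to_ac (dwork_component b) * ?pi ^ b))"
      unfolding dwork_char_eq[OF odd \<open>t \<noteq> 0\<close>] sum_distrib_left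
          by (simp only: to_ac_mult mult_ac)
  qed
  also have "\<dots> = (\<Sum>b<?q. \<Sum>t\<in>- {0 :: 'p mod_ring}. to_ac (inverse (omega t) ^ a
      * omega t ^ b) * (to_ac (dwork_component b) * ?pi ^ b))"
    by (rule sum.swap)
  also have "\<dots> = (\<Sum>b<?q. if b = a then to_ac (of_nat ?q) * (to_ac (dwork_component a)
      * ?pi ^ a) else 0)"
  proof (rule sum.cong[OF refl])
    fix b assume "b \<in> {..<?q}"
    then have "(\<Sum>t\<in>- {0 :: 'p mod_ring}. inverse (omega t) ^ a * omega t ^ b) = (if a
        = b then of_nat ?q else 0)"
      by (intro omega_orthogonality a) simp
    then show "(\<Sum>t\<in>- {0 :: 'p mod_ring}. to_ac (inverse (omega t) ^ a * omega t ^ b)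
        * (to_ac (dwork_component b) * ?pi ^ b)) =
        (if b = a then to_ac (of_nat ?q) * (to_ac (dwork_component a) * ?pi ^ a) else 0)"
      unfolding sum_distrib_right[symmetric] to_ac_sum[symmetric] by auto
  qed
  also have "\<dots> = to_ac (of_nat ?q) * (to_ac (dwork_component a) * ?pi ^ a)" using a by simp
  also have "\<dots> = to_ac (of_nat ?q * dwork_component a) * ?pi ^ a" by (simp only: to_ac_mult mult.assoc)
  also have "of_nat ?q * dwork_component a = - gam a"
    unfolding gam_eq[OF a] using CARD_gt_1[where 'p='p] by (simp add: of_nat_diff algebra_simps)
  finally show ?thesis by simp
qed

lemma inverse_omega_power_half: "inverse (omega t) ^ ((CARD('p) - 1) div 2)
    = of_int (quad_char (t :: 'p mod_ring))"
  using of_int_quad_char[OF odd, of "inverse t"] by (simp add: omega_inverse quad_char_inverse[OF odd])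

lemma gauss_sum_half: "gauss_sum ((CARD('p) - 1) div 2) = (\<Sum>t\<in>- {0}. of_int (quad_char t)
    * dwork_char t)"
  unfolding gauss_sum_def inverse_omega_power_half by simp

text \<open>For c = 0 both sides vanish; this covers 1 + u = 0 and 1 + u + v = 0 in the Jacobi
  sums.\<close>

lemma sum_quad_char_dwork_char:
  "(\<Sum>t\<in>- {0}. of_int (quad_char t) * dwork_char (t * c))
      = of_int (quad_char c) * gauss_sum ((CARD('p) - 1) div 2)"
proof (cases "c = 0")
  case True
  have "(\<Sum>t\<in>- {0 :: 'p mod_ring}. quad_char t) = 0"
      by (simp add: sum_nonzero[OF odd] sum_quad_char[OF odd])
  then have "(\<Sum>t\<in>- {0 :: 'p mod_ring}. of_int (quad_char t) :: 'p padic alg_closure) = 0"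
    by (simp flip: of_int_sum)
  then show ?thesis using True by (simp add: dwork_char_0[OF odd])
next
  case False
  have "(\<Sum>t\<in>- {0 :: 'p mod_ring}. of_int (quad_char t) * dwork_char t)
      = (\<Sum>t\<in>- {0}. of_int (quad_char (c * t)) * dwork_char (c * t))"
    by (rule sum_nonzero_scale[OF odd False, symmetric])
  also have "\<dots> = of_int (quad_char c) * (\<Sum>t\<in>- {0}. of_int (quad_char t) * dwork_char (t * c))"
    by (simp add: quad_char_mult[OF odd] sum_distrib_left mult_ac)
  finally have "gauss_sum ((CARD('p) - 1) div 2) = of_int (quad_char c)
      * (\<Sum>t\<in>- {0}. of_int (quad_char t) * dwork_char (t * c))"
    unfolding gauss_sum_half .
  then have "of_int (quad_char c) * gauss_sum ((CARD('p) - 1) div 2) =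
     of_int (quad_char c * quad_char c) * (\<Sum>t\<in>- {0}. of_int (quad_char t) * dwork_char (t * c))"
    by (simp add: mult.assoc)
  then show ?thesis by (simp add: quad_char_square[OF odd False])
qed

text \<open>The exponents r and b add up to (p - 1)/2 modulo p - 1, so the product of the two
  characters is the quadratic one. The carry e is harmless here but becomes a power of -p in
  \<open>gauss_sum_pi_power\<close>.\<close>

lemma inverse_omega_power_reflect:
  fixes s :: "'p mod_ring"
  assumes "s \<noteq> 0" "r + b = (CARD('p) - 1) div 2 + e * (CARD('p) - 1)"
  shows "inverse (omega s) ^ r = of_int (quad_char s) * omega s ^ b"
proof -
  have "inverse (omega s) ^ (r + b) = inverse (omega s) ^ ((CARD('p) - 1) div 2)
      * inverse (omega s ^ (CARD('p) - 1)) ^ e"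
    unfolding assms(2) by (simp only: power_add power_mult[symmetric] power_inverse mult.commute)
  also have "\<dots> = of_int (quad_char s)" unfolding inverse_omega_power_half omega_power_pred[OF
      assms(1)] by simp
  finally have "inverse (omega s) ^ r * inverse (omega s) ^ b * omega s ^ b
      = of_int (quad_char s) * omega s ^ b"
    by (simp add: power_add)
  moreover have "inverse (omega s) ^ b * omega s ^ b = 1" using assms(1) by (simp flip: power_mult_distrib)
  ultimately show ?thesis by (simp add: mult.assoc)
qed

lemma gauss_sum_pi_power:
  assumes "r + b = (CARD('p) - 1) div 2 + e * (CARD('p) - 1)"
  shows "dwork_pi ^ (r + b) = to_ac ((- qp_p) ^ e) * (dwork_pi :: 'p padic alg_closure) ^ ((CARD('p)
      - 1) div 2)"
proof -
  let ?pi = "dwork_pi :: 'p padic alg_closure"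
  have "?pi ^ (e * (CARD('p) - 1)) = (?pi ^ (CARD('p) - 1)) ^ e"
    unfolding power_mult[symmetric] by (subst mult.commute) (rule refl)
  also have "\<dots> = to_ac ((- qp_p) ^ e)" unfolding dwork_pi
      by (simp only: to_ac_power to_ac_minus to_ac_of_nat)
  finally show ?thesis unfolding assms power_add by (simp only: mult.commute)
qed

lemma half_less: "(CARD('p) - 1) div 2 < CARD('p) - 1"
  using CARD_gt_1[where 'p='p] by simp

text \<open>The substitution s = t u factors the product of two Gauss sums into a Jacobi sum and the
  quadratic Gauss sum. By pi^(r+a) = (-p)^e pi^h with h = (p - 1)/2 the powers of pi cancel. The
  sign arises because two Gauss sums on one side face one on the other.\<close>

lemma gam_product_2:
  assumes ra: "r < CARD('p) - 1" "a < CARD('p) - 1" and e: "r + a = (CARD('p) - 1) div 2 + e * (CARD('p) - 1)"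
  shows "(- qp_p) ^ e * gam r * gam a =
    - (\<Sum>u\<in>- {0}. of_int (quad_char u * quad_char (1 + u)) * omega u ^ a) * gam ((CARD('p) - 1) div 2)"
proof -
  let ?h = "(CARD('p) - 1) div 2" and ?N = "- {0 :: 'p mod_ring}"
  let ?J = "\<Sum>u\<in>?N. of_int (quad_char u * quad_char (1 + u)) * omega u ^ a"
  have "gauss_sum r * gauss_sum a = (\<Sum>t\<in>?N. \<Sum>s\<in>?N. to_ac (inverse (omega s) ^ r)
      * dwork_char s * (to_ac (inverse (omega t) ^ a) * dwork_char t))"
    unfolding gauss_sum_def sum_product by (rule sum.swap)
  also have "\<dots> = (\<Sum>t\<in>?N. \<Sum>u\<in>?N. of_int (quad_char u) * to_ac (omega u ^ a)
      * (of_int (quad_char t) * dwork_char (t * (1 + u))))"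
  proof (rule sum.cong[OF refl])
    fix t assume "t \<in> ?N"
    then have t: "t \<noteq> 0" by simp
    have "(\<Sum>s\<in>?N. to_ac (inverse (omega s) ^ r) * dwork_char s * (to_ac (inverse (omega t) ^ a)
        * dwork_char t)) =
      (\<Sum>u\<in>?N. to_ac (inverse (omega (t * u)) ^ r) * dwork_char (t * u)
          * (to_ac (inverse (omega t) ^ a) * dwork_char t))"
      by (rule sum_nonzero_scale[OF odd t, symmetric])
    also have "\<dots> = (\<Sum>u\<in>?N. of_int (quad_char u) * to_ac (omega u ^ a)
        * (of_int (quad_char t) * dwork_char (t * (1 + u))))"
    proof (rule sum.cong[OF refl])
      fix u assume "u \<in> ?N"
      then have u: "u \<noteq> 0" by simp
      then have "t * u \<noteq> 0" using t by simp
      note refl = inverse_omega_power_reflect[OF this e]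
      have "omega t ^ a * inverse (omega t) ^ a = 1" using t by (simp flip: power_mult_distrib)
      then have "inverse (omega (t * u)) ^ r * inverse (omega t) ^ a
          = of_int (quad_char u) * omega u ^ a * of_int (quad_char t)"
      proof -
        assume *: "omega t ^ a * inverse (omega t) ^ a = 1"
        have "inverse (omega (t * u)) ^ r * inverse (omega t) ^ a =
            of_int (quad_char u) * omega u ^ a * of_int (quad_char t) * (omega t ^ a * inverse (omega t) ^ a)"
          unfolding refl unfolding quad_char_mult[OF odd] omega_mult power_mult_distrib of_int_mult
          by (simp only: mult_ac)
        then show ?thesis unfolding * by (simp only: mult_1_right)
      qed
      then have "to_ac (inverse (omega (t * u)) ^ r) * to_ac (inverse (omega t) ^ a)
          = to_ac (of_int (quad_char u) * omega u ^ a * of_int (quad_char t))"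
        by (simp only: to_ac_mult[symmetric])
      moreover have "t * (1 + u) = t * u + t" by (simp add: algebra_simps)
      then have "dwork_char (t * (1 + u)) = dwork_char (t * u) * dwork_char t"
          by (simp only: dwork_char_add[OF odd])
      ultimately show "to_ac (inverse (omega (t * u)) ^ r) * dwork_char (t * u)
          * (to_ac (inverse (omega t) ^ a) * dwork_char t) =
        of_int (quad_char u) * to_ac (omega u ^ a) * (of_int (quad_char t) * dwork_char (t * (1 + u)))"
        by (simp only: to_ac_mult to_ac_of_int mult_ac)
    qed
    finally show "(\<Sum>s\<in>?N. to_ac (inverse (omega s) ^ r) * dwork_char s
        * (to_ac (inverse (omega t) ^ a) * dwork_char t)) =
      (\<Sum>u\<in>?N. of_int (quad_char u) * to_ac (omega u ^ a) * (of_int (quad_char t) * dwork_char (t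
          * (1 + u))))" .
  qed
  also have "\<dots> = (\<Sum>u\<in>?N. \<Sum>t\<in>?N. of_int (quad_char u) * to_ac (omega u ^ a)
      * (of_int (quad_char t) * dwork_char (t * (1 + u))))"
    by (rule sum.swap)
  also have "\<dots> = (\<Sum>u\<in>?N. of_int (quad_char u) * to_ac (omega u ^ a) * (of_int (quad_char (1
      + u)) * gauss_sum ?h))"
    unfolding sum_distrib_left[symmetric] sum_quad_char_dwork_char ..
  also have "\<dots> = to_ac ?J * gauss_sum ?h"
    unfolding to_ac_sum sum_distrib_right by (simp add: mult_ac)
  finally have "to_ac (gam r * gam a) * dwork_pi ^ (r + a) = - to_ac (?J * gam ?h) * dwork_pi ^ ?h"
    unfolding gauss_sum_eq[OF ra(1)] gauss_sum_eq[OF ra(2)] gauss_sum_eq[OF half_less]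
    by (simp add: power_add mult_ac)
  then have "to_ac ((- qp_p) ^ e * gam r * gam a) * dwork_pi ^ ?h = to_ac (- ?J * gam ?h) * dwork_pi ^ ?h"
    unfolding gauss_sum_pi_power[OF e] by (simp add: mult_ac)
  then have "to_ac ((- qp_p) ^ e * gam r * gam a) = to_ac (- ?J * gam ?h)"
    by (simp only: mult_right_cancel[OF power_not_zero[OF dwork_pi_neq_0]])
  then show ?thesis by (simp only: to_ac_eq_iff)
qed

text \<open>The same for three Gauss sums, scaling two of the variables by the third. Three Gauss
  sums face one, so the signs cancel.\<close>

lemma gam_product_3:
  assumes ra: "r < CARD('p) - 1" "a < CARD('p) - 1" and e: "r + 2 * a
      = (CARD('p) - 1) div 2 + e * (CARD('p) - 1)"
  shows "(- qp_p) ^ e * gam r * gam a ^ 2 =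
    (\<Sum>u\<in>- {0}. \<Sum>v\<in>- {0}. of_int (quad_char (1 + u + v)) * inverse (omega (u * v)) ^ a)
        * gam ((CARD('p) - 1) div 2)"
proof -
  let ?h = "(CARD('p) - 1) div 2" and ?N = "- {0 :: 'p mod_ring}"
  let ?J = "\<Sum>u\<in>?N. \<Sum>v\<in>?N. of_int (quad_char (1 + u + v)) * inverse (omega (u * v)) ^ a"
  let ?g = "\<lambda>t. to_ac (inverse (omega t) ^ a) * dwork_char t"
  have "gauss_sum r * (gauss_sum a * gauss_sum a) = (\<Sum>s\<in>?N. to_ac (inverse (omega s) ^ r)
      * dwork_char s * (gauss_sum a * gauss_sum a))"
    by (simp only: gauss_sum_def[of r] sum_distrib_right)
  also have "\<dots> = (\<Sum>s\<in>?N. to_ac (inverse (omega s) ^ r) * dwork_char s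
      * ((\<Sum>u\<in>?N. ?g (s * u)) * (\<Sum>v\<in>?N. ?g (s * v))))"
  proof (rule sum.cong[OF refl])
    fix s assume "s \<in> ?N"
    then have "s \<noteq> 0" by simp
    then have "gauss_sum a = (\<Sum>u\<in>?N. ?g (s * u))"
      unfolding gauss_sum_def by (rule sum_nonzero_scale[OF odd, symmetric])
    then show "to_ac (inverse (omega s) ^ r) * dwork_char s * (gauss_sum a * gauss_sum a) =
        to_ac (inverse (omega s) ^ r) * dwork_char s * ((\<Sum>u\<in>?N. ?g (s * u))
            * (\<Sum>v\<in>?N. ?g (s * v)))"
      by (simp only:)
  qed
  also have "\<dots> = (\<Sum>s\<in>?N. \<Sum>u\<in>?N. \<Sum>v\<in>?N. to_ac (inverse (omega (u * v)) ^ a)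
      * (of_int (quad_char s) * dwork_char (s * (1 + u + v))))"
  proof (rule sum.cong[OF refl])
    fix s assume "s \<in> ?N"
    then have s: "s \<noteq> 0" by simp
    have "to_ac (inverse (omega s) ^ r) * dwork_char s * (?g (s * u) * ?g (s * v)) =
        to_ac (inverse (omega (u * v)) ^ a) * (of_int (quad_char s) * dwork_char (s * (1 + u + v)))" for u v
    proof -
      have "s * (1 + u + v) = s + s * u + s * v" by (simp add: algebra_simps)
      then have E: "dwork_char (s * (1 + u + v)) = dwork_char s * dwork_char (s * u) * dwork_char (s * v)"
        by (simp only: dwork_char_add[OF odd])
      have "omega s ^ a * inverse (omega s) ^ a = 1" using s by (simp flip: power_mult_distrib)
      moreover have "inverse (omega s) ^ r * (inverse (omega (s * u)) ^ a * inverse (omega (s * v)) ^ a) =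
          inverse (omega (u * v)) ^ a * of_int (quad_char s) * ((omega s ^ a * inverse (omega s) ^ a)
              * (omega s ^ a * inverse (omega s) ^ a))"
        unfolding inverse_omega_power_reflect[OF s e] omega_mult inverse_mult_distrib power_mult_distrib
            mult_2 power_add
        by (simp only: mult_ac)
      ultimately have "inverse (omega s) ^ r * (inverse (omega (s * u)) ^ a * inverse (omega (s * v)) ^ a)
          = inverse (omega (u * v)) ^ a * of_int (quad_char s)"
        by (simp only: mult_1_right)
      then have "to_ac (inverse (omega s) ^ r) * (to_ac (inverse (omega (s * u)) ^ a)
          * to_ac (inverse (omega (s * v)) ^ a)) = to_ac (inverse (omega (u * v)) ^ a) * of_int (quad_char s)"
        by (simp only: to_ac_mult[symmetric]) simp
      then have "(to_ac (inverse (omega s) ^ r) * (to_ac (inverse (omega (s * u)) ^ a)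
          * to_ac (inverse (omega (s * v)) ^ a))) * (dwork_char s * dwork_char (s * u) * dwork_char (s * v))
         = to_ac (inverse (omega (u * v)) ^ a) * (of_int (quad_char s) * dwork_char (s * (1 + u + v)))"
        unfolding E by (simp only: mult.assoc)
      then show ?thesis by (simp only: mult_ac)
    qed
    then show "to_ac (inverse (omega s) ^ r) * dwork_char s * ((\<Sum>u\<in>?N. ?g (s * u))
        * (\<Sum>v\<in>?N. ?g (s * v))) =
      (\<Sum>u\<in>?N. \<Sum>v\<in>?N. to_ac (inverse (omega (u * v)) ^ a) * (of_int (quad_char s)
          * dwork_char (s * (1 + u + v))))"
      unfolding sum_product unfolding sum_distrib_left by (simp only:)
  qed
  also have "\<dots> = (\<Sum>u\<in>?N. \<Sum>s\<in>?N. \<Sum>v\<in>?N. to_ac (inverse (omega (u * v)) ^ a)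
      * (of_int (quad_char s) * dwork_char (s * (1 + u + v))))"
    by (rule sum.swap)
  also have "\<dots> = (\<Sum>u\<in>?N. \<Sum>v\<in>?N. \<Sum>s\<in>?N. to_ac (inverse (omega (u * v)) ^ a)
      * (of_int (quad_char s) * dwork_char (s * (1 + u + v))))"
    by (rule sum.cong[OF refl], rule sum.swap)
  also have "\<dots> = (\<Sum>u\<in>?N. \<Sum>v\<in>?N. to_ac (inverse (omega (u * v)) ^ a)
      * (of_int (quad_char (1 + u + v)) * gauss_sum ?h))"
    unfolding sum_distrib_left[symmetric] sum_quad_char_dwork_char ..
  also have "\<dots> = to_ac ?J * gauss_sum ?h"
    unfolding to_ac_sum sum_distrib_right by (simp add: mult_ac)
  finally have "to_ac (gam r * (gam a * gam a)) * dwork_pi ^ (r + 2 * a) = to_ac (?J * gam ?h) * dwork_pi ^ ?h"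
    unfolding gauss_sum_eq[OF ra(1)] gauss_sum_eq[OF ra(2)] gauss_sum_eq[OF half_less]
    by (simp add: power_add mult_2 mult_2_right mult_ac)
  then have "to_ac ((- qp_p) ^ e * gam r * gam a ^ 2) * dwork_pi ^ ?h = to_ac (?J * gam ?h) * dwork_pi ^ ?h"
    unfolding gauss_sum_pi_power[OF e] by (simp add: power2_eq_square mult_ac)
  then have "to_ac ((- qp_p) ^ e * gam r * gam a ^ 2) = to_ac (?J * gam ?h)"
    by (simp only: mult_right_cancel[OF power_not_zero[OF dwork_pi_neq_0]])
  then show ?thesis by (simp only: to_ac_eq_iff)
qed

end

section \<open>The two hypergeometric functions as character sums\<close>

lemma floor_frac_minus_nat:
  fixes z :: rat
  assumes "0 \<le> z" "z < 1"
  shows "\<lfloor>z - of_nat n\<rfloor> = - int n" "frac (z - of_nat n) = z"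
proof -
  show "\<lfloor>z - of_nat n\<rfloor> = - int n" using assms by (simp add: floor_eq_iff)
  then show "frac (z - of_nat n) = z" by (simp add: frac_def)
qed

lemma sum_nonzero_delta:
  fixes f :: "'a :: {finite, zero} \<Rightarrow> 'b :: comm_monoid_add"
  assumes "c \<noteq> 0"
  shows "(\<Sum>w\<in>- {0}. if w = c then f w else 0) = f c"
  using assms by (subst sum.delta) simp_all

context
  assumes odd: "odd CARD('p :: prime_card)"
begin

lemma of_nat_pred_neq_0: "(of_nat (CARD('p) - 1) :: 'a :: field_char_0) \<noteq> 0"
  using CARD_gt_1[where 'p='p] by simp

lemma omega_minus_1: "omega (- 1 :: 'p mod_ring) = - 1"
proof -
  have "teich0 (- 1 :: 'p mod_ring) = - 1"
    by (rule teich0_eqI[of _ "- 1"]) (simp_all add: odd)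
  then show ?thesis by (simp add: omega_def zp_uminus)
qed

section \<open>The function with parameters 1/2\<close>

definition jacobi_quad :: "nat \<Rightarrow> 'p padic" where
  "jacobi_quad a = (\<Sum>u\<in>- {0 :: 'p mod_ring}. of_int (quad_char u * quad_char (1 + u)) * omega u ^ a)"

text \<open>Writing 1/2 - a/(p-1) as r/(p-1) - e with 0 <= r < p - 1, the floors produce exactly the
  power (-p)^e that \<open>gam_product_2\<close> needs. The \<open>let\<close> and the terms
  \<open>- 0\<close> repeat the shape of the factor in \<open>nGn_def\<close>.\<close>

lemma factor_3G3:
  assumes a: "a < CARD('p) - 1"
  shows "(let q = of_nat a / of_nat (CARD('p) - 1) in
     (- of_nat CARD('p)) powi (- \<lfloor>frac (1 / 2) - q\<rfloor> - \<lfloor>frac (- 0) + q\<rfloor>) *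
     (Gamma_rat (frac (1 / 2 - q)) / Gamma_rat (frac (1 / 2))) *
     (Gamma_rat (frac (- 0 + q)) / Gamma_rat (frac (- 0)))) = - jacobi_quad a"
proof -
  define q h where "q = CARD('p) - 1" and "h = q div 2"
  have aq: "a < q" using a by (simp add: q_def)
  have "even q" using odd by (simp add: q_def)
  then have h2: "q = h + h" unfolding h_def by presburger
  have half: "(1 / 2 :: rat) = of_nat h / of_nat q"
    using arg_cong[OF h2, of "of_nat :: nat \<Rightarrow> rat"] aq by (simp add: field_simps)
  define e where "e = (if a \<le> h then 0 else 1 :: nat)"
  define r where "r = h + e * q - a"
  have ra: "r + a = h + e * q" and rq: "r < q" using aq h2 by (auto simp: r_def e_def)
  have "of_nat r + of_nat a = (of_nat h + of_nat e * of_nat q :: rat)"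
      using arg_cong[OF ra, of "of_nat :: nat \<Rightarrow> rat"] by simp
  then have r: "(of_nat r :: rat) = of_nat h - of_nat a + of_nat e * of_nat q" by simp
  have q0: "(of_nat q :: rat) > 0" using aq by simp
  have 1: "1 / 2 - of_nat a / of_nat q = (of_nat r / of_nat q :: rat) - of_nat e"
    unfolding half r using q0 by (simp add: field_simps)
  have r1: "0 \<le> (of_nat r / of_nat q :: rat)" "(of_nat r / of_nat q :: rat) < 1" using rq q0 by simp_all
  have a1: "0 \<le> (of_nat a / of_nat q :: rat)" "(of_nat a / of_nat q :: rat) < 1" using aq q0 by simp_all
  note fr = floor_frac_minus_nat[OF r1, of e, folded 1] floor_frac_minus_nat[OF a1, of 0]
  have frac: "frac (1 / 2 :: rat) = 1 / 2" "frac (- 0 :: rat) = 0" by (simp_all add: frac_eq)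
  have G: "Gamma_rat (of_nat r / of_nat q) = (gam r :: 'p padic)" "Gamma_rat (of_nat a / of_nat q)
      = (gam a :: 'p padic)"
    "Gamma_rat (1 / 2) = (gam h :: 'p padic)" "Gamma_rat 0 = (gam 0 :: 'p padic)"
    unfolding gam_def[OF odd] q_def[symmetric] half by simp_all
  have "(- qp_p) ^ e * gam r * gam a = - jacobi_quad a * gam h"
    using gam_product_2[OF odd rq[unfolded q_def] a ra[unfolded h_def q_def]]
        unfolding jacobi_quad_def h_def q_def .
  moreover have "gam h \<noteq> (0 :: 'p padic)" "gam 0 = (1 :: 'p padic)"
      using gam_neq_0[OF odd] gam_0[OF odd] by auto
  moreover have "- \<lfloor>(1 / 2 :: rat) - of_nat a / of_nat q\<rfloor> - \<lfloor>0
      + of_nat a / of_nat q :: rat\<rfloor> = int e"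
    using fr by simp
  ultimately show ?thesis
    unfolding Let_def q_def[symmetric] frac using fr by (simp add: G field_simps)
qed

text \<open>The cube of the Jacobi sum is a triple sum, and (-1)^(3a) = omega(-1)^a joins the
  characters to omega(-xuvw)^a. Summation over a leaves only -xuvw = 1, that is, w = k/(uv).\<close>

lemma nGn_3G3:
  fixes x :: "'p mod_ring"
  assumes x: "x \<noteq> 0"
  defines "k \<equiv> - 1 / x"
  shows "nGn [1/2, 1/2, 1/2] [0, 0, 0] (1 / x) = of_int (quad_char k *
    (\<Sum>u\<in>- {0}. \<Sum>v\<in>- {0}. quad_char (1 + u) * quad_char (1 + v) * quad_char (1 + k / (u
        * v))))"
proof -
  let ?q = "CARD('p) - 1" and ?N = "- {0 :: 'p mod_ring}"
  let ?c = "\<lambda>u :: 'p mod_ring. quad_char u * quad_char (1 + u)"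
  have set: "{0..CARD('p) - 2} = {..<?q}" using CARD_ge_3[OF odd] by auto
  have k: "k \<noteq> 0" using x by (simp add: k_def)
  have q0: "(of_nat ?q :: 'p padic) \<noteq> 0" by (rule of_nat_pred_neq_0)
  have "nGn [1/2, 1/2, 1/2] [0, 0, 0] (1 / x) =
      - 1 / of_nat ?q * (\<Sum>a<?q. (- 1) ^ (a * 3) * teichmueller_bar_power a (1 / x)
          * (- jacobi_quad a) ^ 3)"
    unfolding nGn_def set
  proof (intro arg_cong[where f="\<lambda>y. - 1 / of_nat ?q * y"] sum.cong refl)
    fix a assume "a \<in> {..<?q}"
    then have a: "a < ?q" by simp
    show "(- 1) ^ (a * length [1/2, 1/2, 1/2 :: rat]) * teichmueller_bar_power a (1 / x) *
        (\<Prod>k<length [1/2, 1/2, 1/2 :: rat]. let q = of_nat a / of_nat (CARD('p) - 1) in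
           (- of_nat CARD('p)) powi (- \<lfloor>frac ([1/2, 1/2, 1/2] ! k) - q\<rfloor>
               - \<lfloor>frac (- ([0, 0, 0] ! k)) + q\<rfloor>) *
           (Gamma_rat (frac ([1/2, 1/2, 1/2] ! k - q)) / Gamma_rat (frac ([1/2, 1/2, 1/2] ! k))) *
           (Gamma_rat (frac (- ([0, 0, 0] ! k) + q)) / Gamma_rat (frac (- ([0, 0, 0] ! k)))))
        = (- 1) ^ (a * 3) * teichmueller_bar_power a (1 / x) * (- jacobi_quad a) ^ 3"
    proof -
      have len: "length [1/2, 1/2, 1/2 :: rat] = Suc (Suc (Suc 0))" by simp
      have three: "(- jacobi_quad a) ^ 3 = - jacobi_quad a * - jacobi_quad a * - jacobi_quad a"
          by (simp add: power3_eq_cube)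
      show ?thesis
        unfolding len prod.lessThan_Suc lessThan_0 prod.empty nth_Cons_0 nth_Cons_Suc factor_3G3[OF a] three
        by (simp add: numeral_3_eq_3)
    qed
  qed
  also have "(\<Sum>a<?q. (- 1) ^ (a * 3) * teichmueller_bar_power a (1 / x) * (- jacobi_quad a) ^ 3) =
      - (\<Sum>a<?q. \<Sum>u\<in>?N. \<Sum>v\<in>?N. \<Sum>w\<in>?N. of_int (?c u * ?c v * ?c w)
          * omega (- x * u * v * w) ^ a)"
    unfolding sum_negf[where A="{..<?q}", symmetric]
  proof (rule sum.cong[OF refl])
    fix a
    have "(- 1) ^ (a * 3) = omega (- 1 :: 'p mod_ring) ^ a"
      unfolding omega_minus_1 by (simp add: mult.commute[of a] power_mult)
    moreover have "teichmueller_bar_power a (1 / x) = omega x ^ a"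
      using x by (simp add: teichmueller_bar_power_eq omega_inverse divide_inverse)
    ultimately have "(- 1) ^ (a * 3) * teichmueller_bar_power a (1 / x) * (- jacobi_quad a) ^ 3 =
       - (omega (- x) ^ a * (jacobi_quad a * jacobi_quad a * jacobi_quad a))"
      using omega_mult[of "- 1" x] by (simp add: power3_eq_cube power_mult_distrib[symmetric])
    also have "omega (- x) ^ a * (jacobi_quad a * jacobi_quad a * jacobi_quad a)
        = (\<Sum>u\<in>?N. \<Sum>v\<in>?N. \<Sum>w\<in>?N. of_int (?c u * ?c v * ?c w) * omega (- x * u * v
        * w) ^ a)"
    proof -
      have "omega (- x * u * v * w) ^ a = omega (- x) ^ a * (omega u ^ a * omega v ^ a * omega w ^ a)" for u v w
        by (simp only: omega_mult power_mult_distrib mult.assoc)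
      then have eq: "of_int (?c u * ?c v * ?c w) * omega (- x * u * v * w) ^ a =
         omega (- x) ^ a * (((of_int (?c u) * omega u ^ a) * (of_int (?c v) * omega v ^ a))
             * (of_int (?c w) * omega w ^ a))" for u v w
        by (simp only: of_int_mult mult_ac)
      have "jacobi_quad a * jacobi_quad a * jacobi_quad a = (\<Sum>u\<in>?N. \<Sum>v\<in>?N.
          \<Sum>w\<in>?N. ((of_int (?c u) * omega u ^ a) * (of_int (?c v) * omega v ^ a)) * (of_int (?c w)
          * omega w ^ a))"
        unfolding jacobi_quad_def sum_product unfolding sum_distrib_right sum_distrib_left
        by (rule sum.cong[OF refl], rule sum.swap)
      then show ?thesis unfolding eq by (simp only: sum_distrib_left)
    qed
    finally show "(- 1) ^ (a * 3) * teichmueller_bar_power a (1 / x) * (- jacobi_quad a) ^ 3 =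
      - (\<Sum>u\<in>?N. \<Sum>v\<in>?N. \<Sum>w\<in>?N. of_int (?c u * ?c v * ?c w) * omega (- x * u * v
          * w) ^ a)" .
  qed
  also have "(\<Sum>a<?q. \<Sum>u\<in>?N. \<Sum>v\<in>?N. \<Sum>w\<in>?N. of_int (?c u * ?c v * ?c w)
      * omega (- x * u * v * w) ^ a) =
      (\<Sum>u\<in>?N. \<Sum>a<?q. \<Sum>v\<in>?N. \<Sum>w\<in>?N. of_int (?c u * ?c v * ?c w) * omega (- x
          * u * v * w) ^ a)"
    by (rule sum.swap)
  also have "\<dots> = (\<Sum>u\<in>?N. \<Sum>v\<in>?N. \<Sum>a<?q. \<Sum>w\<in>?N. of_int (?c u * ?c v
      * ?c w) * omega (- x * u * v * w) ^ a)"
    by (rule sum.cong[OF refl], rule sum.swap)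
  also have "\<dots> = (\<Sum>u\<in>?N. \<Sum>v\<in>?N. \<Sum>w\<in>?N. \<Sum>a<?q. of_int (?c u * ?c v
      * ?c w) * omega (- x * u * v * w) ^ a)"
    by (rule sum.cong[OF refl], rule sum.cong[OF refl], rule sum.swap)
  also have "\<dots> = (\<Sum>u\<in>?N. \<Sum>v\<in>?N. of_nat ?q * of_int (quad_char k * (quad_char (1
      + u) * quad_char (1 + v) * quad_char (1 + k / (u * v)))))"
  proof (intro sum.cong refl)
    fix u v assume "u \<in> ?N" "v \<in> ?N"
    then have uv: "u \<noteq> 0" "v \<noteq> 0" by simp_all
    have "(\<Sum>w\<in>?N. \<Sum>a<?q. of_int (?c u * ?c v * ?c w) * omega (- x * u * v * w) ^ a) =
        (\<Sum>w\<in>?N. if w = k / (u * v) then of_nat ?q * of_int (?c u * ?c v * ?c w) else 0)"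
    proof (rule sum.cong[OF refl])
      fix w assume "w \<in> ?N"
      then have nz: "- x * u * v * w \<noteq> 0" using x uv by simp
      have "- x * u * v * w = 1 \<longleftrightarrow> w * (u * v) = k"
      proof -
        have "- x * u * v * w = 1 \<longleftrightarrow> (w * (u * v)) * x = - 1"
            by (auto simp: mult_ac minus_equation_iff)
        also have "- 1 = k * x" using x by (simp add: k_def)
        also have "(w * (u * v)) * x = k * x \<longleftrightarrow> w * (u * v) = k"
            by (rule mult_right_cancel[OF x])
        finally show ?thesis .
      qed
      also have "\<dots> \<longleftrightarrow> w = k / (u * v)" using uv by (simp add: nonzero_eq_divide_eq)
      finally have iff: "- x * u * v * w = 1 \<longleftrightarrow> w = k / (u * v)" .
      show "(\<Sum>a<?q. of_int (?c u * ?c v * ?c w) * omega (- x * u * v * w) ^ a) =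
        (if w = k / (u * v) then of_nat ?q * of_int (?c u * ?c v * ?c w) else 0)"
        unfolding sum_distrib_left[symmetric] sum_omega_powers[OF odd nz] iff by simp
    qed
    also have "\<dots> = of_nat ?q * of_int (?c u * ?c v * ?c (k / (u * v)))"
      using k uv by (intro sum_nonzero_delta) simp
    also have "?c u * ?c v * ?c (k / (u * v)) = quad_char k * (quad_char (1 + u) * quad_char (1 + v)
        * quad_char (1 + k / (u * v)))"
    proof -
      have "?c u * ?c v * ?c (k / (u * v)) = (quad_char u * quad_char u) * (quad_char v * quad_char v) *
          (quad_char k * (quad_char (1 + u) * quad_char (1 + v) * quad_char (1 + k / (u * v))))"
        unfolding quad_char_divide[OF odd] quad_char_mult[OF odd] by (simp only: mult_ac)
      then show ?thesis by (simp only: quad_char_square[OF odd uv(1)] quad_char_square[OF odd uv(2)] mult_1)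
    qed
    finally show "(\<Sum>w\<in>?N. \<Sum>a<?q. of_int (?c u * ?c v * ?c w) * omega (- x * u * v * w) ^ a) =
        of_nat ?q * of_int (quad_char k * (quad_char (1 + u) * quad_char (1 + v) * quad_char (1 + k / (u
            * v))))" .
  qed
  also have "\<dots> = of_nat ?q * of_int (quad_char k *
    (\<Sum>u\<in>?N. \<Sum>v\<in>?N. quad_char (1 + u) * quad_char (1 + v) * quad_char (1 + k / (u * v))))"
    by (simp only: of_int_mult of_int_sum sum_distrib_left)
  finally show ?thesis using q0 by (simp del: of_int_mult of_int_sum)
qed

section \<open>The function with parameters 1/4 and 3/4\<close>

definition jacobi_triple :: "nat \<Rightarrow> 'p padic" where
  "jacobi_triple a = (\<Sum>u\<in>- {0 :: 'p mod_ring}. \<Sum>v\<in>- {0}. of_int (quad_char (1 + u + v))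
      * inverse (omega (u * v)) ^ a)"

text \<open>The two factors can be evaluated only together: in general 1/4 - a/(p-1) has a
  denominator beyond p - 1, and the duplication formula needs both arguments.\<close>

lemma factor_2G2:
  assumes a: "a < CARD('p) - 1"
  defines "F \<equiv> \<lambda>b. let q = of_nat a / of_nat (CARD('p) - 1) in
     (- of_nat CARD('p)) powi (- \<lfloor>frac b - q\<rfloor> - \<lfloor>frac (- 0) + q\<rfloor>) *
     (Gamma_rat (frac (b - q)) / Gamma_rat (frac b)) *
     (Gamma_rat (frac (- 0 + q)) / Gamma_rat (frac (- 0)))"
  shows "F (1 / 4) * F (3 / 4) = inverse (omega (4 :: 'p mod_ring)) ^ a * jacobi_triple a"
proof -
  define q h where "q = CARD('p) - 1" and "h = q div 2"
  have aq: "a < q" using a by (simp add: q_def)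
  have "even q" using odd by (simp add: q_def)
  then have h2: "q = h + h" unfolding h_def by presburger
  have q0: "(of_nat q :: rat) > 0" using aq by simp
  have quarter: "(1 / 4 :: rat) = of_nat h / of_nat (2 * q)"
    using arg_cong[OF h2, of "of_nat :: nat \<Rightarrow> rat"] q0 by (simp add: field_simps)
  have hq: "h < q" using h2 aq by simp
  \<comment> \<open>With h/(2q) = 1/4 one has 1/4 - a/q = (h - 2a)/(2q). The number e shifts h - 2a
    by multiples of q to r in [0, q), so this is r/(2q) - e/2; as a < q, e is at most 2.\<close>
  obtain e where e: "e \<in> {0, 1, 2}" "2 * a \<le> h + e * q" "h + e * q < 2 * a + q"
  proof -
    consider "2 * a \<le> h" | "h < 2 * a" "2 * a \<le> h + q" | "h + q < 2 * a" by linarith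
    then show ?thesis
    proof cases
      case 1
      then show ?thesis using hq by (intro that[of 0]) auto
    next
      case 2
      then show ?thesis using hq by (intro that[of 1]) auto
    next
      case 3
      then show ?thesis using hq aq by (intro that[of 2]) auto
    qed
  qed
  define r where "r = h + e * q - 2 * a"
  have ra: "r + 2 * a = h + e * q" and rq: "r < q" using e by (auto simp: r_def)
  have "of_nat r + 2 * of_nat a = (of_nat h + of_nat e * of_nat q :: rat)"
    using arg_cong[OF ra, of "of_nat :: nat \<Rightarrow> rat"] by simp
  then have r: "(of_nat r :: rat) = of_nat h - 2 * of_nat a + of_nat e * of_nat q" by simp
  define X0 where "X0 = (of_nat r / of_nat (2 * q) :: rat)"
  have X0: "0 \<le> X0" "X0 < 1 / 2" using rq q0 by (simp_all add: X0_def field_simps)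
  have y: "1 / 4 - of_nat a / of_nat q = X0 - of_nat e / 2"
    unfolding quarter X0_def r using q0 by (simp add: field_simps)
  have y': "3 / 4 - of_nat a / of_nat q = (1 / 4 - of_nat a / of_nat q) + (1 / 2 :: rat)" by simp
  note f = floor_frac_minus_nat
  have f1: "\<lfloor>X0\<rfloor> = 0" "frac X0 = X0" "\<lfloor>X0 - 1\<rfloor> = - 1" "frac (X0 - 1) = X0"
    using f[of X0 0] f[of X0 1] X0 by simp_all
  have f2: "\<lfloor>X0 + 1 / 2\<rfloor> = 0" "frac (X0 + 1 / 2)
      = X0 + 1 / 2" "\<lfloor>X0 - 1 / 2\<rfloor> = - 1" "frac (X0 - 1 / 2) = X0 + 1 / 2"
    using f[of "X0 + 1 / 2" 0] f[of "X0 + 1 / 2" 1] X0 by simp_all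
  let ?y = "1 / 4 - of_nat a / of_nat q :: rat" and ?y' = "3 / 4 - of_nat a / of_nat q :: rat"
  have y'': "?y' = X0 - of_nat e / 2 + 1 / 2" unfolding y' y ..
  \<comment> \<open>For e = 1 the two fractional parts trade places; their product of gamma values
    does not notice, and the floors add up to -e in all cases.\<close>
  have "- \<lfloor>?y\<rfloor> - \<lfloor>?y'\<rfloor> = int e \<and> Gamma_rat (frac ?y)
      * Gamma_rat (frac ?y') = Gamma_rat X0 * (Gamma_rat (X0 + 1 / 2) :: 'p padic)"
    unfolding y y'' using e(1) by (auto simp: f1 f2)
  then have fl: "- \<lfloor>?y\<rfloor> - \<lfloor>?y'\<rfloor> = int e"
    and GG: "Gamma_rat (frac ?y) * Gamma_rat (frac ?y') = omega (2 :: 'p mod_ring) ^ r * (gam r * gam h)"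
    using Gamma_rat_duplication[OF odd rq[unfolded q_def]] unfolding X0_def q_def h_def by auto
  have GG0: "Gamma_rat (1 / 4) * Gamma_rat (3 / 4) = omega (2 :: 'p mod_ring) ^ h * (gam h * gam h)"
  proof -
    have "(3 / 4 :: rat) = 1 / 4 + 1 / 2" by simp
    then show ?thesis
      using Gamma_rat_duplication[OF odd hq[unfolded q_def]]
          unfolding q_def[symmetric] h_def[symmetric] quarter[symmetric] by simp
  qed
  have a1: "0 \<le> (of_nat a / of_nat q :: rat)" "(of_nat a / of_nat q :: rat) < 1" using aq q0 by simp_all
  have fa: "\<lfloor>of_nat a / of_nat q :: rat\<rfloor> = 0" "frac (of_nat a / of_nat q :: rat)
      = of_nat a / of_nat q"
    using f[OF a1, of 0] by simp_all
  have frac: "frac (1 / 4 :: rat) = 1 / 4" "frac (3 / 4 :: rat) = 3 / 4" "frac (- 0 :: rat) = 0"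
      by (simp_all add: frac_eq)
  have G: "Gamma_rat (of_nat a / of_nat q) = (gam a :: 'p padic)" "Gamma_rat 0 = (gam 0 :: 'p padic)"
    unfolding gam_def[OF odd] q_def[symmetric] by simp_all
  have F: "F b = (- qp_p) powi (- \<lfloor>frac b - of_nat a / of_nat q\<rfloor>) * (Gamma_rat (frac (b
      - of_nat a / of_nat q)) / Gamma_rat (frac b)) * gam a" for b
    unfolding F_def Let_def q_def[symmetric] frac by (simp add: fa G gam_0[OF odd])
  have "(- qp_p) powi (- \<lfloor>?y\<rfloor>) * (- qp_p) powi (- \<lfloor>?y'\<rfloor>)
      = ((- qp_p) powi (- \<lfloor>?y\<rfloor> - \<lfloor>?y'\<rfloor>) :: 'p padic)"
    using power_int_add[of "- qp_p :: 'p padic" "- \<lfloor>?y\<rfloor>" "- \<lfloor>?y'\<rfloor>"] by simp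
  also have "\<dots> = (- qp_p) ^ e" unfolding fl by (rule power_int_of_nat)
  finally have P: "(- qp_p) powi (- \<lfloor>?y\<rfloor>) * (- qp_p) powi (- \<lfloor>?y'\<rfloor>)
      = ((- qp_p) ^ e :: 'p padic)" .
  have gh: "gam h \<noteq> (0 :: 'p padic)" by (rule gam_neq_0[OF odd])
  have "F (1 / 4) * F (3 / 4) = ((- qp_p) powi (- \<lfloor>?y\<rfloor>)
      * (- qp_p) powi (- \<lfloor>?y'\<rfloor>)) *
      ((Gamma_rat (frac ?y) * Gamma_rat (frac ?y')) / (Gamma_rat (1 / 4) * Gamma_rat (3 / 4))) * gam a ^ 2"
    unfolding F frac by (simp add: power2_eq_square)
  also have "\<dots> = (omega 2 ^ r / omega 2 ^ h) * ((- qp_p) ^ e * gam r * gam a ^ 2 / gam h)"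
    unfolding P GG GG0 using gh by (simp add: field_simps)
  also have "(- qp_p) ^ e * gam r * gam a ^ 2 = jacobi_triple a * gam h"
    using gam_product_3[OF odd rq[unfolded q_def] a ra[unfolded h_def q_def]]
        unfolding jacobi_triple_def h_def q_def .
  \<comment> \<open>Since r - h = e q - 2a and omega(2)^q = 1, only omega(2)^(-2a) remains.\<close>
  also have "omega 2 ^ r / omega 2 ^ h = inverse (omega (4 :: 'p mod_ring)) ^ a"
  proof -
    have o2: "omega (2 :: 'p mod_ring) \<noteq> 0" using two_neq_0[OF odd] by simp
    have "omega (4 :: 'p mod_ring) = omega 2 ^ 2" using omega_power[of "2 :: 'p mod_ring" 2] by simp
    then have 4: "omega (4 :: 'p mod_ring) ^ a = omega 2 ^ (2 * a)" by (simp add: power_mult)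
    have "omega 2 ^ r * omega 2 ^ (2 * a) = omega (2 :: 'p mod_ring) ^ h * (omega 2 ^ q) ^ e"
      unfolding power_add[symmetric] power_mult[symmetric] ra by (simp only: mult.commute[of q e])
    also have "omega (2 :: 'p mod_ring) ^ q = 1" unfolding q_def
        by (rule omega_power_pred[OF two_neq_0[OF odd]])
    finally have "omega 2 ^ r * omega 4 ^ a = omega (2 :: 'p mod_ring) ^ h" unfolding 4 by simp
    moreover have "omega (4 :: 'p mod_ring) ^ a \<noteq> 0" unfolding 4 using o2 by simp
    ultimately show ?thesis using o2 by (simp add: power_inverse field_simps)
  qed
  finally show ?thesis using gh by simp
qed

text \<open>Here a occurs as the exponent of omega(1/(4tuv)), so the summation over a leaves only v
  = 1/(4tu).\<close>

lemma nGn_2G2: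
  fixes t :: "'p mod_ring"
  assumes t: "t \<noteq> 0"
  shows "nGn [1/4, 3/4] [0, 0] t = of_int (- (\<Sum>u\<in>- {0}. quad_char (1 + (u + 1 / (4 * t) / u))))"
proof -
  let ?q = "CARD('p) - 1" and ?N = "- {0 :: 'p mod_ring}"
  have set: "{0..CARD('p) - 2} = {..<?q}" using CARD_ge_3[OF odd] by auto
  have q0: "(of_nat ?q :: 'p padic) \<noteq> 0" by (rule of_nat_pred_neq_0)
  have t4: "4 * t \<noteq> 0" using t four_neq_0[OF odd] by simp
  have "nGn [1/4, 3/4] [0, 0] t =
      - 1 / of_nat ?q * (\<Sum>a<?q. (- 1) ^ (a * 2) * teichmueller_bar_power a t
          * (inverse (omega (4 :: 'p mod_ring)) ^ a * jacobi_triple a))"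
    unfolding nGn_def set
  proof (intro arg_cong[where f="\<lambda>y. - 1 / of_nat ?q * y"] sum.cong refl)
    fix a assume "a \<in> {..<?q}"
    then have a: "a < ?q" by simp
    show "(- 1) ^ (a * length [1/4, 3/4 :: rat]) * teichmueller_bar_power a t *
        (\<Prod>k<length [1/4, 3/4 :: rat]. let q = of_nat a / of_nat (CARD('p) - 1) in
           (- of_nat CARD('p)) powi (- \<lfloor>frac ([1/4, 3/4] ! k) - q\<rfloor>
               - \<lfloor>frac (- ([0, 0] ! k)) + q\<rfloor>) *
           (Gamma_rat (frac ([1/4, 3/4] ! k - q)) / Gamma_rat (frac ([1/4, 3/4] ! k))) *
           (Gamma_rat (frac (- ([0, 0] ! k) + q)) / Gamma_rat (frac (- ([0, 0] ! k)))))
        = (- 1) ^ (a * 2) * teichmueller_bar_power a t * (inverse (omega 4) ^ a * jacobi_triple a)"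
    proof -
      have len: "length [1/4, 3/4 :: rat] = Suc (Suc 0)" by simp
      show ?thesis
        unfolding factor_2G2[OF a, symmetric]
        unfolding len prod.lessThan_Suc lessThan_0 prod.empty nth_Cons_0 nth_Cons_Suc
        by (simp only: numeral_2_eq_2 mult_1)
    qed
  qed
  also have "(\<Sum>a<?q. (- 1) ^ (a * 2) * teichmueller_bar_power a t
      * (inverse (omega (4 :: 'p mod_ring)) ^ a * jacobi_triple a)) =
      (\<Sum>a<?q. \<Sum>u\<in>?N. \<Sum>v\<in>?N. of_int (quad_char (1 + u + v)) * omega (inverse (4 * t
          * (u * v))) ^ a)"
  proof (rule sum.cong[OF refl])
    fix a
    have "(- 1 :: 'p padic) ^ (a * 2) = 1" by simp
    moreover have "teichmueller_bar_power a t = inverse (omega t) ^ a"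
      using t by (simp add: teichmueller_bar_power_eq)
    moreover have "omega (inverse (4 * t * (u * v))) ^ a = inverse (omega t) ^ a * (inverse (omega 4) ^ a
        * inverse (omega (u * v)) ^ a)" for u v
      unfolding omega_inverse unfolding omega_mult[of "4 * t"] omega_mult[of 4 t]
      unfolding inverse_mult_distrib power_mult_distrib by (simp only: mult_ac)
    ultimately show "(- 1) ^ (a * 2) * teichmueller_bar_power a t * (inverse (omega (4 :: 'p mod_ring)) ^ a
        * jacobi_triple a) =
      (\<Sum>u\<in>?N. \<Sum>v\<in>?N. of_int (quad_char (1 + u + v)) * omega (inverse (4 * t * (u * v))) ^ a)"
      unfolding jacobi_triple_def by (simp only: sum_distrib_left mult_1 mult_ac)
  qed
  also have "\<dots> = (\<Sum>u\<in>?N. \<Sum>a<?q. \<Sum>v\<in>?N. of_int (quad_char (1 + u + v))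
      * omega (inverse (4 * t * (u * v))) ^ a)"
    by (rule sum.swap)
  also have "\<dots> = (\<Sum>u\<in>?N. \<Sum>v\<in>?N. \<Sum>a<?q. of_int (quad_char (1 + u + v))
      * omega (inverse (4 * t * (u * v))) ^ a)"
    by (rule sum.cong[OF refl], rule sum.swap)
  also have "\<dots> = (\<Sum>u\<in>?N. of_nat ?q * of_int (quad_char (1 + (u + 1 / (4 * t) / u))))"
  proof (rule sum.cong[OF refl])
    fix u assume "u \<in> ?N"
    then have u: "u \<noteq> 0" by simp
    let ?v = "1 / (4 * t) / u"
    have "(\<Sum>v\<in>?N. \<Sum>a<?q. of_int (quad_char (1 + u + v)) * omega (inverse (4 * t * (u * v))) ^ a) =
        (\<Sum>v\<in>?N. if v = ?v then of_nat ?q * of_int (quad_char (1 + u + v)) else 0)"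
    proof (rule sum.cong[OF refl])
      fix v assume "v \<in> ?N"
      then have nz: "inverse (4 * t * (u * v)) \<noteq> 0" using t4 u by simp
      have "inverse (4 * t * (u * v)) = 1 \<longleftrightarrow> (v * u) * (4 * t) = 1"
          by (simp only: inverse_eq_1_iff mult_ac)
      also have "\<dots> \<longleftrightarrow> v = ?v" using u t4
          by (simp only: nonzero_eq_divide_eq not_False_eq_True)
      finally have iff: "inverse (4 * t * (u * v)) = 1 \<longleftrightarrow> v = ?v" .
      show "(\<Sum>a<?q. of_int (quad_char (1 + u + v)) * omega (inverse (4 * t * (u * v))) ^ a) =
          (if v = ?v then of_nat ?q * of_int (quad_char (1 + u + v)) else 0)"
        unfolding sum_distrib_left[symmetric] sum_omega_powers[OF odd nz] iff by simp
    qed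
    also have "\<dots> = of_nat ?q * of_int (quad_char (1 + u + ?v))"
      using u t4 by (intro sum_nonzero_delta) simp
    finally show "(\<Sum>v\<in>?N. \<Sum>a<?q. of_int (quad_char (1 + u + v)) * omega (inverse (4 * t * (u
        * v))) ^ a) =
        of_nat ?q * of_int (quad_char (1 + (u + ?v)))" by (simp only: add.assoc)
  qed
  also have "\<dots> = of_nat ?q * of_int (\<Sum>u\<in>?N. quad_char (1 + (u + 1 / (4 * t) / u)))"
    by (simp only: of_int_sum sum_distrib_left)
  finally show ?thesis using q0 by (simp del: of_int_sum)
qed

text \<open>For c = 1/(4m) the discriminant in \<open>sum_plus_quotient\<close> is v^2 - 1/m, and
  the part of the sum without it is a complete sum of phi, hence 0.\<close>

lemma sum_2G2_eq:
  fixes m :: "'p mod_ring"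
  assumes m: "m \<noteq> 0"
  shows "(\<Sum>u\<in>- {0}. quad_char (1 + (u + 1 / (4 * m) / u))) =
    quad_char m * (\<Sum>v\<in>UNIV. quad_char (1 + v) * quad_char (m * v ^ 2 - 1))"
proof -
  have c: "1 / (4 * m) \<noteq> 0" using m four_neq_0[OF odd] by simp
  have 4: "4 * (1 / (4 * m)) = 1 / m" using four_neq_0[OF odd] m by simp
  have "(\<Sum>u\<in>- {0}. quad_char (1 + (u + 1 / (4 * m) / u)))
      = (\<Sum>v\<in>UNIV. (1 + quad_char (v ^ 2 - 1 / m)) * quad_char (1 + v))"
    using sum_plus_quotient[OF odd c, of "\<lambda>v. quad_char (1 + v)"] unfolding 4 .
  also have "\<dots> = (\<Sum>v\<in>(UNIV :: 'p mod_ring set). quad_char (v + 1))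
      + (\<Sum>v\<in>UNIV. quad_char m * (quad_char (1 + v) * quad_char (m * v ^ 2 - 1)))"
  proof -
    have "(1 + quad_char (v ^ 2 - 1 / m)) * quad_char (1 + v)
        = quad_char (v + 1) + quad_char m * (quad_char (1 + v) * quad_char (m * v ^ 2
        - 1))" for v :: "'p mod_ring"
    proof -
      have "m * v ^ 2 - 1 = m * (v ^ 2 - 1 / m)" using m by (simp add: right_diff_distrib)
      then have "quad_char m * quad_char (m * v ^ 2 - 1) = quad_char (v ^ 2 - 1 / m)"
        using m by (simp only: quad_char_mult[OF odd] quad_char_square_left[OF odd] not_False_eq_True)
      then show ?thesis by (simp add: distrib_right add.commute flip: \<open>quad_char m * _ = _\<close>)
    qed
    then show ?thesis by (simp only: sum.distrib)
  qed
  also have "(\<Sum>v\<in>UNIV. quad_char (v + 1 :: 'p mod_ring)) = 0"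
      by (simp only: sum_translate[OF odd] sum_quad_char[OF odd])
  finally show ?thesis by (simp only: sum_distrib_left add_0)
qed

text \<open>The substitution w = u v and the parity of phi under inversion clear the denominators;
  afterwards the terms with u = 0 or w = 0 vanish and the sums extend to all elements.\<close>

lemma sum_3G3_eq:
  fixes k :: "'p mod_ring"
  shows "(\<Sum>u\<in>- {0}. \<Sum>v\<in>- {0}. quad_char (1 + u) * quad_char (1 + v) * quad_char (1
      + k / (u * v))) =
    (\<Sum>u\<in>UNIV. \<Sum>w\<in>UNIV. quad_char (u * (u + 1)) * quad_char (w * (w + k) * (w + u)))"
proof -
  let ?N = "- {0 :: 'p mod_ring}"
  have "(\<Sum>u\<in>?N. \<Sum>v\<in>?N. quad_char (1 + u) * quad_char (1 + v) * quad_char (1 + k / (u * v))) =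
     (\<Sum>u\<in>?N. \<Sum>w\<in>?N. quad_char (u * (u + 1)) * quad_char (w * (w + k) * (w + u)))"
  proof (rule sum.cong[OF refl])
    fix u assume "u \<in> ?N"
    then have u: "u \<noteq> 0" by simp
    then have iu: "inverse u \<noteq> 0" by simp
    have "(\<Sum>v\<in>?N. quad_char (1 + u) * quad_char (1 + v) * quad_char (1 + k / (u * v))) =
        (\<Sum>w\<in>?N. quad_char (1 + u) * quad_char (1 + inverse u * w) * quad_char (1 + k / (u
            * (inverse u * w))))"
      by (rule sum_nonzero_scale[OF odd iu, symmetric])
    also have "\<dots> = (\<Sum>w\<in>?N. quad_char (u * (u + 1)) * quad_char (w * (w + k) * (w + u)))"
    proof (rule sum.cong[OF refl])
      fix w assume "w \<in> ?N"
      then have w: "w \<noteq> 0" by simp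
      have "u * (inverse u * w) = w" using u by simp
      moreover have "1 + inverse u * w = (w + u) / u" using u by (simp add: field_simps)
      moreover have "1 + k / w = (w + k) / w" using w by (simp add: add_divide_distrib)
      moreover have "1 + u = u + 1" by simp
      ultimately show "quad_char (1 + u) * quad_char (1 + inverse u * w) * quad_char (1 + k / (u
          * (inverse u * w))) =
          quad_char (u * (u + 1)) * quad_char (w * (w + k) * (w + u))"
        by (simp only: quad_char_mult[OF odd] quad_char_divide[OF odd] mult_ac)
    qed
    finally show "(\<Sum>v\<in>?N. quad_char (1 + u) * quad_char (1 + v) * quad_char (1 + k / (u * v))) =
        (\<Sum>w\<in>?N. quad_char (u * (u + 1)) * quad_char (w * (w + k) * (w + u)))" .
  qed
  also have "\<dots> = (\<Sum>u\<in>UNIV. \<Sum>w\<in>UNIV. quad_char (u * (u + 1)) * quad_char (w * (w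
      + k) * (w + u)))"
    by (simp add: sum_nonzero[OF odd])
  finally show ?thesis .
qed

end

theorem theorem1p3:
  fixes x :: "'p :: prime_card mod_ring"
  assumes "odd CARD('p)"
    and "x \<noteq> 0" and "x \<noteq> 1"
  shows "nGn [1/2, 1/2, 1/2] [0, 0, 0] (1 / x) =
           of_int (quad_char (1 - x)) * (nGn [1/4, 3/4] [0, 0] ((x - 1) / x)) ^ 2
           - of_nat CARD('p) * of_int (quad_char (1 - x))"
proof -
  note odd = assms(1)
  define k m where "k = - 1 / x" and "m = (x - 1) / x"
  have k: "k \<noteq> 0" and m: "m \<noteq> 0" using assms(2,3) by (simp_all add: k_def m_def)
  have mk: "m = k + 1" using assms(2) by (simp add: k_def m_def diff_divide_distrib)
  \<comment> \<open>The sign phi(k) of the first function and phi(m) from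
    \<open>clausen_quad_char\<close> combine to phi(1 - x), while the sign phi(m) of the second
    function disappears on squaring.\<close>
  have "1 - x = m / k" using assms(2) by (simp add: k_def m_def)
  then have kx: "quad_char (1 - x) = quad_char k * quad_char m"
    by (simp add: quad_char_divide[OF odd] mult.commute)
  let ?B = "\<Sum>v\<in>UNIV. quad_char (1 + v) * quad_char (m * v ^ 2 - 1)"
  have "nGn [1/4, 3/4] [0, 0] m = of_int (- (quad_char m * ?B))"
    unfolding nGn_2G2[OF odd m] sum_2G2_eq[OF odd m] ..
  then have "(nGn [1/4, 3/4] [0, 0] m) ^ 2 = of_int ((quad_char m * quad_char m) * ?B ^ 2)"
    by (simp add: power2_eq_square mult_ac)
  then have 2: "(nGn [1/4, 3/4] [0, 0] m) ^ 2 = of_int (?B ^ 2)"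
    unfolding quad_char_square[OF odd m] mult_1 .
  have "nGn [1/2, 1/2, 1/2] [0, 0, 0] (1 / x) = of_int (quad_char k * (quad_char m * (?B ^ 2 - int CARD('p))))"
    unfolding nGn_3G3[OF odd assms(2)] k_def[symmetric] sum_3G3_eq[OF odd] clausen_quad_char[OF odd k m mk] ..
  also have "\<dots> = of_int (quad_char (1 - x)) * of_int (?B ^ 2) - of_nat CARD('p)
      * of_int (quad_char (1 - x))"
    unfolding kx by (simp add: algebra_simps)
  finally show ?thesis unfolding m_def[symmetric] 2 .
qed

end
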